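(* Let $\mathbb T^3=\mathbb R^3/\mathbb Z^3$ carry the flat metric $dx^2+dy^2+dz^2$, and for $N\in\mathbb N=\{1,2,\dots\}$ let $$H_N=-\frac{\partial^2}{\partial x^2}-\left(\frac{\partial}{\partial y}-2\pi N i x\right)^2-\frac{\partial^2}{\partial z^2}$$ be the magnetic Laplacian acting on sections of $L^N$, where $L\to\mathbb T^3$ is the Hermitian line bundle described in the context. For $\varphi\in\mathcal S(\mathbb R)$ let $Y_N(\varphi)=\operatorname{tr}\varphi\left(\frac1N H_N\right)$. Then for every $\varphi\in\mathcal S(\mathbb R)$, $$Y_N(\varphi)=f_0(\varphi)\,N^{3/2}+\mathcal O(N^{-\infty}),\qquad N\to\infty,$$ where $$f_0(\varphi)=\frac{e^{-\frac14\pi i}}{8\pi^{3/2}}\left\langle \frac{1}{(t+i0)^{1/2}\sin 2\pi(t+i0)},\hat\varphi(t)\right\rangle .$$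
   Context: Magnetic field: $F=2\pi\,dx\wedge dy$. Smooth sections of $L$ on $\mathbb T^3$ are identified with $u\in C^\infty(\mathbb R^3)$ satisfying $u(x+1,y,z)=e^{2\pi i y}u(x,y,z)$, $u(x,y+1,z)=u(x,y,z+1)=u(x,y,z)$, with Hermitian structure given by $|u|$; correspondingly, smooth sections of $L^N=L^{\otimes N}$ are identified with $u\in C^\infty(\mathbb R^3)$ satisfying $u(x+1,y,z)=e^{2\pi i N y}u(x,y,z)$, $u(x,y+1,z)=u(x,y,z+1)=u(x,y,z)$. The Hermitian connection on $L$ is $\nabla^L=d-2\pi i x\,dy$ (so on $L^N$ it is $d-2\pi iNx\,dy$), and $H_N=\Delta^{L^N}=(\nabla^{L^N})^*\nabla^{L^N}$. $H_N$ is self-adjoint in $L^2(\mathbb T^3,L^N)$ with discrete spectrum; if $\nu_{N,j}$, $j=0,1,2,\dots$, are its eigenvalues counted with multiplicity, then $Y_N(\varphi)=\operatorname{tr}\varphi(\frac1N H_N)=\sum_{j\ge0}\varphi\left(\frac1N\nu_{N,j}\right)$. The notation $\mathcal O(N^{-\infty})$ means $\mathcal O(N^{-k})$ for every $k\in\mathbb N$. Fourier transform: $\hat\varphi(k)=\int_{\mathbb R}\varphi(\lambda)e^{-ik\lambda}\,d\lambda$. The distribution in $f_0$ is defined by $$\left\langle\frac{1}{(t+i0)^{1/2}\sin 2\pi(t+i0)},\psi\right\rangle=\lim_{\varepsilon\to0+}\int_{\mathbb R}\frac{\psi(t)}{(t+i\varepsilon)^{1/2}\sin 2\pi(t+i\varepsilon)}\,dt,\qquad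 \psi\in\mathcal S(\mathbb R).$$ Branch convention: in the upper half-plane, $w^{1/2}$ denotes the branch of the square root with $\arg w\in(-2\pi,-\pi)$, i.e. $w^{1/2}$ is the negative of the principal square root (so that $i^{1/2}=e^{-3\pi i/4}$). *)

theory Defs
  imports "HOL-Analysis.Analysis" "HOL-Library.Function_Algebras" "HOL-Library.Landau_Symbols"
begin

definition dir_deriv :: "'a \<Rightarrow> ('a::real_normed_vector \<Rightarrow> complex) \<Rightarrow> 'a \<Rightarrow> complex" where
  "dir_deriv v f = (\<lambda>p. frechet_derivative f (at p) v)"

fun C_k :: "nat \<Rightarrow> ('a::euclidean_space \<Rightarrow> complex) \<Rightarrow> bool" where
  "C_k 0 f \<longleftrightarrow> continuous_on UNIV f"
| "C_k (Suc k) f \<longleftrightarrow> (\<forall>p. f differentiable (at p)) \<and> (\<forall>v. C_k k (dir_deriv v f))"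

definition C_infinity :: "('a::euclidean_space \<Rightarrow> complex) \<Rightarrow> bool" where
  "C_infinity f \<longleftrightarrow> (\<forall>k. C_k k f)"


section \<open>The magnetic Laplacian on \<open>L\<^sup>N\<close>\<close>

definition smooth_sections :: "nat \<Rightarrow> (real \<times> real \<times> real \<Rightarrow> complex) set" where
  "smooth_sections N = {u. C_infinity u \<and>
     (\<forall>x y z. u (x + 1, y, z) = exp (2 * of_real pi * \<i> * of_nat N * of_real y) * u (x, y, z) \<and>
              u (x, y + 1, z) = u (x, y, z) \<and>
              u (x, y, z + 1) = u (x, y, z))}"

definition nabla_x :: "(real \<times> real \<times> real \<Rightarrow> complex) \<Rightarrow> real \<times> real \<times> real \<Rightarrow> complex" where
  "nabla_x = dir_deriv (1, 0, 0)"

definition nabla_y :: "nat \<Rightarrow> (real \<times> real \<times> real \<Rightarrow> complex) \<Rightarrow> real \<times> real \<times> real \<Rightarrow> complex" where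
  "nabla_y N u = (\<lambda>(x, y, z). dir_deriv (0, 1, 0) u (x, y, z) - 2 * of_real pi * of_nat N * \<i> * of_real x * u (x, y, z))"

definition nabla_z :: "(real \<times> real \<times> real \<Rightarrow> complex) \<Rightarrow> real \<times> real \<times> real \<Rightarrow> complex" where
  "nabla_z = dir_deriv (0, 0, 1)"

definition magnetic_laplacian ::
    "nat \<Rightarrow> (real \<times> real \<times> real \<Rightarrow> complex) \<Rightarrow> real \<times> real \<times> real \<Rightarrow> complex" where
  "magnetic_laplacian N u =
     (\<lambda>p. - nabla_x (nabla_x u) p - nabla_y N (nabla_y N u) p - nabla_z (nabla_z u) p)"

text \<open>
  The operator is elliptic and formally self-adjoint on a compact manifold, so the eigenfunctions
  of its self-adjoint realisation in \<open>L\<^sup>2\<close> are smooth and its eigenvalues are real; eigenspaces are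
  therefore taken inside the smooth sections and indexed by a real \<open>\<mu>\<close>.
\<close>

definition eigenspace :: "nat \<Rightarrow> real \<Rightarrow> (real \<times> real \<times> real \<Rightarrow> complex) set" where
  "eigenspace N \<mu> =
     {u \<in> smooth_sections N. \<forall>p. magnetic_laplacian N u p = of_real \<mu> * u p}"

interpretation cfun: vector_space "\<lambda>(c::complex) (f :: 'a \<Rightarrow> complex) p. c * f p"
  by unfold_locales (auto simp: fun_eq_iff algebra_simps)

text \<open>Complex dimension. The eigenspaces are finite-dimensional, so the convention that
  \<^const>\<open>cfun.dim\<close> is \<open>0\<close> in infinite dimension plays no role, and \<open>eigen_mult N \<mu> = 0\<close>
  exactly when \<open>\<mu>\<close> is not an eigenvalue.\<close>

definition eigen_mult :: "nat \<Rightarrow> real \<Rightarrow> nat" where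
  "eigen_mult N \<mu> = cfun.dim (eigenspace N \<mu>)"

text \<open>The trace of \<open>\<phi> (H / N)\<close>: each eigenvalue \<open>\<mu>\<close> contributes one index \<open>(\<mu>, j)\<close> for every
  \<open>j\<close> below its multiplicity.\<close>

definition Y :: "nat \<Rightarrow> (real \<Rightarrow> complex) \<Rightarrow> complex" where
  "Y N \<phi> = (\<Sum>\<^sub>\<infinity>(\<mu>, j) \<in> {(\<mu>, j). j < eigen_mult N \<mu>}. \<phi> (\<mu> / real N))"


section \<open>Schwartz functions, Fourier transform and the leading coefficient\<close>

definition schwartz :: "(real \<Rightarrow> complex) set" where
  "schwartz = {\<phi>. C_infinity \<phi> \<and>
     (\<forall>k m. \<exists>C. \<forall>t. \<bar>t\<bar> ^ k * norm ((dir_deriv 1 ^^ m) \<phi> t) \<le> C)}"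

definition fourier :: "(real \<Rightarrow> complex) \<Rightarrow> real \<Rightarrow> complex" where
  "fourier \<phi> k = (LINT s|lborel. \<phi> s * exp (- \<i> * of_real (k * s)))"

text \<open>On the upper half-plane this is the branch with argument of \<open>w\<close> in \<open>(-2\<pi>, -\<pi>)\<close>, whereas
  \<^const>\<open>csqrt\<close> is the principal branch.\<close>

definition uhp_sqrt :: "complex \<Rightarrow> complex" where
  "uhp_sqrt w = - csqrt w"

definition dist_pairing :: "(real \<Rightarrow> complex) \<Rightarrow> complex" where
  "dist_pairing \<psi> = Lim (at_right 0) (\<lambda>\<epsilon>::real.
     LINT t|lborel. \<psi> t / (uhp_sqrt (of_real t + \<i> * of_real \<epsilon>)
                             * sin (2 * of_real pi * (of_real t + \<i> * of_real \<epsilon>))))"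

definition f_0 :: "(real \<Rightarrow> complex) \<Rightarrow> complex" where
  "f_0 \<phi> = exp (- (1 / 4) * of_real pi * \<i>) / of_real (8 * pi powr (3 / 2)) * dist_pairing (fourier \<phi>)"

end

theory Submission
  imports Defs "HOL-Real_Asymp.Real_Asymp" "HOL-Probability.Probability" "HOL-Complex_Analysis.Complex_Analysis"
begin

text \<open>
  Expanding a section into a Fourier series in \<open>y\<close> and \<open>z\<close> turns \<open>H\<^sub>N\<close> into a family of shifted harmonic
  oscillators in \<open>x\<close>. Smooth sections are bounded and are preserved by the annihilation operator, and a
  bounded solution of the oscillator equation below the ground energy vanishes by convexity, so descending
  the ladder leaves only the energies \<open>2\<pi>N(2j+1) + (2\<pi>m)\<^sup>2\<close>. Each pair \<open>(j, m)\<close> has multiplicity \<open>N\<close>, the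
  eigensections being obtained from theta functions by the creation operator. Thus
  \<open>Y\<^sub>N(\<phi>) = N \<Sum>\<^sub>j \<Sum>\<^sub>m \<phi>(2\<pi>(2j+1) + 4\<pi>\<^sup>2m\<^sup>2/N)\<close>, and Euler-Maclaurin summation replaces the sum over \<open>m\<close> by
  \<open>\<surd>N\<close> times the integral of \<open>\<phi>(2\<pi>(2j+1) + 4\<pi>\<^sup>2s\<^sup>2)\<close> in \<open>s\<close>, up to any power of \<open>1/N\<close>.

  The same integrals appear in \<open>f\<^sub>0\<close>: in the upper half-plane \<open>1/sin 2\<pi>w\<close> is a geometric series in
  \<open>e\<^sup>2\<^sup>\<pi>\<^sup>i\<^sup>w\<close> and \<open>w\<close> to the power \<open>-1/2\<close> is a Gaussian integral over \<open>s\<close>, so Fourier inversion evaluates the pairing term by term.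
\<close>

section \<open>Smooth functions\<close>

text \<open>No L2 theory enters. A section is handled through its coefficient functions c_{k,m}(x),
  and smooth sections with equal coefficients coincide, so operator identities become identities
  between functions of x. A section is only quasi-periodic in x: the step x -> x + 1 shifts k by N,
  hence the coefficients with 0 <= k < N determine it. This is where the multiplicity N comes from.
  Boundedness of c_{k,m} takes the place of square integrability of oscillator eigenfunctions.

  The asymptotics must survive the sum over j, so every estimate of the sum over m carries the
  weight 1/(1 + l)^2 at energy offset l. Each integration by parts against a periodic kernel of mean
  zero gains h = 1/sqrt N, and it can be repeated because such a kernel has a primitive of the same
  kind.

  The constants match as follows: the inverse root gives -2 sqrt(pi) e^(-i pi/4), the minus sign
  being the chosen branch, and the inverse sine gives -2i. Together with the 2 pi of Fourier
  inversion and the prefactor of \<open>f_0\<close> the product is i (e^(-i pi/4))^2 = 1.\<close>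

lemma dir_deriv_eqI: "(f has_derivative F) (at p) \<Longrightarrow> dir_deriv v f p = F v"
  unfolding dir_deriv_def using frechet_derivative_at by metis

lemma dir_deriv_works: "f differentiable (at p) \<Longrightarrow> (f has_derivative (\<lambda>v. dir_deriv v f p)) (at p)"
  unfolding dir_deriv_def using frechet_derivative_works by metis

text \<open>Reduces directional derivatives to derivatives along curves; the partial derivatives of
  sections are obtained from it with affine curves.\<close>

lemma dir_deriv_chain:
  assumes "f differentiable (at (g t))" "(g has_vector_derivative g') (at t)"
  shows "((\<lambda>t. f (g t)) has_vector_derivative dir_deriv g' f (g t)) (at t)"
proof -
  have "(f has_derivative (\<lambda>v. dir_deriv v f (g t))) (at (g t) within range g)"
    by (rule has_derivative_at_withinI[OF dir_deriv_works[OF assms(1)]])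
  from vector_derivative_diff_chain_within[OF assms(2) this] show ?thesis
    by (simp add: o_def)
qed

lemma C_k_SucD: "C_k (Suc k) f \<Longrightarrow> C_k k f"
proof (induction k arbitrary: f)
  case 0
  then show ?case
    by (auto intro!: continuous_at_imp_continuous_on differentiable_imp_continuous_within)
next
  case (Suc k)
  then show ?case by (metis C_k.simps(2))
qed

lemma C_k_const: "C_k k (\<lambda>p. c)"
proof (induction k arbitrary: c)
  case (Suc k)
  have "dir_deriv v (\<lambda>p. c) = (\<lambda>p. 0)" for v :: 'a and c
    by (rule ext, rule dir_deriv_eqI[where F = "\<lambda>_. 0"]) auto
  with Suc show ?case by simp
qed simp

lemma C_k_add: "C_k k f \<Longrightarrow> C_k k g \<Longrightarrow> C_k k (\<lambda>p. f p + g p)"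
proof (induction k arbitrary: f g)
  case 0
  then show ?case by (auto intro: continuous_intros)
next
  case (Suc k)
  have "dir_deriv v (\<lambda>p. f p + g p) = (\<lambda>p. dir_deriv v f p + dir_deriv v g p)" for v
    using Suc.prems
    by (intro ext dir_deriv_eqI[where F = "\<lambda>v. dir_deriv v f p + dir_deriv v g p" for p])
       (auto intro!: has_derivative_add dir_deriv_works)
  with Suc show ?case by auto
qed

lemma C_k_mult: "C_k k f \<Longrightarrow> C_k k g \<Longrightarrow> C_k k (\<lambda>p. f p * g p)"
proof (induction k arbitrary: f g)
  case 0
  then show ?case by (auto intro: continuous_intros)
next
  case (Suc k)
  have "dir_deriv v (\<lambda>p. f p * g p) = (\<lambda>p. f p * dir_deriv v g p + dir_deriv v f p * g p)" for v
    using Suc.prems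
    by (intro ext dir_deriv_eqI[where F = "\<lambda>v. f p * dir_deriv v g p + dir_deriv v f p * g p" for p])
       (auto intro!: has_derivative_mult dir_deriv_works)
  moreover have "C_k k (\<lambda>p. f p * dir_deriv v g p + dir_deriv v f p * g p)" for v
    using Suc by (intro C_k_add Suc.IH C_k_SucD[OF Suc.prems(1)] C_k_SucD[OF Suc.prems(2)]) auto
  ultimately show ?case using Suc.prems by (auto intro: differentiable_mult)
qed

text \<open>Differentiating in direction v gives \<open>deriv g\<close> after L, times the constant
  L v, so the induction must vary g. This one lemma yields smoothness of the phases, of the Gaussian
  and of the theta factor in the ground states.\<close>

lemma C_k_holomorphic_linear:
  assumes "bounded_linear L"
  shows "g holomorphic_on UNIV \<Longrightarrow> C_k k (\<lambda>p. g (L p))"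
proof (induction k arbitrary: g)
  case 0
  then have "continuous_on UNIV g" by (simp add: holomorphic_on_imp_continuous_on)
  then have "continuous_on UNIV (g \<circ> L)"
    by (intro continuous_on_compose) (auto intro: continuous_on_subset linear_continuous_on[OF assms])
  then show ?case by (simp add: o_def)
next
  case (Suc k)
  have D: "((\<lambda>p. g (L p)) has_derivative (\<lambda>v. deriv g (L p) * L v)) (at p)" for p
  proof -
    have "(g has_field_derivative deriv g (L p)) (at (L p))"
      using Suc.prems by (simp add: holomorphic_derivI)
    then have "(g has_derivative (*) (deriv g (L p))) (at (L p))"
      by (simp add: has_field_derivative_def)
    from has_derivative_compose[OF bounded_linear_imp_has_derivative[OF assms] this]
    show ?thesis by simp
  qed
  have "dir_deriv v (\<lambda>p. g (L p)) = (\<lambda>p. deriv g (L p) * L v)" for v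
    using D by (intro ext dir_deriv_eqI)
  moreover have "C_k k (\<lambda>p. deriv g (L p) * L v)" for v
    by (intro C_k_mult C_k_const Suc.IH holomorphic_deriv Suc.prems open_UNIV)
  ultimately show ?case using D by (auto simp: differentiable_def)
qed

lemma C_infinity_const: "C_infinity (\<lambda>p. c)"
  by (simp add: C_infinity_def C_k_const)

lemma C_infinity_add: "C_infinity f \<Longrightarrow> C_infinity g \<Longrightarrow> C_infinity (\<lambda>p. f p + g p)"
  by (simp add: C_infinity_def C_k_add)

lemma C_infinity_mult: "C_infinity f \<Longrightarrow> C_infinity g \<Longrightarrow> C_infinity (\<lambda>p. f p * g p)"
  by (simp add: C_infinity_def C_k_mult)

lemma C_infinity_cmult: "C_infinity f \<Longrightarrow> C_infinity (\<lambda>p. c * f p)"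
  by (intro C_infinity_mult C_infinity_const)

lemma C_infinity_diff: "C_infinity f \<Longrightarrow> C_infinity g \<Longrightarrow> C_infinity (\<lambda>p. f p - g p)"
  using C_infinity_add[OF _ C_infinity_cmult, of f g "-1"] by simp

lemma C_infinity_holomorphic_linear:
  "g holomorphic_on UNIV \<Longrightarrow> bounded_linear L \<Longrightarrow> C_infinity (\<lambda>p. g (L p))"
  by (simp add: C_infinity_def C_k_holomorphic_linear)

lemma C_infinity_dir_deriv: "C_infinity f \<Longrightarrow> C_infinity (dir_deriv v f)"
  unfolding C_infinity_def by (metis C_k.simps(2))

lemma C_infinity_differentiable: "C_infinity f \<Longrightarrow> f differentiable (at p)"
  by (auto simp: C_infinity_def dest: spec[of _ "Suc 0"])

lemma C_infinity_continuous: "C_infinity f \<Longrightarrow> continuous_on UNIV f"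
  by (auto simp: C_infinity_def dest: spec[of _ 0])


section \<open>Sections of \<open>L\<^sup>N\<close> and their covariant derivatives\<close>

lemma smooth_sections_C_infinity: "u \<in> smooth_sections N \<Longrightarrow> C_infinity u"
  by (simp add: smooth_sections_def)

lemma smooth_sections_shift:
  assumes "u \<in> smooth_sections N"
  shows "u (x + 1, y, z) = exp (2 * of_real pi * \<i> * of_nat N * of_real y) * u (x, y, z)"
    "u (x, y + 1, z) = u (x, y, z)" "u (x, y, z + 1) = u (x, y, z)"
  using assms by (simp_all add: smooth_sections_def)

lemma partial_x:
  "C_infinity u \<Longrightarrow> ((\<lambda>t. u (t, y, z)) has_vector_derivative dir_deriv (1, 0, 0) u (x, y, z)) (at x)"
  by (rule dir_deriv_chain[where g = "\<lambda>t. (t, y, z)"])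
     (auto intro!: C_infinity_differentiable derivative_eq_intros has_vector_derivative_Pair simp: zero_prod_def)

lemma partial_y:
  "C_infinity u \<Longrightarrow> ((\<lambda>t. u (x, t, z)) has_vector_derivative dir_deriv (0, 1, 0) u (x, y, z)) (at y)"
  by (rule dir_deriv_chain[where g = "\<lambda>t. (x, t, z)"])
     (auto intro!: C_infinity_differentiable derivative_eq_intros has_vector_derivative_Pair simp: zero_prod_def)

lemma partial_z:
  "C_infinity u \<Longrightarrow> ((\<lambda>t. u (x, y, t)) has_vector_derivative dir_deriv (0, 0, 1) u (x, y, z)) (at z)"
  by (rule dir_deriv_chain[where g = "\<lambda>t. (x, y, t)"])
     (auto intro!: C_infinity_differentiable derivative_eq_intros has_vector_derivative_Pair simp: zero_prod_def)

lemma dir_deriv_shift: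
  assumes "C_infinity u" "C_infinity v" "\<And>p. u (p + c) = v p"
  shows "dir_deriv w u (p + c) = dir_deriv w v p"
proof -
  have "((\<lambda>t. u (p + c + t *\<^sub>R w)) has_vector_derivative dir_deriv w u (p + c + 0 *\<^sub>R w)) (at 0)"
    by (rule dir_deriv_chain) (auto intro!: C_infinity_differentiable assms derivative_eq_intros)
  moreover have "((\<lambda>t. v (p + t *\<^sub>R w)) has_vector_derivative dir_deriv w v (p + 0 *\<^sub>R w)) (at 0)"
    by (rule dir_deriv_chain) (auto intro!: C_infinity_differentiable assms derivative_eq_intros)
  moreover have "u (p + c + t *\<^sub>R w) = v (p + t *\<^sub>R w)" for t
    using assms(3)[of "p + t *\<^sub>R w"] by (simp add: add_ac)
  ultimately show ?thesis
    using vector_derivative_unique_at by fastforce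
qed

lemma dir_deriv_phase:
  fixes u :: "real \<times> real \<times> real \<Rightarrow> complex"
  assumes "C_infinity u"
  shows "dir_deriv w (\<lambda>p. exp (of_real (fst (snd p)) * c) * u p) p =
    exp (of_real (fst (snd p)) * c) * (dir_deriv w u p + of_real (fst (snd w)) * c * u p)"
proof -
  have L: "bounded_linear (\<lambda>p::real \<times> real \<times> real. of_real (fst (snd p)) * c)"
    by (intro bounded_linear_mult_const bounded_linear_compose[OF bounded_linear_of_real]
        bounded_linear_compose[OF bounded_linear_fst bounded_linear_snd])
  have "((\<lambda>p. exp (of_real (fst (snd p)) * c)) has_derivative
      (\<lambda>h. exp (of_real (fst (snd p)) * c) * (of_real (fst (snd h)) * c))) (at p)"
    using has_derivative_compose[OF bounded_linear_imp_has_derivative[OF L] DERIV_exp[unfolded has_field_derivative_def]]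
    by simp
  from has_derivative_mult[OF this dir_deriv_works[OF C_infinity_differentiable[OF assms]]]
  show ?thesis by (subst dir_deriv_eqI, assumption) (simp add: algebra_simps)
qed

lemma C_infinity_phase:
  fixes u :: "real \<times> real \<times> real \<Rightarrow> complex"
  assumes "C_infinity u"
  shows "C_infinity (\<lambda>p. exp (of_real (fst (snd p)) * c) * u p)"
proof (intro C_infinity_mult assms)
  show "C_infinity (\<lambda>p::real \<times> real \<times> real. exp (of_real (fst (snd p)) * c))"
    by (rule C_infinity_holomorphic_linear[where g = exp and L = "\<lambda>p. of_real (fst (snd p)) * c"])
       (auto intro!: holomorphic_intros bounded_linear_mult_const bounded_linear_compose[OF bounded_linear_of_real]
         bounded_linear_compose[OF bounded_linear_fst bounded_linear_snd])
qed

text \<open>The phase of the x-translation depends on y, so the product rule leaves a defect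
  proportional to the y-component of the direction. Hence x- and z-derivatives are again sections,
  while the y-derivative alone is not.\<close>

lemma smooth_sections_dir_deriv_shift:
  assumes "u \<in> smooth_sections N"
  shows "dir_deriv w u (x + 1, y, z) = exp (2 * of_real pi * \<i> * of_nat N * of_real y) *
        (dir_deriv w u (x, y, z) + 2 * of_real pi * \<i> * of_nat N * of_real (fst (snd w)) * u (x, y, z))"
    "dir_deriv w u (x, y + 1, z) = dir_deriv w u (x, y, z)"
    "dir_deriv w u (x, y, z + 1) = dir_deriv w u (x, y, z)"
proof -
  note u = smooth_sections_C_infinity[OF assms]
  let ?c = "2 * of_real pi * \<i> * of_nat N"
  show "dir_deriv w u (x, y + 1, z) = dir_deriv w u (x, y, z)"
    using dir_deriv_shift[OF u u, of "(0, 1, 0)" w "(x, y, z)"] smooth_sections_shift[OF assms] by auto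
  show "dir_deriv w u (x, y, z + 1) = dir_deriv w u (x, y, z)"
    using dir_deriv_shift[OF u u, of "(0, 0, 1)" w "(x, y, z)"] smooth_sections_shift[OF assms] by auto
  have "dir_deriv w u ((x, y, z) + (1, 0, 0)) = dir_deriv w (\<lambda>p. exp (of_real (fst (snd p)) * ?c) * u p) (x, y, z)"
    by (rule dir_deriv_shift[OF u C_infinity_phase[OF u]])
       (auto simp: smooth_sections_shift[OF assms] mult_ac)
  then show "dir_deriv w u (x + 1, y, z) = exp (2 * of_real pi * \<i> * of_nat N * of_real y) *
        (dir_deriv w u (x, y, z) + 2 * of_real pi * \<i> * of_nat N * of_real (fst (snd w)) * u (x, y, z))"
    unfolding dir_deriv_phase[OF u] by (simp add: mult_ac)
qed

lemma smooth_sections_add: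
  "u \<in> smooth_sections N \<Longrightarrow> v \<in> smooth_sections N \<Longrightarrow> (\<lambda>p. u p + v p) \<in> smooth_sections N"
  by (auto simp: smooth_sections_def C_infinity_add algebra_simps)

lemma smooth_sections_cmult:
  "u \<in> smooth_sections N \<Longrightarrow> (\<lambda>p. c * u p) \<in> smooth_sections N"
  by (auto simp: smooth_sections_def C_infinity_cmult algebra_simps)

lemma smooth_sections_diff:
  "u \<in> smooth_sections N \<Longrightarrow> v \<in> smooth_sections N \<Longrightarrow> (\<lambda>p. u p - v p) \<in> smooth_sections N"
  by (auto simp: smooth_sections_def C_infinity_diff algebra_simps)

lemma smooth_sections_nabla_x: "u \<in> smooth_sections N \<Longrightarrow> nabla_x u \<in> smooth_sections N"
  using smooth_sections_dir_deriv_shift[of u N "(1, 0, 0)"]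
  by (auto simp: nabla_x_def smooth_sections_def C_infinity_dir_deriv)

lemma smooth_sections_nabla_z: "u \<in> smooth_sections N \<Longrightarrow> nabla_z u \<in> smooth_sections N"
  using smooth_sections_dir_deriv_shift[of u N "(0, 0, 1)"]
  by (auto simp: nabla_z_def smooth_sections_def C_infinity_dir_deriv)

text \<open>Replacing x by x + 1 changes the connection term by -2 pi i N u, which cancels exactly
  the defect of the plain y-derivative.\<close>

lemma smooth_sections_nabla_y: "u \<in> smooth_sections N \<Longrightarrow> nabla_y N u \<in> smooth_sections N"
proof -
  assume u: "u \<in> smooth_sections N"
  have eq: "nabla_y N u = (\<lambda>p. dir_deriv (0, 1, 0) u p - of_real (fst p) * (2 * of_real pi * of_nat N * \<i>) * u p)"
    by (auto simp: nabla_y_def fun_eq_iff)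
  have "C_infinity (\<lambda>p::real \<times> real \<times> real. of_real (fst p) * (2 * of_real pi * of_nat N * \<i>))"
    by (rule C_infinity_holomorphic_linear[where g = "\<lambda>x. x"])
       (auto intro!: bounded_linear_mult_const bounded_linear_compose[OF bounded_linear_of_real] bounded_linear_fst)
  then have "C_infinity (nabla_y N u)"
    unfolding eq using u
    by (intro C_infinity_diff C_infinity_mult[of _ u] C_infinity_dir_deriv smooth_sections_C_infinity[OF u])
  moreover note smooth_sections_dir_deriv_shift[OF u, of "(0, 1, 0)"] smooth_sections_shift[OF u]
  ultimately show ?thesis
    unfolding smooth_sections_def by (simp add: nabla_y_def algebra_simps)
qed

section \<open>Fourier coefficients of periodic functions\<close>

definition fourier_coeff :: "int \<Rightarrow> (real \<Rightarrow> complex) \<Rightarrow> complex" where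
  "fourier_coeff k f = integral (cbox 0 1) (\<lambda>t. f t * cis (- 2 * pi * of_int k * t))"

lemma fourier_coeff_integrable:
  "continuous_on UNIV f \<Longrightarrow> (\<lambda>t. f t * cis (w * t)) integrable_on cbox 0 (1::real)"
  by (intro integrable_continuous continuous_intros) (auto intro: continuous_on_subset)

lemma fourier_coeff_add:
  "continuous_on UNIV f \<Longrightarrow> continuous_on UNIV g \<Longrightarrow>
    fourier_coeff k (\<lambda>t. f t + g t) = fourier_coeff k f + fourier_coeff k g"
  unfolding fourier_coeff_def ring_distribs
  by (intro integral_add fourier_coeff_integrable)

lemma fourier_coeff_cmult: "fourier_coeff k (\<lambda>t. c * f t) = c * fourier_coeff k f"
  unfolding fourier_coeff_def by (simp add: mult.assoc)

lemma fourier_coeff_diff: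
  "continuous_on UNIV f \<Longrightarrow> continuous_on UNIV g \<Longrightarrow>
    fourier_coeff k (\<lambda>t. f t - g t) = fourier_coeff k f - fourier_coeff k g"
  unfolding fourier_coeff_def ring_distribs
  by (intro integral_diff fourier_coeff_integrable)

lemma fourier_coeff_norm_le:
  assumes "continuous_on UNIV f" "\<And>t. norm (f t) \<le> B"
  shows "norm (fourier_coeff k f) \<le> B"
proof -
  have "norm (fourier_coeff k f) \<le> B * measure lborel (cbox 0 (1::real))"
    unfolding fourier_coeff_def
    using assms fourier_coeff_integrable[OF assms(1), of "- 2 * pi * of_int k"] order_trans[OF norm_ge_zero assms(2)]
    by (intro integrable_bound) (auto simp: norm_mult)
  then show ?thesis by simp
qed

lemma fourier_coeff_modulate:
  "fourier_coeff k (\<lambda>t. cis (2 * pi * of_int n * t) * f t) = fourier_coeff (k - n) f"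
  unfolding fourier_coeff_def
proof (intro integral_cong)
  fix t :: real
  have "cis (2 * pi * of_int n * t) * cis (- 2 * pi * of_int k * t) = cis (- 2 * pi * of_int (k - n) * t)"
    by (simp add: cis_mult algebra_simps)
  then show "cis (2 * pi * of_int n * t) * f t * cis (- 2 * pi * of_int k * t) = f t * cis (- 2 * pi * of_int (k - n) * t)"
    by (metis mult.assoc mult.commute)
qed

lemma cis_2pi_int: "cis (2 * pi * of_int k) = 1"
  by (metis cis_multiple_2pi Ints_of_int)

text \<open>Integration by parts: the fundamental theorem is applied to f(t) e^(iwt) with w = -2 pi
  k, whose values at 0 and 1 agree since f 1 = f 0 and e^(iw) = 1.\<close>

lemma fourier_coeff_deriv:
  assumes "\<And>t. (f has_vector_derivative f' t) (at t)" "continuous_on UNIV f'" "f 1 = f 0"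
  shows "fourier_coeff k f' = 2 * pi * \<i> * of_int k * fourier_coeff k f"
proof -
  define w where "w = - 2 * pi * real_of_int k"
  have cf: "continuous_on UNIV f"
    using assms(1) by (intro continuous_at_imp_continuous_on) (auto intro: has_vector_derivative_continuous)
  have "((\<lambda>t. f t * cis (w * t)) has_vector_derivative (f t * (\<i> * w * cis (w * t)) + f' t * cis (w * t))) (at t within cbox 0 1)" for t
  proof -
    have "((\<lambda>t. cis (w * t)) has_vector_derivative (\<i> * w * cis (w * t))) (at t)"
      by (auto intro!: derivative_eq_intros simp: has_vector_derivative_def scaleR_conv_of_real)
    from has_vector_derivative_mult[OF assms(1) this] show ?thesis
      by (rule has_vector_derivative_at_within)
  qed
  then have "((\<lambda>t. f t * (\<i> * w * cis (w * t)) + f' t * cis (w * t)) has_integral (f 1 * cis (w * 1) - f 0 * cis (w * 0))) (cbox 0 1)"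
    by (intro fundamental_theorem_of_calculus[where f = "\<lambda>t. f t * cis (w * t)", folded cbox_interval]) auto
  moreover have "cis w = 1" using cis_2pi_int[of "-k"] by (simp add: w_def)
  ultimately have "((\<lambda>t. \<i> * w * (f t * cis (w * t)) + f' t * cis (w * t)) has_integral 0) (cbox 0 1)"
    using assms(3) by (simp add: mult_ac)
  moreover have "((\<lambda>t. \<i> * w * (f t * cis (w * t)) + f' t * cis (w * t)) has_integral
      (\<i> * w * fourier_coeff k f + fourier_coeff k f')) (cbox 0 1)"
    unfolding fourier_coeff_def w_def[symmetric]
    by (intro has_integral_add has_integral_mult_right integrable_integral fourier_coeff_integrable cf assms)
  ultimately have "0 = \<i> * w * fourier_coeff k f + fourier_coeff k f'"
    by (rule has_integral_unique)
  then show ?thesis by (simp add: w_def algebra_simps eq_neg_iff_add_eq_0)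
qed

lemma fourier_coeff_continuous_on_param:
  fixes g :: "'a::euclidean_space \<Rightarrow> real \<Rightarrow> complex"
  assumes "continuous_on UNIV (\<lambda>(s, t). g s t)"
  shows "continuous_on UNIV (\<lambda>s. fourier_coeff k (g s))"
  unfolding fourier_coeff_def
proof (rule integral_continuous_on_param)
  have "continuous_on UNIV (\<lambda>p. (\<lambda>(s, t). g s t) p * cis (- 2 * pi * of_int k * snd p))"
    by (intro continuous_intros assms)
  then show "continuous_on (UNIV \<times> cbox 0 1) (\<lambda>(s, t). g s t * cis (- 2 * pi * of_int k * t))"
    by (auto simp: case_prod_beta intro: continuous_on_subset)
qed

lemma fourier_coeff_has_vector_derivative:
  fixes g :: "real \<Rightarrow> real \<Rightarrow> complex"
  assumes "\<And>s t. ((\<lambda>s. g s t) has_vector_derivative g' s t) (at s)"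
    "\<And>s. continuous_on UNIV (g s)" "continuous_on UNIV (\<lambda>(s, t). g' s t)"
  shows "((\<lambda>s. fourier_coeff k (g s)) has_vector_derivative fourier_coeff k (g' s)) (at s)"
  unfolding fourier_coeff_def
proof (rule leibniz_rule_vector_derivative[where U = UNIV])
  show "((\<lambda>s. g s t * cis (- 2 * pi * of_int k * t)) has_vector_derivative g' s t * cis (- 2 * pi * of_int k * t)) (at s)" for s t
    by (intro has_vector_derivative_mult_left assms)
  show "(\<lambda>t. g s t * cis (- 2 * pi * of_int k * t)) integrable_on cbox 0 1" for s
    by (rule fourier_coeff_integrable[OF assms(2)])
  have "continuous_on UNIV (\<lambda>p. (\<lambda>(s, t). g' s t) p * cis (- 2 * pi * of_int k * snd p))"
    by (intro continuous_intros assms)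
  then show "continuous_on (UNIV \<times> cbox 0 1) (\<lambda>(s, t). g' s t * cis (- 2 * pi * of_int k * t))"
    by (auto simp: case_prod_beta intro: continuous_on_subset)
qed auto

lemma periodic_int_shift:
  assumes "\<And>t::real. f (t + 1) = f t"
  shows "f (t + of_int n) = f t"
proof (induction n)
  case (nonneg n)
  show ?case
  proof (induction n)
    case (Suc n)
    then show ?case using assms[of "t + real n"] by (simp add: add_ac)
  qed simp
next
  case (neg n)
  show ?case
  proof (induction n)
    case 0
    then show ?case using assms[of "t - 1"] by simp
  next
    case (Suc n)
    then show ?case using assms[of "t - (2 + real n)"] by (simp add: algebra_simps)
  qed
qed

text \<open>The integral over [s, 1 + s] is cut at 1 and its right piece is moved back by one
  period; for 0 <= s <= 1 a single cut suffices.\<close>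

lemma fourier_coeff_shift_periodic:
  assumes f: "continuous_on UNIV f" "\<And>t. f (t + 1) = f t" and s: "0 \<le> s" "s \<le> 1"
  shows "fourier_coeff k (\<lambda>t. f (t + s)) = cis (2 * pi * of_int k * s) * fourier_coeff k f"
proof -
  define w where "w = - 2 * pi * real_of_int k"
  define h where "h = (\<lambda>t. f t * cis (w * t))"
  have per: "h (t + 1) = h t" for t
  proof -
    have "cis (w * (t + 1)) = cis (w * t) * cis w" by (simp add: cis_mult ring_distribs)
    then show ?thesis using cis_2pi_int[of "-k"] by (simp add: h_def f w_def)
  qed
  have ch: "continuous_on A h" for A
    unfolding h_def by (intro continuous_intros continuous_on_subset[OF f(1)]) auto
  have int: "h integrable_on {a..b}" for a b
    by (intro integrable_continuous_real ch)
  have sh: "integral {a..b} (\<lambda>t. h (t + c)) = integral {a + c..b + c} h" for a b c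
    using integral_shift[OF ch, of a b c] by (simp add: o_def)
  have "integral {0..1} (\<lambda>t. h (t + s)) = integral {s..1 + s} h"
    using sh[of 0 1 s] by simp
  also have "\<dots> = integral {s..1} h + integral {1..1 + s} h"
    using s by (intro Henstock_Kurzweil_Integration.integral_combine[symmetric] int) auto
  also have "integral {1..1 + s} h = integral {0..s} h"
    using sh[of 0 s 1] per by (simp add: add_ac)
  also have "integral {s..1} h + integral {0..s} h = integral {0..1} h"
    using s Henstock_Kurzweil_Integration.integral_combine[of 0 s 1 h] int by (simp add: add.commute)
  finally have eq: "integral {0..1} (\<lambda>t. h (t + s)) = integral {0..1} h" .
  have "(\<lambda>t. f (t + s) * cis (w * t)) = (\<lambda>t. cis (2 * pi * of_int k * s) * h (t + s))"
    by (auto simp: h_def w_def cis_mult algebra_simps fun_eq_iff)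
  then show ?thesis
    unfolding fourier_coeff_def w_def[symmetric] using eq by (simp add: h_def)
qed

text \<open>An eigenfunction of a translation has only frequencies compatible with its eigenvalue.
  With s = 1/N this selects a residue class of frequencies modulo N.\<close>

lemma fourier_coeff_shift_eigen:
  assumes "continuous_on UNIV f" "\<And>t. f (t + 1) = f t" "0 \<le> s" "s \<le> 1"
    "\<And>t. f (t + s) = e * f t" "e \<noteq> cis (2 * pi * of_int k * s)"
  shows "fourier_coeff k f = 0"
  using fourier_coeff_shift_periodic[OF assms(1-4), of k] assms(5,6)
  by (simp add: fourier_coeff_cmult)

text \<open>On the unit circle every real polynomial function is a trigonometric polynomial, so
  Stone-Weierstrass makes the latter dense.\<close>

lemma integral_real_polynomial_circle:
  fixes f :: "real \<Rightarrow> complex"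
  assumes "continuous_on UNIV f" "\<And>k. fourier_coeff k f = 0" "real_polynomial_function p"
  shows "integral (cbox 0 1) (\<lambda>t. f t * of_real (p (cis (2 * pi * t)))) = 0"
proof -
  \<comment> \<open>Membership restricts g on the unit circle only; this allows \<open>cnj z\<close>
    and \<open>z powi k\<close> to be treated as trigonometric polynomials.\<close>
  define T where "T = {g :: complex \<Rightarrow> complex. \<exists>S c. finite S \<and> (\<forall>t. g (cis t) = (\<Sum>k\<in>S. c k * cis (of_int k * t)))}"
  have mono: "(\<lambda>z. c * z ^ n) \<in> T" for c n
    unfolding T_def
    by (intro CollectI exI[of _ "{int n}"] exI[of _ "\<lambda>_. c"]) (simp add: Complex.DeMoivre)
  have monoc: "(\<lambda>z. c * cnj z) \<in> T" for c
    unfolding T_def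
    by (intro CollectI exI[of _ "{-1}"] exI[of _ "\<lambda>_. c"]) (simp add: cis_cnj)
  have T_add: "(\<lambda>z. f z + g z) \<in> T" if "f \<in> T" "g \<in> T" for f g
  proof -
    from that obtain S c S' c' where S: "finite S" "\<And>t. f (cis t) = (\<Sum>k\<in>S. c k * cis (of_int k * t))"
        "finite S'" "\<And>t. g (cis t) = (\<Sum>k\<in>S'. c' k * cis (of_int k * t))"
      unfolding T_def by blast
    define d where "d = (\<lambda>k. (if k \<in> S then c k else 0) + (if k \<in> S' then c' k else 0))"
    have "(\<Sum>k\<in>S \<union> S'. d k * cis (of_int k * t)) = f (cis t) + g (cis t)" for t
    proof -
      have "(\<Sum>k\<in>S \<union> S'. (if k \<in> S then c k else 0) * cis (of_int k * t)) = f (cis t)"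
        unfolding S using S(1,3) by (intro sum.mono_neutral_cong_right) auto
      moreover have "(\<Sum>k\<in>S \<union> S'. (if k \<in> S' then c' k else 0) * cis (of_int k * t)) = g (cis t)"
        unfolding S using S(1,3) by (intro sum.mono_neutral_cong_right) auto
      ultimately show ?thesis by (simp add: d_def ring_distribs sum.distrib)
    qed
    then show ?thesis unfolding T_def using S(1,3)
      by (intro CollectI exI[of _ "S \<union> S'"] exI[of _ d]) auto
  qed
  \<comment> \<open>Induction on the frequency set of one factor: multiplication by a single
    frequency k translates the frequencies of g by k.\<close>
  have mult1: "(\<lambda>z. (\<Sum>k\<in>S. c k * h k z) * g z) \<in> T"
    if "finite S" "g \<in> T" "\<And>k t. h k (cis t) = cis (of_int k * t)" for S :: "int set" and c h g
    using that(1)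
  proof (induction S)
    case empty
    show ?case using mono[of 0 0] by simp
  next
    case (insert k S)
    from that(2) obtain S' c' where S: "finite S'" "\<And>t. g (cis t) = (\<Sum>k\<in>S'. c' k * cis (of_int k * t))"
      unfolding T_def by blast
    have "(\<lambda>z. c k * h k z * g z) \<in> T" unfolding T_def
    proof (intro CollectI exI[of _ "(\<lambda>l. l + k) ` S'"] exI[of _ "\<lambda>l. c k * c' (l - k)"] conjI allI)
      fix t
      show "c k * h k (cis t) * g (cis t) = (\<Sum>ka\<in>(\<lambda>l. l + k) ` S'. c k * c' (ka - k) * cis (of_int ka * t))"
        by (subst sum.reindex)
           (auto simp: S that(3) sum_distrib_left cis_mult ring_distribs mult_ac add_ac inj_on_def intro!: sum.cong simp flip: cis_mult)
    qed (use S in auto)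
    from T_add[OF this insert.IH] show ?case using insert by (simp add: ring_distribs)
  qed
  have mult: "(\<lambda>z. f z * g z) \<in> T" if fT: "f \<in> T" and gT: "g \<in> T" for f g
  proof -
    from fT obtain S c where S: "finite S" "\<And>t. f (cis t) = (\<Sum>k\<in>S. c k * cis (of_int k * t))"
      unfolding T_def by blast
    have "(\<lambda>z. (\<Sum>k\<in>S. c k * (z powi k)) * g z) \<in> T"
      by (rule mult1[OF S(1) gT]) (simp add: cis_power_int)
    then show ?thesis unfolding T_def using S by (simp add: cis_power_int)
  qed
  have "(\<lambda>z. of_real (p z)) \<in> T"
    using assms(3)
  proof (induction rule: real_polynomial_function.induct)
    case (linear p)
    interpret bounded_linear p by fact
    \<comment> \<open>A real-linear functional on the complex plane is a combination of z and its
      conjugate, and on the circle the conjugate has frequency -1.\<close>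
    have "complex_of_real (p z) = (p 1 / 2 - \<i> * p \<i> / 2) * z ^ 1 + (p 1 / 2 + \<i> * p \<i> / 2) * cnj z" for z
    proof -
      have "z = Re z *\<^sub>R 1 + Im z *\<^sub>R \<i>" by (simp add: complex_eq_iff)
      then have "p z = p (Re z *\<^sub>R 1 + Im z *\<^sub>R \<i>)" by (rule arg_cong)
      then have "p z = Re z * p 1 + Im z * p \<i>" by (simp only: add scaleR) simp
      then show ?thesis by (simp add: complex_eq_iff field_simps)
    qed
    then show ?case by (subst ext) (assumption | rule T_add[OF mono monoc])+
  next
    case (const c)
    then show ?case using mono[of "of_real c" 0] by simp
  qed (simp_all add: T_add mult)
  then obtain S c where S: "finite S" "\<And>t. of_real (p (cis t)) = (\<Sum>k\<in>S. c k * cis (of_int k * t))"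
    unfolding T_def by blast
  have "integral (cbox 0 1) (\<lambda>t. f t * of_real (p (cis (2 * pi * t)))) =
     integral (cbox 0 1) (\<lambda>t. \<Sum>k\<in>S. c k * (f t * cis (- 2 * pi * of_int (-k) * t)))"
    by (intro integral_cong) (simp add: S sum_distrib_left mult_ac)
  also have "\<dots> = (\<Sum>k\<in>S. c k * fourier_coeff (-k) f)"
    unfolding fourier_coeff_def integral_mult_right[symmetric]
    by (intro integral_sum S(1) integrable_on_mult_right fourier_coeff_integrable assms)
  finally show ?thesis by (simp add: assms)
qed

section \<open>Uniqueness of Fourier coefficients of continuous periodic functions\<close>

lemma cis_2pi_eq_imp_int:
  assumes "cis (2 * pi * s) = cis (2 * pi * t)"
  obtains n where "s = t + of_int n"
proof -
  have "sin (2 * pi * s) = sin (2 * pi * t) \<and> cos (2 * pi * s) = cos (2 * pi * t)"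
    using assms by (auto simp: complex_eq_iff)
  then obtain n where "2 * pi * s = 2 * pi * t + 2 * pi * of_int n"
    unfolding sin_cos_eq_iff by (auto simp: mult_ac)
  then have "2 * pi * s = 2 * pi * (t + of_int n)" by (simp add: ring_distribs)
  then show ?thesis using that[of n] by simp
qed

text \<open>Stone-Weierstrass is applied on the compact circle, so f is pushed down to it.
  Continuity of g follows from compactness of [0,1]: the preimage of a closed set under g is the
  image of a compact subset of [0,1].\<close>

lemma periodic_factor_circle:
  fixes f :: "real \<Rightarrow> complex"
  assumes "continuous_on UNIV f" "\<And>t. f (t + 1) = f t"
  obtains g where "continuous_on (sphere 0 1) g" "\<And>t. g (cis (2 * pi * t)) = f t"
proof -
  define g where "g z = f (SOME t. cis (2 * pi * t) = z)" for z
  have g: "g (cis (2 * pi * t)) = f t" for t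
  proof -
    have "cis (2 * pi * (SOME s. cis (2 * pi * s) = cis (2 * pi * t))) = cis (2 * pi * t)"
      by (rule someI) (rule refl)
    then show ?thesis
      unfolding g_def by (metis cis_2pi_eq_imp_int periodic_int_shift assms(2))
  qed
  have onto: "\<exists>t\<in>{0..1}. z = cis (2 * pi * t)" if "norm z = 1" for z
    using that
    by (intro bexI[of _ "Arg2pi z / (2 * pi)"])
       (use Arg2pi_eq[of z] Arg2pi_ge_0[of z] Arg2pi_lt_2pi[of z] in \<open>auto simp: cis_conv_exp mult.commute\<close>)
  have "continuous_on (sphere 0 1) g"
  proof (subst continuous_on_closed_vimage, simp, intro allI impI)
    fix B :: "complex set" assume "closed B"
    have "compact ({0..1} \<inter> f -` B)"
      using continuous_closed_vimage[OF \<open>closed B\<close>] assms(1)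
      by (intro compact_Int_closed) (auto simp: continuous_on_eq_continuous_at)
    then have "compact ((\<lambda>t. cis (2 * pi * t)) ` ({0..1} \<inter> f -` B))"
      by (intro compact_continuous_image continuous_intros)
    also have "(\<lambda>t. cis (2 * pi * t)) ` ({0..1} \<inter> f -` B) = g -` B \<inter> sphere 0 1"
      using g onto by (fastforce simp: image_iff)
    finally show "closed (g -` B \<inter> sphere 0 1)" by (rule compact_imp_closed)
  qed
  with g show ?thesis using that by blast
qed

text \<open>A polynomial p uniformly within e/B of h, where B bounds |f|, changes the integral by at
  most e, and the integral with p vanishes.\<close>

lemma fourier_coeff_eq_0_imp_orthogonal:
  fixes f :: "real \<Rightarrow> complex" and h :: "complex \<Rightarrow> real"
  assumes "continuous_on UNIV f" "\<And>k. fourier_coeff k f = 0" "continuous_on (sphere 0 1) h"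
  shows "integral (cbox 0 1) (\<lambda>t. f t * of_real (h (cis (2 * pi * t)))) = 0"
proof -
  have ch: "continuous_on A (\<lambda>t. h (cis (2 * pi * t)))" for A
    by (intro continuous_on_compose2[OF assms(3)] continuous_intros) auto
  have cf: "continuous_on A f" for A
    using assms(1) continuous_on_subset by blast
  have "bounded (f ` cbox 0 1)"
    by (intro compact_imp_bounded compact_continuous_image cf) auto
  then obtain B where B: "0 < B" "\<And>t. t \<in> cbox 0 1 \<Longrightarrow> norm (f t) \<le> B"
    unfolding bounded_pos by auto
  have le: "norm (integral (cbox 0 1) (\<lambda>t. f t * of_real (h (cis (2 * pi * t))))) \<le> e" if "e > 0" for e
  proof -
    have "0 < e / B" using B that by simp
    from Stone_Weierstrass_real_polynomial_function[OF compact_sphere assms(3) this]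
    obtain p where p: "real_polynomial_function p" "\<And>z. z \<in> sphere 0 1 \<Longrightarrow> \<bar>h z - p z\<bar> < e / B"
      by blast
    have cp: "continuous_on A (\<lambda>t. p (cis (2 * pi * t)))" for A
    proof -
      have "continuous_on UNIV p"
        using continuous_real_polymonial_function[OF p(1)] by (simp add: continuous_at_imp_continuous_on)
      moreover have "continuous_on A (\<lambda>t. cis (2 * pi * t))" by (intro continuous_intros)
      ultimately show ?thesis
        using continuous_on_compose2[of UNIV p A "\<lambda>t. cis (2 * pi * t)"] by simp
    qed
    have "integral (cbox 0 1) (\<lambda>t. f t * of_real (h (cis (2 * pi * t)))) =
        integral (cbox 0 1) (\<lambda>t. f t * of_real (h (cis (2 * pi * t)))) - integral (cbox 0 1) (\<lambda>t. f t * of_real (p (cis (2 * pi * t))))"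
      using integral_real_polynomial_circle[OF assms(1,2) p(1)] by simp
    also have "\<dots> = integral (cbox 0 1) (\<lambda>t. f t * of_real (h (cis (2 * pi * t))) - f t * of_real (p (cis (2 * pi * t))))"
      by (intro integral_diff[symmetric] integrable_continuous continuous_intros ch cf cp)
    also have "norm \<dots> \<le> e * measure lborel (cbox 0 (1::real))"
    proof (intro integrable_bound integrable_continuous continuous_intros ch cf cp)
      fix t :: real assume "t \<in> cbox 0 1"
      have "norm (f t * of_real (h (cis (2 * pi * t))) - f t * of_real (p (cis (2 * pi * t)))) =
          norm (f t) * \<bar>h (cis (2 * pi * t)) - p (cis (2 * pi * t))\<bar>"
        unfolding right_diff_distrib[symmetric] norm_mult of_real_diff[symmetric] norm_of_real ..
      also have "\<dots> \<le> B * (e / B)"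
        using p(2)[of "cis (2 * pi * t)"] B \<open>t \<in> cbox 0 1\<close> by (intro mult_mono) auto
      finally show "norm (f t * of_real (h (cis (2 * pi * t))) - f t * of_real (p (cis (2 * pi * t)))) \<le> e"
        using B by simp
    qed (use that in simp)
    finally show ?thesis by simp
  qed
  have "norm (integral (cbox 0 1) (\<lambda>t. f t * of_real (h (cis (2 * pi * t))))) \<le> 0"
  proof (rule field_le_epsilon)
    fix e :: real assume "0 < e"
    from le[OF this] show "norm (integral (cbox 0 1) (\<lambda>t. f t * of_real (h (cis (2 * pi * t))))) \<le> 0 + e"
      by (simp only: add_0_left)
  qed
  then show ?thesis by (simp only: norm_le_zero_iff)
qed

text \<open>The real and imaginary parts of f itself serve as test functions; combining them gives
  that the integral of |f|^2 over a period is 0, and continuity does the rest.\<close>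

lemma fourier_coeff_eq_0_imp:
  assumes "continuous_on UNIV f" "\<And>t. f (t + 1) = f t" "\<And>k. fourier_coeff k f = 0"
  shows "f t = 0"
proof -
  obtain g where g: "continuous_on (sphere 0 1) g" "\<And>t. g (cis (2 * pi * t)) = f t"
    using periodic_factor_circle[OF assms(1,2)] by blast
  have cf: "continuous_on A f" for A
    using assms(1) continuous_on_subset by blast
  have R: "integral (cbox 0 1) (\<lambda>t. f t * of_real (Re (f t))) = 0"
    using fourier_coeff_eq_0_imp_orthogonal[OF assms(1,3), of "\<lambda>z. Re (g z)"] g
    by (simp add: continuous_on_Re)
  have I: "integral (cbox 0 1) (\<lambda>t. f t * of_real (Im (f t))) = 0"
    using fourier_coeff_eq_0_imp_orthogonal[OF assms(1,3), of "\<lambda>z. Im (g z)"] g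
    by (simp add: continuous_on_Im)
  have "((\<lambda>t. f t * of_real (Re (f t))) has_integral 0) (cbox 0 1)"
    unfolding R[symmetric] by (intro integrable_integral integrable_continuous continuous_intros cf)
  moreover have "((\<lambda>t. f t * of_real (Im (f t))) has_integral 0) (cbox 0 1)"
    unfolding I[symmetric] by (intro integrable_integral integrable_continuous continuous_intros cf)
  ultimately have "((\<lambda>t. f t * of_real (Re (f t)) - \<i> * (f t * of_real (Im (f t)))) has_integral (0 - \<i> * 0)) (cbox 0 1)"
    by (intro has_integral_diff has_integral_mult_right)
  moreover have "(\<lambda>t. f t * of_real (Re (f t)) - \<i> * (f t * of_real (Im (f t)))) = (\<lambda>t. of_real ((norm (f t))\<^sup>2))"
    by (rule ext, simp add: complex_eq_iff cmod_power2, simp add: power2_eq_square)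
  ultimately have "((\<lambda>t. complex_of_real ((norm (f t))\<^sup>2)) has_integral 0) (cbox 0 1)"
    by simp
  then have "((\<lambda>t. (norm (f t))\<^sup>2) has_integral 0) (cbox 0 1)"
    using has_integral_linear[OF _ bounded_linear_Re, of _ 0] by (auto simp: o_def dest!: has_integral_linear[OF _ bounded_linear_Re])
  moreover have "continuous_on (cbox 0 1) (\<lambda>t. (norm (f t))\<^sup>2)"
    by (intro continuous_intros cf)
  ultimately have z: "f t = 0" if "t \<in> {0..1}" for t
    using has_integral_0_cbox_imp_0[of 0 1 "\<lambda>t. (norm (f t))\<^sup>2" t] that by simp
  have "f t = f (frac t)"
    using periodic_int_shift[of f "frac t" "\<lfloor>t\<rfloor>"] assms(2) by (simp add: frac_def)
  also have "\<dots> = 0"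
    using frac_ge_0[of t] frac_lt_1[of t] by (intro z) auto
  finally show ?thesis .
qed

section \<open>Fourier coefficients of sections in the variables \<open>y\<close> and \<open>z\<close>\<close>

text \<open>The coefficient c_{k,m}(x) of e^(2 pi i (ky + mz)). The variable x stays free, since
  sections are not periodic in it.\<close>

definition yz_coeff :: "int \<Rightarrow> int \<Rightarrow> (real \<times> real \<times> real \<Rightarrow> complex) \<Rightarrow> real \<Rightarrow> complex" where
  "yz_coeff k m u x = fourier_coeff m (\<lambda>z. fourier_coeff k (\<lambda>y. u (x, y, z)))"

lemma continuous_on_slice_y:
  "continuous_on UNIV u \<Longrightarrow> continuous_on UNIV (\<lambda>y. u (x, y, z))" for u :: "real \<times> real \<times> real \<Rightarrow> complex"
  by (rule continuous_on_compose2[of UNIV u]) (auto intro!: continuous_intros)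

lemma continuous_on_inner_coeff:
  assumes "continuous_on UNIV (u :: real \<times> real \<times> real \<Rightarrow> complex)"
  shows "continuous_on UNIV (\<lambda>(x, z). fourier_coeff k (\<lambda>y. u (x, y, z)))"
proof -
  have "continuous_on UNIV (\<lambda>((x, z), y). u (x, y, z))"
    unfolding case_prod_beta
    by (rule continuous_on_compose2[OF assms]) (auto intro!: continuous_intros)
  then have "continuous_on UNIV (\<lambda>(p, y). u (fst p, y, snd p))"
    by (simp add: case_prod_beta)
  from fourier_coeff_continuous_on_param[OF this] show ?thesis
    by (simp add: case_prod_beta)
qed

lemma continuous_on_inner_coeff_z:
  assumes "continuous_on UNIV (u :: real \<times> real \<times> real \<Rightarrow> complex)"
  shows "continuous_on UNIV (\<lambda>z. fourier_coeff k (\<lambda>y. u (x, y, z)))"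
  using continuous_on_compose2[OF continuous_on_inner_coeff[OF assms], of UNIV "\<lambda>z. (x, z)"]
    continuous_on_Pair[OF continuous_on_const continuous_on_id, of UNIV x]
  by simp

lemma yz_coeff_add:
  assumes "continuous_on UNIV u" "continuous_on UNIV v"
  shows "yz_coeff k m (\<lambda>p. u p + v p) x = yz_coeff k m u x + yz_coeff k m v x"
  unfolding yz_coeff_def
  by (simp add: fourier_coeff_add continuous_on_slice_y continuous_on_inner_coeff_z assms)

lemma yz_coeff_diff:
  assumes "continuous_on UNIV u" "continuous_on UNIV v"
  shows "yz_coeff k m (\<lambda>p. u p - v p) x = yz_coeff k m u x - yz_coeff k m v x"
  unfolding yz_coeff_def
  by (simp add: fourier_coeff_diff continuous_on_slice_y continuous_on_inner_coeff_z assms)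

lemma yz_coeff_cmult: "yz_coeff k m (\<lambda>p. c * u p) x = c * yz_coeff k m u x"
  by (simp add: yz_coeff_def fourier_coeff_cmult)

lemma yz_coeff_norm_le:
  assumes "continuous_on UNIV u" "\<And>p. norm (u p) \<le> B"
  shows "norm (yz_coeff k m u x) \<le> B"
  unfolding yz_coeff_def
  by (intro fourier_coeff_norm_le continuous_on_slice_y continuous_on_inner_coeff_z assms)

lemma has_vector_derivative_inner_coeff_x:
  assumes "C_infinity u"
  shows "((\<lambda>x. fourier_coeff k (\<lambda>y. u (x, y, z))) has_vector_derivative
    fourier_coeff k (\<lambda>y. nabla_x u (x, y, z))) (at x)"
proof (rule fourier_coeff_has_vector_derivative[where g' = "\<lambda>x y. nabla_x u (x, y, z)"])
  show "((\<lambda>x. u (x, y, z)) has_vector_derivative nabla_x u (x, y, z)) (at x)" for x y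
    unfolding nabla_x_def by (rule partial_x[OF assms])
  show "continuous_on UNIV (\<lambda>y. u (x, y, z))" for x
    by (intro continuous_on_slice_y C_infinity_continuous assms)
  show "continuous_on UNIV (\<lambda>(x, y). nabla_x u (x, y, z))"
    unfolding case_prod_beta nabla_x_def
    by (rule continuous_on_compose2[OF C_infinity_continuous[OF C_infinity_dir_deriv[OF assms]]])
       (auto intro!: continuous_intros)
qed

lemma has_vector_derivative_inner_coeff_z:
  assumes "C_infinity u"
  shows "((\<lambda>z. fourier_coeff k (\<lambda>y. u (x, y, z))) has_vector_derivative
    fourier_coeff k (\<lambda>y. nabla_z u (x, y, z))) (at z)"
proof (rule fourier_coeff_has_vector_derivative[where g' = "\<lambda>z y. nabla_z u (x, y, z)"])
  show "((\<lambda>z. u (x, y, z)) has_vector_derivative nabla_z u (x, y, z)) (at z)" for z y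
    unfolding nabla_z_def by (rule partial_z[OF assms])
  show "continuous_on UNIV (\<lambda>y. u (x, y, z))" for z
    by (intro continuous_on_slice_y C_infinity_continuous assms)
  show "continuous_on UNIV (\<lambda>(z, y). nabla_z u (x, y, z))"
    unfolding case_prod_beta nabla_z_def
    by (rule continuous_on_compose2[OF C_infinity_continuous[OF C_infinity_dir_deriv[OF assms]]])
       (auto intro!: continuous_intros)
qed

lemma yz_coeff_nabla_x:
  assumes "C_infinity u"
  shows "(yz_coeff k m u has_vector_derivative yz_coeff k m (nabla_x u) x) (at x)"
proof -
  have n: "continuous_on UNIV (nabla_x u)"
    unfolding nabla_x_def by (intro C_infinity_continuous C_infinity_dir_deriv assms)
  show ?thesis
    unfolding yz_coeff_def[abs_def]
    by (intro fourier_coeff_has_vector_derivative has_vector_derivative_inner_coeff_x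
        continuous_on_inner_coeff_z continuous_on_inner_coeff C_infinity_continuous assms n)
qed

lemma yz_coeff_nabla_y:
  assumes "u \<in> smooth_sections N"
  shows "yz_coeff k m (nabla_y N u) x = (2 * pi * \<i> * of_int k - 2 * pi * \<i> * of_nat N * x) * yz_coeff k m u x"
proof -
  note C = smooth_sections_C_infinity[OF assms]
  have c: "continuous_on UNIV (dir_deriv (0, 1, 0) u)"
    by (intro C_infinity_continuous C_infinity_dir_deriv C)
  have "fourier_coeff k (\<lambda>y. dir_deriv (0, 1, 0) u (x, y, z)) = 2 * pi * \<i> * of_int k * fourier_coeff k (\<lambda>y. u (x, y, z))" for z
    by (intro fourier_coeff_deriv partial_y C continuous_on_slice_y c)
       (use smooth_sections_shift(2)[OF assms, of x 0 z] in simp)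
  moreover have "fourier_coeff k (\<lambda>y. nabla_y N u (x, y, z)) =
      fourier_coeff k (\<lambda>y. dir_deriv (0, 1, 0) u (x, y, z)) - 2 * pi * \<i> * of_nat N * x * fourier_coeff k (\<lambda>y. u (x, y, z))" for z
  proof -
    have s: "continuous_on UNIV (\<lambda>y. 2 * of_real pi * \<i> * of_nat N * of_real x * u (x, y, z))"
      by (intro continuous_on_mult_left continuous_on_slice_y[OF C_infinity_continuous[OF C]])
    have "nabla_y N u = (\<lambda>(x, y, z). dir_deriv (0, 1, 0) u (x, y, z) - 2 * of_real pi * \<i> * of_nat N * of_real x * u (x, y, z))"
      by (simp add: nabla_y_def mult_ac)
    then show ?thesis
      using fourier_coeff_diff[OF continuous_on_slice_y[OF c, of x z] s, of k] by (simp add: fourier_coeff_cmult)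
  qed
  ultimately have "fourier_coeff k (\<lambda>y. nabla_y N u (x, y, z)) =
      (2 * pi * \<i> * of_int k - 2 * pi * \<i> * of_nat N * x) * fourier_coeff k (\<lambda>y. u (x, y, z))" for z
    by (simp only: left_diff_distrib)
  then show ?thesis by (simp add: yz_coeff_def fourier_coeff_cmult)
qed

lemma yz_coeff_nabla_z:
  assumes "u \<in> smooth_sections N"
  shows "yz_coeff k m (nabla_z u) x = 2 * pi * \<i> * of_int m * yz_coeff k m u x"
  unfolding yz_coeff_def
proof (rule fourier_coeff_deriv)
  note C = smooth_sections_C_infinity[OF assms]
  show "((\<lambda>z. fourier_coeff k (\<lambda>y. u (x, y, z))) has_vector_derivative
    fourier_coeff k (\<lambda>y. nabla_z u (x, y, z))) (at z)" for z
    by (rule has_vector_derivative_inner_coeff_z[OF C])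
  show "continuous_on UNIV (\<lambda>z. fourier_coeff k (\<lambda>y. nabla_z u (x, y, z)))"
    unfolding nabla_z_def by (intro continuous_on_inner_coeff_z C_infinity_continuous C_infinity_dir_deriv C)
  show "fourier_coeff k (\<lambda>y. u (x, y, 1)) = fourier_coeff k (\<lambda>y. u (x, y, 0))"
    using smooth_sections_shift(3)[OF assms, of x _ 0] by simp
qed

text \<open>The multiplier e^(2 pi i N y) is a character in y, so it only moves the frequency
  k.\<close>

lemma yz_coeff_shift:
  assumes "u \<in> smooth_sections N"
  shows "yz_coeff k m u (x + 1) = yz_coeff (k - int N) m u x"
proof -
  have "exp (2 * of_real pi * \<i> * of_nat N * of_real y) = cis (2 * pi * of_int (int N) * y)" for y
    by (simp add: cis_conv_exp mult_ac)
  then have "fourier_coeff k (\<lambda>y. u (x + 1, y, z)) = fourier_coeff (k - int N) (\<lambda>y. u (x, y, z))" for z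
    by (simp only: smooth_sections_shift(1)[OF assms] fourier_coeff_modulate)
  then show ?thesis by (simp add: yz_coeff_def)
qed

lemma yz_coeff_shift_multiple:
  assumes "u \<in> smooth_sections N"
  shows "yz_coeff k m u (x + of_int n) = yz_coeff (k - n * int N) m u x"
proof (induction n arbitrary: x)
  case (nonneg n)
  show ?case
  proof (induction n arbitrary: x)
    case (Suc n)
    have "yz_coeff k m u (x + of_int (int (Suc n))) = yz_coeff k m u ((x + 1) + of_int (int n))"
      by (simp add: add_ac)
    also have "\<dots> = yz_coeff (k - int (Suc n) * int N) m u x"
      unfolding Suc yz_coeff_shift[OF assms] by (simp add: algebra_simps)
    finally show ?case .
  qed simp
next
  case (neg n)
  show ?case
  proof (induction n arbitrary: x)
    case 0
    show ?case using yz_coeff_shift[OF assms, of "k + int N" m "x - 1"] by (simp add: algebra_simps)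
  next
    case (Suc n)
    have "yz_coeff k m u (x + of_int (- int (Suc (Suc n)))) = yz_coeff k m u ((x - 1) + of_int (- int (Suc n)))"
      by (simp add: algebra_simps)
    also have "\<dots> = yz_coeff (k + int (Suc n) * int N) m u (x - 1)"
      unfolding Suc by (simp add: algebra_simps)
    also have "\<dots> = yz_coeff (k + int (Suc (Suc n)) * int N) m u x"
      using yz_coeff_shift[OF assms, of "k + int (Suc (Suc n)) * int N" m "x - 1"] by (simp add: algebra_simps)
    finally show ?case by (simp add: algebra_simps)
  qed
qed

lemma yz_coeff_eq_0_imp:
  assumes "u \<in> smooth_sections N" "\<And>k m x. yz_coeff k m u x = 0"
  shows "u = (\<lambda>p. 0)"
proof -
  note C = C_infinity_continuous[OF smooth_sections_C_infinity[OF assms(1)]]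
  have 1: "fourier_coeff k (\<lambda>y. u (x, y, z)) = 0" for k x z
  proof (rule fourier_coeff_eq_0_imp[where f = "\<lambda>z. fourier_coeff k (\<lambda>y. u (x, y, z))"])
    show "continuous_on UNIV (\<lambda>z. fourier_coeff k (\<lambda>y. u (x, y, z)))"
      by (rule continuous_on_inner_coeff_z[OF C])
  qed (use assms smooth_sections_shift(3)[OF assms(1)] in \<open>auto simp: yz_coeff_def\<close>)
  have "u (x, y, z) = 0" for x y z
    using 1 smooth_sections_shift(2)[OF assms(1)]
    by (intro fourier_coeff_eq_0_imp[where f = "\<lambda>y. u (x, y, z)"] continuous_on_slice_y[OF C])
  then show ?thesis by auto
qed

text \<open>Takes the place of convergence of Fourier series: identities between sections are
  verified coefficient by coefficient, and no series is ever summed.\<close>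

lemma yz_coeff_eqI:
  assumes "u \<in> smooth_sections N" "v \<in> smooth_sections N" "\<And>k m x. yz_coeff k m u x = yz_coeff k m v x"
  shows "u = v"
proof -
  have "(\<lambda>p. u p - v p) = (\<lambda>p. 0)"
    using assms
    by (intro yz_coeff_eq_0_imp[of _ N] smooth_sections_diff)
       (auto simp: yz_coeff_diff C_infinity_continuous smooth_sections_C_infinity)
  then show ?thesis by (auto simp: fun_eq_iff)
qed

text \<open>The multiplier has modulus 1, so |u| is periodic in all three variables and its values
  on the unit cube are all its values.\<close>

lemma smooth_sections_bounded:
  assumes "u \<in> smooth_sections N"
  obtains B where "\<And>p. norm (u p) \<le> B"
proof -
  let ?K = "{0..1} \<times> {0..1} \<times> {0..1::real}"
  have "compact (u ` ?K)"
    by (intro compact_continuous_image continuous_on_subset[OF C_infinity_continuous[OF smooth_sections_C_infinity[OF assms]]]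
        compact_Times) auto
  then have "bounded (u ` ?K)" by (rule compact_imp_bounded)
  then obtain B where "\<forall>v\<in>u ` ?K. norm v \<le> B" unfolding bounded_iff by blast
  then have B: "\<And>p. p \<in> ?K \<Longrightarrow> norm (u p) \<le> B" by blast
  have "norm (u (x, y, z)) \<le> B" for x y z
  proof -
    have 1: "norm (u (t + 1, y, z)) = norm (u (t, y, z))" for t y z
      unfolding smooth_sections_shift(1)[OF assms] norm_mult by (simp add: norm_exp_eq_Re)
    have "norm (u (x, y, z)) = norm (u (frac x, y, z))"
      using periodic_int_shift[of "\<lambda>t. norm (u (t, y, z))", OF 1, of "frac x" "\<lfloor>x\<rfloor>"] by (simp add: frac_def)
    also have "\<dots> = norm (u (frac x, frac y, z))"
      using periodic_int_shift[of "\<lambda>t. norm (u (frac x, t, z))" "frac y" "\<lfloor>y\<rfloor>"] smooth_sections_shift(2)[OF assms] by (simp add: frac_def)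
    also have "\<dots> = norm (u (frac x, frac y, frac z))"
      using periodic_int_shift[of "\<lambda>t. norm (u (frac x, frac y, t))" "frac z" "\<lfloor>z\<rfloor>"] smooth_sections_shift(3)[OF assms] by (simp add: frac_def)
    also have "\<dots> \<le> B"
      by (intro B) (auto simp: frac_lt_1 less_imp_le)
    finally show ?thesis .
  qed
  then show ?thesis by (intro that[of B]) (auto simp: split_paired_all)
qed

lemma yz_coeff_bounded:
  assumes "u \<in> smooth_sections N"
  obtains B where "\<And>k m x. norm (yz_coeff k m u x) \<le> B"
proof -
  obtain B where "\<And>p. norm (u p) \<le> B" using smooth_sections_bounded[OF assms] by blast
  then show ?thesis
    using that yz_coeff_norm_le C_infinity_continuous smooth_sections_C_infinity assms by blast
qed

section \<open>Landau levels\<close>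

text \<open>With xi = 2 pi (N x - k), the operators \<open>annih\<close> and \<open>creat\<close>
  act on c_{k,m} as d/dx + xi and xi - d/dx: the ladder operators of an oscillator centred at k/N.
  Being built from covariant derivatives, they preserve sections.\<close>

definition annih :: "nat \<Rightarrow> (real \<times> real \<times> real \<Rightarrow> complex) \<Rightarrow> real \<times> real \<times> real \<Rightarrow> complex" where
  "annih N u = (\<lambda>p. nabla_x u p + \<i> * nabla_y N u p)"

definition creat :: "nat \<Rightarrow> (real \<times> real \<times> real \<Rightarrow> complex) \<Rightarrow> real \<times> real \<times> real \<Rightarrow> complex" where
  "creat N u = (\<lambda>p. \<i> * nabla_y N u p - nabla_x u p)"

lemma smooth_sections_annih: "u \<in> smooth_sections N \<Longrightarrow> annih N u \<in> smooth_sections N"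
  unfolding annih_def
  by (intro smooth_sections_add smooth_sections_cmult smooth_sections_nabla_x smooth_sections_nabla_y)

lemma smooth_sections_creat: "u \<in> smooth_sections N \<Longrightarrow> creat N u \<in> smooth_sections N"
  unfolding creat_def
  by (intro smooth_sections_diff smooth_sections_cmult smooth_sections_nabla_x smooth_sections_nabla_y)

lemmas smooth_sections_continuous = C_infinity_continuous[OF smooth_sections_C_infinity]

lemma yz_coeff_annih:
  assumes "u \<in> smooth_sections N"
  shows "yz_coeff k m (annih N u) x = yz_coeff k m (nabla_x u) x + of_real (2 * pi * N * x - 2 * pi * k) * yz_coeff k m u x"
proof -
  have "yz_coeff k m (annih N u) x = yz_coeff k m (nabla_x u) x + \<i> * yz_coeff k m (nabla_y N u) x"
    unfolding annih_def yz_coeff_cmult[symmetric]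
    by (intro yz_coeff_add smooth_sections_continuous[of _ N] smooth_sections_cmult smooth_sections_nabla_x
        smooth_sections_nabla_y assms)
  then show ?thesis unfolding yz_coeff_nabla_y[OF assms] by (simp add: algebra_simps)
qed

lemma yz_coeff_creat:
  assumes "u \<in> smooth_sections N"
  shows "yz_coeff k m (creat N u) x = of_real (2 * pi * N * x - 2 * pi * k) * yz_coeff k m u x - yz_coeff k m (nabla_x u) x"
proof -
  have "yz_coeff k m (creat N u) x = \<i> * yz_coeff k m (nabla_y N u) x - yz_coeff k m (nabla_x u) x"
    unfolding creat_def yz_coeff_cmult[symmetric]
    by (intro yz_coeff_diff smooth_sections_continuous[of _ N] smooth_sections_cmult smooth_sections_nabla_x
        smooth_sections_nabla_y assms)
  then show ?thesis unfolding yz_coeff_nabla_y[OF assms] by (simp add: algebra_simps)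
qed

lemma yz_coeff_nabla_x_eqI:
  assumes "u \<in> smooth_sections N" "(f has_vector_derivative f') (at x)" "\<And>x. yz_coeff k m u x = f x"
  shows "yz_coeff k m (nabla_x u) x = f'"
  using yz_coeff_nabla_x[OF smooth_sections_C_infinity[OF assms(1)], of k m x] assms(2,3)
    vector_derivative_unique_at[of "yz_coeff k m u" _ x f'] by (metis ext)

text \<open>At fixed (k, m) the ladder operators are first-order differential operators in x alone,
  so proportionality of one pair of coefficient functions passes through them even if the sections
  themselves are not proportional. The case c = 0 propagates vanishing.\<close>

lemma yz_coeff_ladder_cong:
  assumes "u \<in> smooth_sections N" "v \<in> smooth_sections N" "\<And>x. yz_coeff k m v x = c * yz_coeff k m u x"
  shows "yz_coeff k m (annih N v) x = c * yz_coeff k m (annih N u) x"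
    "yz_coeff k m (creat N v) x = c * yz_coeff k m (creat N u) x"
proof -
  have "yz_coeff k m (nabla_x v) x = c * yz_coeff k m (nabla_x u) x"
    by (rule yz_coeff_nabla_x_eqI[OF assms(2) has_vector_derivative_mult_right[OF yz_coeff_nabla_x] assms(3)])
       (rule smooth_sections_C_infinity[OF assms(1)])
  then show "yz_coeff k m (annih N v) x = c * yz_coeff k m (annih N u) x"
    "yz_coeff k m (creat N v) x = c * yz_coeff k m (creat N u) x"
    by (simp_all add: yz_coeff_annih yz_coeff_creat assms algebra_simps)
qed

lemma yz_coeff_affine_derivative:
  assumes "u \<in> smooth_sections N"
  shows "((\<lambda>x. of_real (2 * pi * N * x - 2 * pi * k) * yz_coeff k m u x) has_vector_derivative
    of_real (2 * pi * N * x - 2 * pi * k) * yz_coeff k m (nabla_x u) x + of_real (2 * pi * N) * yz_coeff k m u x) (at x)"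
proof -
  have "((\<lambda>x. complex_of_real (2 * pi * N * x - 2 * pi * k)) has_vector_derivative of_real (2 * pi * N)) (at x)"
    by (intro has_vector_derivative_of_real) (auto intro!: derivative_eq_intros)
  from has_vector_derivative_mult[OF this yz_coeff_nabla_x[OF smooth_sections_C_infinity[OF assms]]]
  show ?thesis by simp
qed

lemma yz_coeff_nabla_x_annih:
  assumes "u \<in> smooth_sections N"
  shows "yz_coeff k m (nabla_x (annih N u)) x = yz_coeff k m (nabla_x (nabla_x u)) x
    + of_real (2 * pi * N * x - 2 * pi * k) * yz_coeff k m (nabla_x u) x + of_real (2 * pi * N) * yz_coeff k m u x"
  using yz_coeff_nabla_x_eqI[OF smooth_sections_annih[OF assms]
      has_vector_derivative_add[OF yz_coeff_nabla_x[OF smooth_sections_C_infinity[OF smooth_sections_nabla_x[OF assms]]]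
        yz_coeff_affine_derivative[OF assms, of k m]], OF yz_coeff_annih[OF assms]]
  by (simp add: add.assoc)

lemma yz_coeff_nabla_x_creat:
  assumes "u \<in> smooth_sections N"
  shows "yz_coeff k m (nabla_x (creat N u)) x =
    of_real (2 * pi * N * x - 2 * pi * k) * yz_coeff k m (nabla_x u) x + of_real (2 * pi * N) * yz_coeff k m u x
    - yz_coeff k m (nabla_x (nabla_x u)) x"
  using yz_coeff_nabla_x_eqI[OF smooth_sections_creat[OF assms]
      has_vector_derivative_diff[OF yz_coeff_affine_derivative[OF assms, of k m]
        yz_coeff_nabla_x[OF smooth_sections_C_infinity[OF smooth_sections_nabla_x[OF assms]]]], OF yz_coeff_creat[OF assms]]
  by simp

lemma yz_coeff_creat_annih:
  assumes "u \<in> smooth_sections N"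
  shows "yz_coeff k m (creat N (annih N u)) x = of_real ((2 * pi * N * x - 2 * pi * k)\<^sup>2 - 2 * pi * N) * yz_coeff k m u x
    - yz_coeff k m (nabla_x (nabla_x u)) x"
  unfolding yz_coeff_creat[OF smooth_sections_annih[OF assms]] yz_coeff_nabla_x_annih[OF assms] yz_coeff_annih[OF assms]
  by (simp add: algebra_simps power2_eq_square)

text \<open>The commutator of d/dx + xi and xi - d/dx is 2 xi' = 4 pi N, the same constant for all
  frequencies.\<close>

lemma annih_creat:
  assumes "u \<in> smooth_sections N"
  shows "annih N (creat N u) = (\<lambda>p. creat N (annih N u) p + of_real (4 * pi * N) * u p)"
proof (rule yz_coeff_eqI[of _ N])
  fix k m x
  show "yz_coeff k m (annih N (creat N u)) x = yz_coeff k m (\<lambda>p. creat N (annih N u) p + of_real (4 * pi * N) * u p) x"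
    unfolding yz_coeff_add[OF smooth_sections_continuous[OF smooth_sections_creat[OF smooth_sections_annih[OF assms]]]
        smooth_sections_continuous[OF smooth_sections_cmult[OF assms]]] yz_coeff_cmult yz_coeff_creat_annih[OF assms]
      yz_coeff_annih[OF smooth_sections_creat[OF assms]] yz_coeff_nabla_x_creat[OF assms] yz_coeff_creat[OF assms]
    by (simp add: algebra_simps power2_eq_square)
qed (intro smooth_sections_add smooth_sections_cmult smooth_sections_annih smooth_sections_creat assms)+

lemma magnetic_laplacian_smooth:
  assumes "u \<in> smooth_sections N"
  shows "magnetic_laplacian N u \<in> smooth_sections N"
proof -
  have eq: "magnetic_laplacian N u = (\<lambda>p. (-1) * nabla_x (nabla_x u) p - nabla_y N (nabla_y N u) p - nabla_z (nabla_z u) p)"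
    by (simp add: magnetic_laplacian_def)
  show ?thesis unfolding eq
    by (intro smooth_sections_diff smooth_sections_cmult smooth_sections_nabla_x smooth_sections_nabla_y smooth_sections_nabla_z assms)
qed

text \<open>Here -d^2/dx^2 + xi^2 is \<open>creat\<close> after \<open>annih\<close> plus xi' = 2 pi
  N, the zero-point energy; the z-derivatives contribute (2 pi m)^2.\<close>

lemma yz_coeff_magnetic_laplacian:
  assumes "u \<in> smooth_sections N"
  shows "yz_coeff k m (magnetic_laplacian N u) x =
    yz_coeff k m (creat N (annih N u)) x + of_real (2 * pi * N + (2 * pi * m)\<^sup>2) * yz_coeff k m u x"
proof -
  have eq: "magnetic_laplacian N u = (\<lambda>p. (-1) * nabla_x (nabla_x u) p - nabla_y N (nabla_y N u) p - nabla_z (nabla_z u) p)"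
    by (simp add: magnetic_laplacian_def)
  have "yz_coeff k m (magnetic_laplacian N u) x = (-1) * yz_coeff k m (nabla_x (nabla_x u)) x
      - yz_coeff k m (nabla_y N (nabla_y N u)) x - yz_coeff k m (nabla_z (nabla_z u)) x"
    unfolding eq yz_coeff_cmult[symmetric]
    by (subst yz_coeff_diff yz_coeff_diff,
       (intro smooth_sections_continuous[of _ N] smooth_sections_diff smooth_sections_cmult smooth_sections_nabla_x smooth_sections_nabla_y smooth_sections_nabla_z assms)+)+
      simp
  then show ?thesis
    unfolding yz_coeff_creat_annih[OF assms] yz_coeff_nabla_y[OF smooth_sections_nabla_y[OF assms]] yz_coeff_nabla_y[OF assms]
      yz_coeff_nabla_z[OF smooth_sections_nabla_z[OF assms]] yz_coeff_nabla_z[OF assms]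
    by (simp add: algebra_simps power2_eq_square)
qed

lemma eigenspace_iff:
  assumes "u \<in> smooth_sections N"
  shows "u \<in> eigenspace N \<mu> \<longleftrightarrow> (\<forall>k m x. yz_coeff k m (creat N (annih N u)) x =
    of_real (\<mu> - 2 * pi * N - (2 * pi * m)\<^sup>2) * yz_coeff k m u x)"
proof -
  have "u \<in> eigenspace N \<mu> \<longleftrightarrow> magnetic_laplacian N u = (\<lambda>p. of_real \<mu> * u p)"
    using assms by (auto simp: eigenspace_def fun_eq_iff)
  also have "\<dots> \<longleftrightarrow> (\<forall>k m x. yz_coeff k m (magnetic_laplacian N u) x = yz_coeff k m (\<lambda>p. of_real \<mu> * u p) x)"
    using yz_coeff_eqI[OF magnetic_laplacian_smooth[OF assms] smooth_sections_cmult[OF assms]] by metis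
  also have "\<dots> \<longleftrightarrow> (\<forall>k m x. yz_coeff k m (creat N (annih N u)) x =
    of_real (\<mu> - 2 * pi * N - (2 * pi * m)\<^sup>2) * yz_coeff k m u x)"
    unfolding yz_coeff_magnetic_laplacian[OF assms] yz_coeff_cmult
    by (simp add: algebra_simps)
  finally show ?thesis .
qed

text \<open>For a positive potential \<open>|c|\<^sup>2\<close> is convex.\<close>

lemma bounded_solution_eq_0:
  fixes c c' c'' :: "real \<Rightarrow> complex"
  assumes c: "\<And>x. (c has_vector_derivative c' x) (at x)" and c': "\<And>x. (c' has_vector_derivative c'' x) (at x)"
    and ode: "\<And>x. c'' x = of_real (V x) * c x" and V: "\<And>x. V x > 0" and B: "\<And>x. norm (c x) \<le> B"
  shows "c x = 0"
proof -
  define f where "f = (\<lambda>x. c x \<bullet> c x)"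
  define g where "g = (\<lambda>x. 2 * (c x \<bullet> c' x))"
  define h where "h = (\<lambda>x. 2 * (c' x \<bullet> c' x + V x * (c x \<bullet> c x)))"
  have fB: "0 \<le> f x" "f x \<le> B\<^sup>2" for x
    using power_mono[OF B[of x], of 2] by (simp_all add: f_def power2_norm_eq_inner)
  have df: "(f has_real_derivative g x) (at x)" for x
    using bounded_bilinear.has_vector_derivative[OF bounded_bilinear_inner c c, of x]
    by (simp add: f_def g_def has_real_derivative_iff_has_vector_derivative inner_commute)
  have dg: "(g has_real_derivative h x) (at x)" for x
    using has_vector_derivative_mult_right[OF bounded_bilinear.has_vector_derivative[OF bounded_bilinear_inner c c', of x], of 2]
    by (simp add: g_def h_def has_real_derivative_iff_has_vector_derivative inner_commute ode add.commute
        flip: scaleR_conv_of_real)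
  have h0: "0 \<le> h x" for x
    using V[of x] by (simp add: h_def)
  have gmono: "g x \<le> g y" if "x \<le> y" for x y
    using that dg h0 by (intro DERIV_nonneg_imp_nondecreasing[of x y g]) blast+
  have "g x = 0" for x
  proof (rule ccontr)
    assume "g x \<noteq> 0"
    then consider "g x > 0" | "g x < 0" by linarith
    then show False
    proof cases
      case 1
      \<comment> \<open>The slope of f is nondecreasing, so it stays at least g x to the right of x;
        over this length f would rise by at least B^2 + g x, above its bound. The second case is the
        mirror image.\<close>
      define t where "t = B\<^sup>2 / g x + 1"
      have "t > 0" using 1 by (simp add: t_def add_nonneg_pos)
      obtain z where z: "x < z" "f (x + t) - f x = t * g z"
        using MVT2[of x "x + t" f g] df \<open>t > 0\<close> by auto
      have "t * g x \<le> t * g z" using gmono[of x z] z \<open>t > 0\<close> by simp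
      moreover have "t * g x = B\<^sup>2 + g x" using 1 by (simp add: t_def field_simps)
      ultimately have "B\<^sup>2 + g x \<le> f (x + t)" using z(2) fB(1)[of x] by linarith
      then show False using fB(2)[of "x + t"] 1 by simp
    next
      case 2
      define t where "t = B\<^sup>2 / (- g x) + 1"
      have "B\<^sup>2 / (- g x) \<ge> 0" using 2 by (intro divide_nonneg_pos) auto
      then have "t > 0" by (simp add: t_def)
      obtain z where z: "z < x" "f x - f (x - t) = t * g z"
        using MVT2[of "x - t" x f g] df \<open>t > 0\<close> by auto
      have "t * g z \<le> t * g x" using gmono[of z x] z \<open>t > 0\<close> by simp
      moreover have "t * g x = g x - B\<^sup>2" using 2 by (simp add: t_def field_simps)
      ultimately have "B\<^sup>2 - g x \<le> f (x - t)" using z(2) fB(1)[of x] by simp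
      then show False using fB(2)[of "x - t"] 2 by simp
    qed
  qed
  then have "g = (\<lambda>x. 0)" by auto
  \<comment> \<open>The derivative of the zero function g is h, a sum of two nonnegative terms, so
    the potential term vanishes too.\<close>
  then have "h x = 0"
    using dg[of x] DERIV_unique[of g _ x 0] by simp
  then have "c' x \<bullet> c' x + V x * (c x \<bullet> c x) = 0" by (simp add: h_def)
  then have "V x * (c x \<bullet> c x) \<le> 0" using inner_ge_zero[of "c' x"] by linarith
  then have "c x \<bullet> c x \<le> 0" using V[of x] by (simp add: mult_le_0_iff)
  then have "c x \<bullet> c x = 0" using inner_ge_zero[of "c x"] by linarith
  then show ?thesis by (simp only: inner_eq_zero_iff)
qed

section \<open>Quantization and uniqueness at a single pair of frequencies\<close>

text \<open>The number e is the energy counted from the ground energy 2 pi N + (2 pi m)^2. Fixing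
  (k, m) makes this a statement about one ordinary differential equation.\<close>

definition landau :: "nat \<Rightarrow> int \<Rightarrow> int \<Rightarrow> (real \<times> real \<times> real \<Rightarrow> complex) \<Rightarrow> real \<Rightarrow> bool" where
  "landau N k m u e \<longleftrightarrow> (\<forall>x. yz_coeff k m (creat N (annih N u)) x = of_real e * yz_coeff k m u x)"

text \<open>Apply \<open>annih\<close> to the eigenvalue relation and exchange \<open>annih\<close>
  and \<open>creat\<close> by the commutator: one step down costs 4 pi N.\<close>

lemma landau_annih:
  assumes "u \<in> smooth_sections N" "landau N k m u e"
  shows "landau N k m (annih N u) (e - 4 * pi * N)"
proof -
  let ?v = "annih N u"
  have v: "?v \<in> smooth_sections N" by (rule smooth_sections_annih[OF assms(1)])
  have "yz_coeff k m (creat N (annih N ?v)) x = of_real (e - 4 * pi * N) * yz_coeff k m ?v x" for x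
  proof -
    have "yz_coeff k m (annih N (creat N ?v)) x =
        yz_coeff k m (creat N (annih N ?v)) x + of_real (4 * pi * N) * yz_coeff k m ?v x"
      unfolding annih_creat[OF v] yz_coeff_cmult[symmetric]
      by (intro yz_coeff_add smooth_sections_continuous[of _ N] smooth_sections_cmult smooth_sections_creat smooth_sections_annih v)
    moreover have "yz_coeff k m (annih N (creat N ?v)) x = of_real e * yz_coeff k m ?v x"
      using assms(2) by (intro yz_coeff_ladder_cong(1)[OF assms(1) smooth_sections_creat[OF v]]) (simp add: landau_def)
    ultimately show ?thesis by (simp add: algebra_simps)
  qed
  then show ?thesis by (simp add: landau_def)
qed

text \<open>The coefficient solves c'' = (xi^2 - 2 pi N - e) c, whose potential is positive below
  the threshold; a bounded solution is then 0.\<close>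

lemma landau_negative:
  assumes u: "u \<in> smooth_sections N" and e: "landau N k m u e" "e + 2 * pi * N < 0"
  shows "yz_coeff k m u x = 0"
proof -
  obtain B where "\<And>k m x. norm (yz_coeff k m u x) \<le> B" using yz_coeff_bounded[OF u] by blast
  then show ?thesis
  proof (intro bounded_solution_eq_0[where c = "yz_coeff k m u" and c' = "yz_coeff k m (nabla_x u)" and
        c'' = "yz_coeff k m (nabla_x (nabla_x u))" and V = "\<lambda>x. (2 * pi * N * x - 2 * pi * k)\<^sup>2 - 2 * pi * N - e"])
    show "0 < (2 * pi * N * x - 2 * pi * k)\<^sup>2 - 2 * pi * N - e" for x
      using e(2) zero_le_power2[of "2 * pi * N * x - 2 * pi * k"] by linarith
    show "yz_coeff k m (nabla_x (nabla_x u)) x = of_real ((2 * pi * N * x - 2 * pi * k)\<^sup>2 - 2 * pi * N - e) * yz_coeff k m u x" for x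
      using e(1) yz_coeff_creat_annih[OF u, of k m x] by (simp add: landau_def algebra_simps)
  qed (auto intro!: yz_coeff_nabla_x smooth_sections_C_infinity smooth_sections_nabla_x u)
qed

text \<open>Here n bounds the number of descents until the energy passes the threshold of
  \<open>landau_negative\<close>. Each descent either leaves a nonzero coefficient function, to
  which the induction hypothesis applies, or annihilates it, which forces e = 0.\<close>

lemma landau_quantized:
  assumes "u \<in> smooth_sections N" "landau N k m u e" "e + 2 * pi * N < 4 * pi * N * real n" "yz_coeff k m u x \<noteq> 0"
  shows "\<exists>j::nat. e = 4 * pi * N * real j"
  using assms
proof (induction n arbitrary: u e x)
  case 0
  then show ?case using landau_negative[of u N k m e x] by simp
next
  case (Suc n)
  let ?v = "annih N u"
  note v = smooth_sections_annih[OF Suc.prems(1)]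
  show ?case
  proof (cases "\<exists>x. yz_coeff k m ?v x \<noteq> 0")
    case True
    then obtain y where "yz_coeff k m ?v y \<noteq> 0" by blast
    with Suc.IH[OF v landau_annih[OF Suc.prems(1,2)]] Suc.prems(3)
    obtain j where "e - 4 * pi * N = 4 * pi * N * real j" by (auto simp: algebra_simps)
    then have "e = 4 * pi * N * real (Suc j)" by (simp add: algebra_simps)
    then show ?thesis by blast
  next
    case False
    then have "yz_coeff k m (creat N ?v) x = 0 * yz_coeff k m (creat N u) x"
      by (intro yz_coeff_ladder_cong(2)[OF Suc.prems(1) v]) simp
    then have "e = 0" using Suc.prems(2,4) by (simp add: landau_def)
    then show ?thesis by (intro exI[of _ 0]) simp
  qed
qed

lemma landau_quantized':
  assumes "N > 0" "u \<in> smooth_sections N" "landau N k m u e" "yz_coeff k m u x \<noteq> 0"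
  shows "\<exists>j::nat. e = 4 * pi * N * real j"
proof -
  obtain n where "(e + 2 * pi * N) / (4 * pi * N) < real n" using reals_Archimedean2 by blast
  then have "e + 2 * pi * N < 4 * pi * N * real n" using assms(1) by (simp add: field_simps)
  from landau_quantized[OF assms(2,3) this assms(4)] show ?thesis .
qed

text \<open>The equation c' = -xi c has integrating factor exp W, where W is the primitive of xi
  with W 0 = 0.\<close>

lemma annih_0_gaussian:
  assumes u: "u \<in> smooth_sections N" and "\<And>x. yz_coeff k m (annih N u) x = 0"
  shows "yz_coeff k m u x = yz_coeff k m u 0 * of_real (exp (2 * pi * k * x - pi * N * x\<^sup>2))"
proof -
  define W where "W x = pi * N * x\<^sup>2 - 2 * pi * k * x" for x
  define g where "g x = yz_coeff k m u x * of_real (exp (W x))" for x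
  have "(g has_vector_derivative 0) (at x)" for x
  proof -
    have d: "yz_coeff k m (nabla_x u) x = - of_real (2 * pi * N * x - 2 * pi * k) * yz_coeff k m u x"
      using assms(2)[of x] unfolding yz_coeff_annih[OF u] mult_minus_left by (simp only: eq_neg_iff_add_eq_0)
    have "((\<lambda>x. exp (W x)) has_real_derivative exp (W x) * (2 * pi * N * x - 2 * pi * k)) (at x)"
      unfolding W_def by (auto intro!: derivative_eq_intros simp: field_simps)
    then have "((\<lambda>x. complex_of_real (exp (W x))) has_vector_derivative of_real (exp (W x) * (2 * pi * N * x - 2 * pi * k))) (at x)"
      by (intro has_vector_derivative_of_real)
    from has_vector_derivative_mult[OF yz_coeff_nabla_x[OF smooth_sections_C_infinity[OF u], of k m x] this] show ?thesis
      unfolding g_def d by (simp add: algebra_simps)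
  qed
  then obtain C where "\<And>x. g x = C"
    using has_vector_derivative_zero_constant[of UNIV g] by auto
  then have "g x = g 0" by simp
  then have "yz_coeff k m u x * (of_real (exp (W x)) * of_real (exp (- W x))) = yz_coeff k m u 0 * of_real (exp (- W x))"
    by (simp add: g_def W_def)
  then show ?thesis by (simp add: W_def flip: of_real_mult exp_add)
qed

text \<open>At level 0 both coefficients are multiples of the same Gaussian. At a higher level the
  images under \<open>annih\<close> are proportional by induction; applying \<open>creat\<close>
  returns the coefficients themselves, up to the nonzero factor e.\<close>

lemma landau_unique:
  assumes "N > 0" "u \<in> smooth_sections N" "v \<in> smooth_sections N"
    "landau N k m u (4 * pi * N * real j)" "landau N k m v (4 * pi * N * real j)" "yz_coeff k m v y \<noteq> 0"
  shows "\<exists>\<alpha>. \<forall>x. yz_coeff k m u x = \<alpha> * yz_coeff k m v x"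
  using assms(2-)
proof (induction j arbitrary: u v y)
  case 0
  \<comment> \<open>A nonzero image under \<open>annih\<close> would have energy -4 pi N, which
    quantization excludes.\<close>
  have z: "yz_coeff k m (annih N w) x = 0" if "w \<in> smooth_sections N" "landau N k m w 0" for w x
  proof (rule ccontr)
    assume "yz_coeff k m (annih N w) x \<noteq> 0"
    from landau_quantized'[OF assms(1) smooth_sections_annih[OF that(1)] landau_annih[OF that] this]
    obtain j :: nat where "- (4 * pi * N) = 4 * pi * N * real j" by auto
    moreover have "0 < 4 * pi * real N" "0 \<le> 4 * pi * real N * real j" using assms(1) by simp_all
    ultimately show False by linarith
  qed
  have gu: "yz_coeff k m u x = yz_coeff k m u 0 * of_real (exp (2 * pi * k * x - pi * N * x\<^sup>2))" for x
    by (intro annih_0_gaussian[OF 0(1)] z) (use 0 in auto)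
  have gv: "yz_coeff k m v x = yz_coeff k m v 0 * of_real (exp (2 * pi * k * x - pi * N * x\<^sup>2))" for x
    by (intro annih_0_gaussian[OF 0(2)] z) (use 0 in auto)
  have "yz_coeff k m v 0 \<noteq> 0" using 0(5) gv[of y] by auto
  then have "\<forall>x. yz_coeff k m u x = (yz_coeff k m u 0 / yz_coeff k m v 0) * yz_coeff k m v x"
    using gu gv by (metis (no_types, lifting) mult.assoc nonzero_eq_divide_eq)
  then show ?case by blast
next
  case (Suc j)
  let ?e = "4 * pi * N * real (Suc j)"
  have e: "?e \<noteq> 0" using assms(1) by simp
  have e': "?e - 4 * pi * N = 4 * pi * N * real j" by (simp add: algebra_simps)
  have "\<exists>y. yz_coeff k m (annih N v) y \<noteq> 0"
  proof (rule ccontr)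
    assume "\<not> ?thesis"
    then have "yz_coeff k m (creat N (annih N v)) y = 0 * yz_coeff k m (creat N v) y"
      by (intro yz_coeff_ladder_cong(2)[OF Suc.prems(2) smooth_sections_annih[OF Suc.prems(2)]]) simp
    then have "of_real ?e * yz_coeff k m v y = 0" using Suc.prems(4) unfolding landau_def by (metis mult_zero_left)
    with Suc.prems(5) e show False by (metis mult_eq_0_iff of_real_eq_0_iff)
  qed
  then obtain y' where "yz_coeff k m (annih N v) y' \<noteq> 0" by blast
  from Suc.IH[OF smooth_sections_annih[OF Suc.prems(1)] smooth_sections_annih[OF Suc.prems(2)]
      landau_annih[OF Suc.prems(1,3), unfolded e'] landau_annih[OF Suc.prems(2,4), unfolded e'] this]
  obtain \<alpha> where \<alpha>: "\<And>x. yz_coeff k m (annih N u) x = \<alpha> * yz_coeff k m (annih N v) x" by blast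
  have "yz_coeff k m u x = \<alpha> * yz_coeff k m v x" for x
  proof -
    have "yz_coeff k m (creat N (annih N u)) x = \<alpha> * yz_coeff k m (creat N (annih N v)) x"
      by (rule yz_coeff_ladder_cong(2)[OF smooth_sections_annih[OF Suc.prems(2)] smooth_sections_annih[OF Suc.prems(1)] \<alpha>])
    then have "of_real ?e * yz_coeff k m u x = of_real ?e * (\<alpha> * yz_coeff k m v x)"
      using Suc.prems(3,4) by (simp only: landau_def mult_ac)
    then show ?thesis using e by (simp only: mult_cancel_left of_real_eq_0_iff) simp
  qed
  then show ?case by blast
qed

section \<open>Theta functions\<close>

text \<open>The part n >= 0 of a theta series, so that it is a power series in \<zeta> and entire in
  it.\<close>

definition half_theta :: "real \<Rightarrow> complex \<Rightarrow> complex" where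
  "half_theta q \<zeta> = (\<Sum>n. of_real (q ^ n\<^sup>2) * \<zeta> ^ n)"

lemma half_theta_summable:
  assumes "0 \<le> q" "q < 1"
  shows "summable (\<lambda>n. of_real (q ^ n\<^sup>2) * \<zeta> ^ n :: complex)"
proof -
  have "(\<lambda>n. q ^ n * norm \<zeta>) \<longlonglongrightarrow> 0 * norm \<zeta>"
    using assms by (intro tendsto_mult_right LIMSEQ_power_zero) auto
  then have "eventually (\<lambda>n. q ^ n * norm \<zeta> < 1 / 2) sequentially"
    by (rule order_tendstoD) simp
  then have "eventually (\<lambda>n. norm (of_real (q ^ n\<^sup>2) * \<zeta> ^ n) \<le> (1 / 2) ^ n) sequentially"
  proof eventually_elim
    case (elim n)
    have "norm (of_real (q ^ n\<^sup>2) * \<zeta> ^ n) = (q ^ n * norm \<zeta>) ^ n"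
      using assms by (simp add: norm_mult norm_power power2_eq_square power_mult power_mult_distrib)
    also have "\<dots> \<le> (1 / 2) ^ n" using elim assms by (intro power_mono) auto
    finally show ?case .
  qed
  then show ?thesis by (rule summable_comparison_test_ev) (simp add: summable_geometric)
qed

text \<open>Split off n = 0 and use (n + 1)^2 = n^2 + 2n + 1. This is one half of the
  quasi-periodicity of the full series.\<close>

lemma half_theta_rec:
  assumes "0 < q" "q < 1"
  shows "half_theta q \<zeta> = 1 + of_real q * \<zeta> * half_theta q ((of_real q)\<^sup>2 * \<zeta>)"
proof -
  have "half_theta q \<zeta> = 1 + (\<Sum>n. of_real (q ^ (Suc n)\<^sup>2) * \<zeta> ^ Suc n)"
    unfolding half_theta_def using suminf_split_head[OF half_theta_summable[of q \<zeta>]] assms by simp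
  also have "(\<lambda>n. of_real (q ^ (Suc n)\<^sup>2) * \<zeta> ^ Suc n) = (\<lambda>n. (of_real q * \<zeta>) * (of_real (q ^ n\<^sup>2) * ((of_real q)\<^sup>2 * \<zeta>) ^ n))"
  proof
    fix n
    have "(Suc n)\<^sup>2 = 1 + n\<^sup>2 + 2 * n" by (simp add: power2_eq_square)
    then have "q ^ (Suc n)\<^sup>2 = q * q ^ n\<^sup>2 * (q\<^sup>2) ^ n" by (simp only: power_add power_mult power_one_right)
    then show "complex_of_real (q ^ (Suc n)\<^sup>2) * \<zeta> ^ Suc n = (of_real q * \<zeta>) * (of_real (q ^ n\<^sup>2) * ((of_real q)\<^sup>2 * \<zeta>) ^ n)"
      by (simp only: of_real_mult of_real_power power_mult_distrib power_Suc mult_ac)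
  qed
  also have "(\<Sum>n. (of_real q * \<zeta>) * (of_real (q ^ n\<^sup>2) * ((of_real q)\<^sup>2 * \<zeta>) ^ n)) = of_real q * \<zeta> * half_theta q ((of_real q)\<^sup>2 * \<zeta>)"
    unfolding half_theta_def using assms by (intro suminf_mult half_theta_summable) auto
  finally show ?thesis .
qed

lemma half_theta_holomorphic:
  assumes "0 \<le> q" "q < 1"
  shows "half_theta q holomorphic_on UNIV"
proof -
  have "(half_theta q has_field_derivative (\<Sum>n. diffs (\<lambda>n. of_real (q ^ n\<^sup>2)) n * \<zeta> ^ n)) (at \<zeta>)" for \<zeta>
    unfolding half_theta_def[abs_def]
    by (rule termdiffs_strong_converges_everywhere) (rule half_theta_summable[OF assms])
  then show ?thesis by (auto simp: holomorphic_on_def field_differentiable_def)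
qed

text \<open>The Jacobi theta series of exp(-pi N n^2 + 2 pi N n w) over all integers n: the two
  halves share the term n = 0, whence the -1.\<close>

definition theta :: "nat \<Rightarrow> complex \<Rightarrow> complex" where
  "theta N w = half_theta (exp (- pi * N)) (exp (of_real (2 * pi * N) * w)) +
    half_theta (exp (- pi * N)) (exp (of_real (- 2 * pi * N) * w)) - 1"

lemma theta_holomorphic:
  assumes "N > 0"
  shows "theta N holomorphic_on UNIV"
proof -
  have h: "half_theta (exp (- pi * N)) holomorphic_on UNIV"
    using assms by (intro half_theta_holomorphic) auto
  have "(\<lambda>w. half_theta (exp (- pi * N)) (exp (c * w))) holomorphic_on UNIV" for c
    using holomorphic_on_compose_gen[OF _ h, of "\<lambda>w. exp (c * w)" UNIV] by (auto simp: o_def intro!: holomorphic_intros)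
  from holomorphic_on_diff[OF holomorphic_on_add[OF this[of "of_real (2 * pi * N)"] this[of "of_real (- 2 * pi * N)"]] holomorphic_on_const[of 1]]
  show ?thesis by (simp add: theta_def[abs_def])
qed

text \<open>In the two-sided series the shift is a renumbering of n. With two halves, the recursion
  is used at \<zeta>/Q^2 and at 1/\<zeta>, which moves one term across from one half to the
  other.\<close>

lemma theta_shift_1:
  assumes "N > 0"
  shows "theta N (w + 1) = exp (of_real (pi * N) + of_real (2 * pi * N) * w) * theta N w"
proof -
  define q where "q = exp (- pi * real N)"
  have q: "0 < q" "q < 1" using assms by (auto simp: q_def)
  define Q where "Q = complex_of_real q"
  define \<zeta> where "\<zeta> = exp (of_real (2 * pi * N) * w)"
  have nz: "\<zeta> \<noteq> 0" "Q \<noteq> 0" using q by (auto simp: \<zeta>_def Q_def)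
  have Q: "Q = exp (of_real (- pi * N))" by (simp only: Q_def q_def exp_of_real)
  have "Q * exp (of_real (pi * N)) = 1" unfolding Q exp_add[symmetric] of_real_add[symmetric] by simp
  then have E: "exp (of_real (pi * N)) = 1 / Q" using nz by (metis nonzero_eq_divide_eq mult.commute)
  have E2: "exp (of_real (2 * pi * N)) = 1 / Q\<^sup>2"
  proof -
    have "of_real (2 * pi * N) = of_real (pi * N) + complex_of_real (pi * N)" by simp
    then show ?thesis by (simp only: exp_add E) (simp add: power2_eq_square)
  qed
  have E3: "exp (of_real (- 2 * pi * N)) = Q\<^sup>2"
  proof -
    have "of_real (- 2 * pi * N) = of_real (- pi * N) + complex_of_real (- pi * N)" by simp
    then show ?thesis by (simp only: exp_add Q power2_eq_square)
  qed
  have e: "exp (of_real (pi * N) + of_real (2 * pi * N) * w) = \<zeta> / Q"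
    unfolding \<zeta>_def exp_add E by simp
  have e1: "exp (of_real (2 * pi * N) * (w + 1)) = \<zeta> / Q\<^sup>2"
    unfolding distrib_left exp_add mult_1_right E2 \<zeta>_def by simp
  have "\<zeta> * exp (of_real (- 2 * pi * N) * w) = 1"
    unfolding \<zeta>_def exp_add[symmetric] distrib_right[symmetric] of_real_add[symmetric] by simp
  then have e3: "exp (of_real (- 2 * pi * N) * w) = 1 / \<zeta>"
    using nz by (metis nonzero_eq_divide_eq mult.commute)
  have e2: "exp (of_real (- 2 * pi * N) * (w + 1)) = Q\<^sup>2 * (1 / \<zeta>)"
    unfolding distrib_left exp_add mult_1_right E3 e3 by (rule mult.commute)
  have h1: "half_theta q (\<zeta> / Q\<^sup>2) = 1 + \<zeta> / Q * half_theta q \<zeta>"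
    using half_theta_rec[OF q, of "\<zeta> / Q\<^sup>2", folded Q_def] nz by (simp add: power2_eq_square)
  have h2: "half_theta q (1 / \<zeta>) = 1 + Q / \<zeta> * half_theta q (Q\<^sup>2 * (1 / \<zeta>))"
    using half_theta_rec[OF q, of "1 / \<zeta>", folded Q_def] by simp
  have "half_theta q (\<zeta> / Q\<^sup>2) + half_theta q (Q\<^sup>2 * (1 / \<zeta>)) - 1 =
      \<zeta> / Q * (half_theta q \<zeta> + half_theta q (1 / \<zeta>) - 1)"
    unfolding h1 h2 using nz by (simp add: distrib_left)
  then show ?thesis unfolding theta_def e e1 e2 e3 \<zeta>_def[symmetric] q_def[symmetric] .
qed

lemma theta_shift_imaginary:
  assumes "N > 0"
  shows "theta N (w + \<i> * of_real (of_int n / N)) = theta N w"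
proof -
  have "exp (of_real (2 * pi * of_int j * N) * (\<i> * of_real (of_int n / N))) = 1" for j
  proof -
    have "of_real (2 * pi * of_int j * N) * (\<i> * of_real (of_int n / N)) = \<i> * (of_int (j * n) * (of_real pi * 2))"
      using assms by simp
    then show ?thesis by (simp only: exp_2pi_1_int)
  qed
  from this[of 1] this[of "-1"] show ?thesis
    unfolding theta_def distrib_left exp_add by simp
qed

text \<open>At w = 0 all terms are positive real numbers, and the term n = 0 already makes each half
  at least 1.\<close>

lemma theta_0_neq_0:
  assumes "N > 0"
  shows "theta N 0 \<noteq> 0"
proof -
  define q where "q = exp (- pi * real N)"
  have q: "0 < q" "q < 1" using assms by (auto simp: q_def)
  have s: "summable (\<lambda>n. q ^ n\<^sup>2)"
    using summable_Re[OF half_theta_summable[of q 1]] q by simp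
  have h: "half_theta q 1 = of_real (\<Sum>n. q ^ n\<^sup>2)"
    unfolding half_theta_def using suminf_of_real[OF s, where 'a = complex] by simp
  have "(\<Sum>n. q ^ n\<^sup>2) \<ge> (\<Sum>n<1. q ^ n\<^sup>2)"
    using q by (intro sum_le_suminf s) auto
  then have "(\<Sum>n. q ^ n\<^sup>2) \<ge> 1" by simp
  then have "2 * (\<Sum>n. q ^ n\<^sup>2) - 1 \<noteq> 0" by linarith
  moreover have "theta N 0 = half_theta q 1 + half_theta q 1 - 1"
    by (simp only: theta_def q_def mult_zero_right exp_zero)
  then have "theta N 0 = of_real (2 * (\<Sum>n. q ^ n\<^sup>2) - 1)"
    by (simp add: h)
  ultimately show ?thesis by (simp only: of_real_eq_0_iff not_False_eq_True)
qed

text \<open>Expanding theta and completing the square gives e^(2 pi i m z) times the sum over n of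
  e^(2 pi i (r + N n) y) exp(-pi N (x - (r + N n)/N)^2): every frequency k congruent to r carries
  the oscillator ground state centred at k/N. The closed form makes smoothness immediate.\<close>

definition ground_section :: "nat \<Rightarrow> nat \<Rightarrow> int \<Rightarrow> real \<times> real \<times> real \<Rightarrow> complex" where
  "ground_section N r m = (\<lambda>(x, y, z). exp (2 * pi * \<i> * (of_int m * of_real z + of_nat r * of_real y)) *
     exp (of_real (- pi * N) * (of_real x - of_real (r / N))\<^sup>2) * theta N (of_real x + \<i> * of_real y - of_real (r / N)))"

lemma ground_section_C_infinity:
  assumes "N > 0"
  shows "C_infinity (ground_section N r m)"
proof -
  have "bounded_linear (\<lambda>p::real \<times> real \<times> real. of_int m * complex_of_real (snd (snd p)) + of_nat r * of_real (fst (snd p)))"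
    by (intro bounded_linear_add bounded_linear_const_mult bounded_linear_compose[OF bounded_linear_of_real]
        bounded_linear_compose[OF bounded_linear_fst bounded_linear_snd] bounded_linear_compose[OF bounded_linear_snd bounded_linear_snd])
  from C_infinity_holomorphic_linear[OF _ this, of "\<lambda>w. exp (2 * of_real pi * \<i> * w)"]
  have 1: "C_infinity (\<lambda>p::real \<times> real \<times> real. exp (2 * pi * \<i> * (of_int m * of_real (snd (snd p)) + of_nat r * of_real (fst (snd p)))))"
    by (auto intro!: holomorphic_intros)
  have "bounded_linear (\<lambda>p::real \<times> real \<times> real. complex_of_real (fst p))"
    by (intro bounded_linear_compose[OF bounded_linear_of_real] bounded_linear_fst)
  moreover have "(\<lambda>w. exp (of_real (- pi * N) * (w - of_real (r / N))\<^sup>2)) holomorphic_on UNIV"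
    by (intro holomorphic_intros)
  ultimately
  have 2: "C_infinity (\<lambda>p::real \<times> real \<times> real. exp (of_real (- pi * N) * (of_real (fst p) - of_real (r / N))\<^sup>2))"
    by (intro C_infinity_holomorphic_linear[where g = "\<lambda>w. exp (of_real (- pi * N) * (w - of_real (r / N))\<^sup>2)"])
  have L: "bounded_linear (\<lambda>p::real \<times> real \<times> real. of_real (fst p) + \<i> * of_real (fst (snd p)))"
    by (intro bounded_linear_add bounded_linear_const_mult bounded_linear_compose[OF bounded_linear_of_real] bounded_linear_fst
        bounded_linear_compose[OF bounded_linear_fst bounded_linear_snd])
  have "(\<lambda>w. theta N (w - of_real (r / N))) holomorphic_on UNIV"
  proof -
    have "(\<lambda>w. w - of_real (r / N)) holomorphic_on UNIV" by (intro holomorphic_intros)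
    from holomorphic_on_compose_gen[OF this theta_holomorphic[OF assms]] show ?thesis by (simp add: o_def)
  qed
  from C_infinity_holomorphic_linear[OF this L]
  have 3: "C_infinity (\<lambda>p::real \<times> real \<times> real. theta N (of_real (fst p) + \<i> * of_real (fst (snd p)) - of_real (r / N)))" .
  from C_infinity_mult[OF C_infinity_mult[OF 1 2] 3] show ?thesis
    unfolding ground_section_def case_prod_unfold .
qed

text \<open>The theta factor has period 1/N in y, so only e^(2 pi i r y) responds. The resulting
  eigenvalue identifies r modulo N.\<close>

lemma ground_section_shift_y:
  assumes "N > 0"
  shows "ground_section N r m (x, y + of_int n / N, z) = cis (2 * pi * of_int n * r / N) * ground_section N r m (x, y, z)"
proof -
  have t: "theta N (of_real x + \<i> * of_real (y + of_int n / N) - of_real (r / N)) = theta N (of_real x + \<i> * of_real y - of_real (r / N))"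
  proof -
    have "of_real x + \<i> * of_real (y + of_int n / N) - of_real (r / N) = of_real x + \<i> * of_real y - of_real (r / N) + \<i> * complex_of_real (of_int n / N)"
      by (simp add: distrib_left)
    then show ?thesis by (simp only: theta_shift_imaginary[OF assms])
  qed
  have "2 * pi * \<i> * (of_int m * of_real z + of_nat r * of_real (y + of_int n / N)) =
      \<i> * of_real (2 * pi * of_int n * r / N) + 2 * pi * \<i> * (of_int m * of_real z + of_nat r * of_real y)"
    by (simp add: field_simps)
  then have e: "exp (2 * pi * \<i> * (of_int m * of_real z + of_nat r * of_real (y + of_int n / N))) =
      cis (2 * pi * of_int n * r / N) * exp (2 * pi * \<i> * (of_int m * of_real z + of_nat r * of_real y))"
    by (simp only: exp_add cis_conv_exp)
  show ?thesis unfolding ground_section_def prod.case t e by (simp only: mult.assoc)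
qed

lemma ground_section_smooth:
  assumes "N > 0"
  shows "ground_section N r m \<in> smooth_sections N"
proof -
  have 1: "ground_section N r m (x + 1, y, z) = exp (2 * of_real pi * \<i> * of_nat N * of_real y) * ground_section N r m (x, y, z)" for x y z
  proof -
    define w where "w = of_real x + \<i> * of_real y - complex_of_real (r / N)"
    have w1: "of_real (x + 1) + \<i> * of_real y - complex_of_real (r / N) = w + 1" by (simp add: w_def)
    have w2: "of_real (x + 1) - complex_of_real (r / N) = w + 1 - \<i> * of_real y" by (simp add: w_def)
    have w3: "of_real x - complex_of_real (r / N) = w - \<i> * of_real y" by (simp add: w_def)
    \<comment> \<open>With s = x - r/N, the Gaussian changes by exp(-2 pi N s - pi N) and theta by
      exp(pi N + 2 pi N (s + i y)); only the multiplier e^(2 pi i N y) survives.\<close>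
    have g: "exp (of_real (- pi * N) * (w + 1 - \<i> * of_real y)\<^sup>2) * exp (of_real (pi * N) + of_real (2 * pi * N) * w) =
        exp (2 * of_real pi * \<i> * of_nat N * of_real y) * exp (of_real (- pi * N) * (w - \<i> * of_real y)\<^sup>2)"
      unfolding exp_add[symmetric] by (intro arg_cong[of _ _ exp]) (simp add: power2_eq_square algebra_simps)
    show ?thesis
      unfolding ground_section_def prod.case w1 w2 w3 w_def[symmetric] theta_shift_1[OF assms]
      using arg_cong[OF g, of "\<lambda>v. exp (2 * pi * \<i> * (of_int m * of_real z + of_nat r * of_real y)) * v * theta N w"]
      by (simp only: mult_ac)
  qed
  have 2: "ground_section N r m (x, y + 1, z) = ground_section N r m (x, y, z)" for x y z
  proof -
    have "of_int (int N) / real N = 1" "2 * pi * of_int (int N) * r / N = 2 * pi * of_int (int r)"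
      using assms by simp_all
    then show ?thesis using ground_section_shift_y[OF assms, of r m x y "int N" z] by (simp only: cis_2pi_int mult_1_left)
  qed
  have "exp (2 * pi * \<i> * (of_int m * of_real (z + 1) + of_nat r * of_real y)) =
      exp (2 * pi * \<i> * (of_int m * of_real z + of_nat r * of_real y))" for y z
  proof -
    have "2 * pi * \<i> * (of_int m * of_real (z + 1) + of_nat r * of_real y) =
      2 * pi * \<i> * (of_int m * of_real z + of_nat r * of_real y) + \<i> * (of_int m * (of_real pi * 2))"
      by (simp add: algebra_simps)
    then show ?thesis by (simp only: exp_add exp_2pi_1_int mult_1_right)
  qed
  then have 3: "ground_section N r m (x, y, z + 1) = ground_section N r m (x, y, z)" for x y z
    by (simp add: ground_section_def)
  show ?thesis
    unfolding smooth_sections_def using 1 2 3 ground_section_C_infinity[OF assms] by blast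
qed

lemma ground_section_neq_0:
  assumes "N > 0"
  shows "ground_section N r m (r / N, 0, 0) \<noteq> 0"
  using theta_0_neq_0[OF assms] by (simp add: ground_section_def)

text \<open>On the theta factor \<open>annih\<close> acts as a Cauchy-Riemann operator and gives T +
  i (i T) = 0. The contributions of the Gaussian, the phase and the connection cancel because N
  \<rho> = r.\<close>

lemma annih_ground_section:
  assumes "N > 0"
  shows "annih N (ground_section N r m) = (\<lambda>p. 0)"
proof -
  have "annih N (ground_section N r m) (x, y, z) = 0" for x y z
  proof -
    define \<rho> where "\<rho> = complex_of_real (r / N)"
    define E where "E = exp (2 * pi * \<i> * (of_int m * of_real z + of_nat r * of_real y))"
    define G where "G = exp (of_real (- pi * N) * (of_real x - \<rho>)\<^sup>2)"
    define w where "w = of_real x + \<i> * of_real y - \<rho>"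
    define T where "T = deriv (theta N) w"
    have dT: "(theta N has_field_derivative T) (at w)"
      unfolding T_def using theta_holomorphic[OF assms] holomorphic_derivI by blast
    have "((\<lambda>s. E * exp (of_real (- pi * N) * (s - \<rho>)\<^sup>2) * theta N (s + \<i> * of_real y - \<rho>)) has_field_derivative
        E * G * (T - of_real (2 * pi * N) * (of_real x - \<rho>) * theta N w)) (at (of_real x))"
    proof -
      have 1: "((\<lambda>s. theta N (s + \<i> * of_real y - \<rho>)) has_field_derivative T * 1) (at (of_real x))"
        by (rule DERIV_chain2[where f = "theta N" and g = "\<lambda>s. s + \<i> * of_real y - \<rho>", OF dT[unfolded w_def]]) (auto intro!: derivative_eq_intros)
      have 2: "((\<lambda>s. E * exp (of_real (- pi * N) * (s - \<rho>)\<^sup>2)) has_field_derivative E * (G * (of_real (- 2 * pi * N) * (of_real x - \<rho>)))) (at (of_real x))"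
        unfolding G_def by (auto intro!: derivative_eq_intros simp: algebra_simps)
      from DERIV_mult[OF 2 1] show ?thesis by (simp add: w_def G_def algebra_simps)
    qed
    from has_vector_derivative_real_field[OF this]
    have "((\<lambda>t. ground_section N r m (t, y, z)) has_vector_derivative
        E * G * (T - of_real (2 * pi * N) * (of_real x - \<rho>) * theta N w)) (at x)"
      by (simp add: ground_section_def E_def \<rho>_def)
    from vector_derivative_unique_at[OF partial_x[OF ground_section_C_infinity[OF assms]] this]
    have dx: "nabla_x (ground_section N r m) (x, y, z) = E * G * (T - of_real (2 * pi * N) * (of_real x - \<rho>) * theta N w)"
      by (simp add: nabla_x_def)
    have "((\<lambda>s. exp (2 * pi * \<i> * (of_int m * of_real z + of_nat r * s)) * G * theta N (of_real x + \<i> * s - \<rho>)) has_field_derivative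
        E * G * (\<i> * T + 2 * pi * \<i> * r * theta N w)) (at (of_real y))"
    proof -
      have 1: "((\<lambda>s. theta N (of_real x + \<i> * s - \<rho>)) has_field_derivative T * \<i>) (at (of_real y))"
        by (rule DERIV_chain2[where f = "theta N" and g = "\<lambda>s. of_real x + \<i> * s - \<rho>", OF dT[unfolded w_def]]) (auto intro!: derivative_eq_intros)
      have 2: "((\<lambda>s. exp (2 * pi * \<i> * (of_int m * of_real z + of_nat r * s)) * G) has_field_derivative E * (2 * pi * \<i> * r) * G) (at (of_real y))"
        unfolding E_def by (auto intro!: derivative_eq_intros)
      from DERIV_mult[OF 2 1] show ?thesis by (simp add: w_def E_def algebra_simps)
    qed
    from has_vector_derivative_real_field[OF this]
    have "((\<lambda>t. ground_section N r m (x, t, z)) has_vector_derivative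
        E * G * (\<i> * T + 2 * pi * \<i> * r * theta N w)) (at y)"
      by (simp add: ground_section_def G_def \<rho>_def)
    from vector_derivative_unique_at[OF partial_y[OF ground_section_C_infinity[OF assms]] this]
    have dy: "dir_deriv (0, 1, 0) (ground_section N r m) (x, y, z) = E * G * (\<i> * T + 2 * pi * \<i> * r * theta N w)" .
    have u: "ground_section N r m (x, y, z) = E * G * theta N w"
      by (simp add: ground_section_def E_def G_def w_def \<rho>_def)
    have "of_nat N * \<rho> = of_nat r" using assms by (simp add: \<rho>_def)
    then have "2 * pi * (of_nat N * \<rho>) * (E * G * theta N w) = 2 * pi * of_nat r * (E * G * theta N w)" by simp
    then show ?thesis
      unfolding annih_def nabla_y_def prod.case dx dy u by (simp add: algebra_simps)
  qed
  then show ?thesis by auto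
qed

lemma fourier_coeff_0: "fourier_coeff k (\<lambda>t. 0) = 0"
  by (simp add: fourier_coeff_def)

lemma fourier_coeff_const: "k \<noteq> 0 \<Longrightarrow> fourier_coeff k (\<lambda>t. c) = 0"
  using fourier_coeff_deriv[of "\<lambda>t. c" "\<lambda>t. 0" k] fourier_coeff_0[of k] by simp

text \<open>No coefficient is evaluated: the pure exponential in z excludes m' different from m, and
  the translation eigenvalue under y -> y + 1/N excludes k not congruent to r.\<close>

lemma yz_coeff_ground_section_eq_0:
  assumes "N > 0" "m' \<noteq> m \<or> (k - int r) mod int N \<noteq> 0"
  shows "yz_coeff k m' (ground_section N r m) x = 0"
proof (cases "m' = m")
  case False
  have "ground_section N r m (x, y, z) = cis (2 * pi * of_int m * z) * ground_section N r m (x, y, 0)" for y z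
  proof -
    have "2 * pi * \<i> * (of_int m * of_real z + of_nat r * of_real y) =
      \<i> * of_real (2 * pi * of_int m * z) + 2 * pi * \<i> * (of_nat r * of_real y)"
      by (simp add: algebra_simps)
    then show ?thesis unfolding ground_section_def prod.case cis_conv_exp by (simp add: exp_add)
  qed
  then have "(\<lambda>y. ground_section N r m (x, y, z)) = (\<lambda>y. cis (2 * pi * of_int m * z) * ground_section N r m (x, y, 0))" for z
    by (rule ext)
  then have "fourier_coeff k (\<lambda>y. ground_section N r m (x, y, z)) =
      cis (2 * pi * of_int m * z) * fourier_coeff k (\<lambda>y. ground_section N r m (x, y, 0))" for z
    by (metis fourier_coeff_cmult)
  then have "yz_coeff k m' (ground_section N r m) x =
      fourier_coeff m' (\<lambda>z. cis (2 * pi * of_int m * z) * fourier_coeff k (\<lambda>y. ground_section N r m (x, y, 0)))"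
    unfolding yz_coeff_def by (intro arg_cong[of _ _ "fourier_coeff m'"] ext)
  also have "\<dots> = 0"
    unfolding fourier_coeff_modulate using False by (intro fourier_coeff_const) simp
  finally show ?thesis .
next
  case True
  have "fourier_coeff k (\<lambda>y. ground_section N r m (x, y, z)) = 0" for z
  proof (rule fourier_coeff_shift_eigen[where s = "1 / N"])
    show "continuous_on UNIV (\<lambda>y. ground_section N r m (x, y, z))"
      by (intro continuous_on_slice_y C_infinity_continuous ground_section_C_infinity assms)
    show "ground_section N r m (x, y + 1, z) = ground_section N r m (x, y, z)" for y
      by (rule smooth_sections_shift(2)[OF ground_section_smooth[OF assms(1)]])
    show "ground_section N r m (x, y + 1 / N, z) = cis (2 * pi * (r / N)) * ground_section N r m (x, y, z)" for y
      using ground_section_shift_y[OF assms(1), of r m x y 1 z] by simp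
    show "cis (2 * pi * (r / N)) \<noteq> cis (2 * pi * of_int k * (1 / N))"
    proof
      assume "cis (2 * pi * (r / N)) = cis (2 * pi * of_int k * (1 / N))"
      then have "cis (2 * pi * (of_int k / N)) = cis (2 * pi * (r / N))" by simp
      then obtain n where "of_int k / real N = r / N + of_int n" using cis_2pi_eq_imp_int by blast
      then have "real_of_int k = of_int (int r + n * int N)" using assms(1) by (simp add: field_simps)
      then have "k = int r + n * int N" by (simp only: of_int_eq_iff)
      then show False using assms(2) True by simp
    qed
  qed (use assms in auto)
  then show ?thesis by (simp add: yz_coeff_def fourier_coeff_0)
qed

section \<open>Multiplicities\<close>

definition level_section :: "nat \<Rightarrow> nat \<Rightarrow> nat \<Rightarrow> int \<Rightarrow> real \<times> real \<times> real \<Rightarrow> complex" where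
  "level_section N j r m = (creat N ^^ j) (ground_section N r m)"

lemma level_section_smooth: "N > 0 \<Longrightarrow> level_section N j r m \<in> smooth_sections N"
  unfolding level_section_def
  by (induction j) (auto intro: ground_section_smooth smooth_sections_creat)

lemma yz_coeff_level_section_eq_0:
  assumes "N > 0" "m' \<noteq> m \<or> (k - int r) mod int N \<noteq> 0"
  shows "yz_coeff k m' (level_section N j r m) x = 0"
proof (induction j arbitrary: x)
  case 0
  then show ?case using yz_coeff_ground_section_eq_0[OF assms] by (simp add: level_section_def)
next
  case (Suc j)
  have "yz_coeff k m' (creat N (level_section N j r m)) x = 0 * yz_coeff k m' (creat N (level_section N j r m)) x"
    by (rule yz_coeff_ladder_cong(2)[OF level_section_smooth level_section_smooth])
       (use assms Suc in auto)
  then show ?case by (simp add: level_section_def)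
qed

text \<open>The two claims feed each other: the energy at level j gives the action of
  \<open>annih\<close> on level j + 1 through the commutator, and applying \<open>creat\<close> to
  that gives the energy at level j + 1.\<close>

lemma yz_coeff_annih_level_section:
  assumes "N > 0"
  shows "yz_coeff k m' (annih N (level_section N (Suc j) r m)) x =
    of_real (4 * pi * N * real (Suc j)) * yz_coeff k m' (level_section N j r m) x"
    and "landau N k m' (level_section N j r m) (4 * pi * N * real j)"
proof -
  note s = level_section_smooth[OF assms]
  have step: "yz_coeff k m' (annih N (level_section N (Suc j) r m)) x =
      of_real (4 * pi * N * real (Suc j)) * yz_coeff k m' (level_section N j r m) x"
    if "landau N k m' (level_section N j r m) (4 * pi * N * real j)" for j x
  proof -
    have "yz_coeff k m' (annih N (level_section N (Suc j) r m)) x = yz_coeff k m' (creat N (annih N (level_section N j r m))) x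
        + of_real (4 * pi * N) * yz_coeff k m' (level_section N j r m) x"
      unfolding level_section_def funpow.simps o_apply annih_creat[OF s[unfolded level_section_def]] yz_coeff_cmult[symmetric]
      by (intro yz_coeff_add smooth_sections_continuous[of _ N] smooth_sections_cmult smooth_sections_creat smooth_sections_annih
          s[unfolded level_section_def])
    then show ?thesis using that by (simp add: landau_def algebra_simps)
  qed
  have lan: "landau N k m' (level_section N j r m) (4 * pi * N * real j)" for j
  proof (induction j)
    case 0
    have "yz_coeff k m' (creat N (annih N (ground_section N r m))) x = 0 * yz_coeff k m' (creat N (ground_section N r m)) x" for x
      by (rule yz_coeff_ladder_cong(2)[OF ground_section_smooth smooth_sections_annih[OF ground_section_smooth]])
         (use assms annih_ground_section[OF assms] in \<open>auto simp: yz_coeff_def fourier_coeff_0\<close>)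
    then show ?case by (simp add: landau_def level_section_def)
  next
    case (Suc j)
    have "yz_coeff k m' (creat N (annih N (level_section N (Suc j) r m))) x =
        of_real (4 * pi * N * real (Suc j)) * yz_coeff k m' (creat N (level_section N j r m)) x" for x
      by (rule yz_coeff_ladder_cong(2)[OF s smooth_sections_annih[OF s] step[OF Suc]])
    then show ?case by (simp add: landau_def level_section_def)
  qed
  show "landau N k m' (level_section N j r m) (4 * pi * N * real j)" by (rule lan)
  show "yz_coeff k m' (annih N (level_section N (Suc j) r m)) x =
      of_real (4 * pi * N * real (Suc j)) * yz_coeff k m' (level_section N j r m) x"
    by (rule step[OF lan])
qed

text \<open>Each coefficient function is a translate of one with 0 <= k < N, so only N frequencies
  in y need to be compared.\<close>

lemma yz_coeff_mod:
  assumes "u \<in> smooth_sections N"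
  shows "yz_coeff k m u x = yz_coeff (k mod int N) m u (x - of_int (k div int N))"
  using yz_coeff_shift_multiple[OF assms, of "k mod int N" m x "- (k div int N)"]
  by (simp add: mult.commute[of _ "int N"] minus_mult_left[symmetric] del: minus_mult_left[symmetric])

text \<open>If the coefficient at r were 0 on the ground level, so would be its translates and hence
  the whole ground section, which is nonzero at (r/N, 0, 0). Higher levels are nonzero because
  \<open>annih\<close> maps them to nonzero multiples of lower ones.\<close>

lemma level_section_coeff_neq_0:
  assumes "N > 0" "r < N"
  shows "\<exists>x. yz_coeff (int r) m (level_section N j r m) x \<noteq> 0"
proof (induction j)
  case 0
  show ?case
  proof (rule ccontr)
    assume *: "\<not> ?thesis"
    have "yz_coeff k m' (ground_section N r m) x = 0" for k m' x
    proof (cases "m' = m \<and> (k - int r) mod int N = 0")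
      case True
      then have "k mod int N = int r"
        using assms(2) by (simp add: mod_eq_dvd_iff[symmetric] flip: mod_0_imp_dvd dvd_eq_mod_eq_0)
      then show ?thesis
        using * True yz_coeff_mod[OF ground_section_smooth[OF assms(1)], of k m r m x] by (auto simp: level_section_def)
    qed (use yz_coeff_ground_section_eq_0[OF assms(1)] in blast)
    then have "ground_section N r m = (\<lambda>p. 0)"
      by (rule yz_coeff_eq_0_imp[OF ground_section_smooth[OF assms(1)]])
    then show False using ground_section_neq_0[OF assms(1), of r m] by simp
  qed
next
  case (Suc j)
  then obtain x where x: "yz_coeff (int r) m (level_section N j r m) x \<noteq> 0" by blast
  show ?case
  proof (rule ccontr)
    assume "\<not> ?thesis"
    then have "yz_coeff (int r) m (annih N (level_section N (Suc j) r m)) x = 0 * yz_coeff (int r) m (annih N (level_section N (Suc j) r m)) x"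
      by (intro yz_coeff_ladder_cong(1)[OF level_section_smooth[OF assms(1)] level_section_smooth[OF assms(1)]]) simp
    then have "of_real (4 * pi * N * real (Suc j)) * yz_coeff (int r) m (level_section N j r m) x = 0"
      unfolding yz_coeff_annih_level_section(1)[OF assms(1)] by simp
    then have "4 * pi * N * real (Suc j) = 0"
      using x by (simp only: mult_eq_0_iff of_real_eq_0_iff simp_thms)
    then show False using assms(1) by simp
  qed
qed

section \<open>Enumeration of the quantum numbers of an eigenvalue\<close>

definition level_energy :: "nat \<Rightarrow> nat \<Rightarrow> int \<Rightarrow> real" where
  "level_energy N j m = 4 * pi * N * j + 2 * pi * N + (2 * pi * m)\<^sup>2"

lemma level_energy_inj: "N > 0 \<Longrightarrow> level_energy N j m = level_energy N j' m \<longleftrightarrow> j = j'"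
  by (simp add: level_energy_def)

text \<open>Different pairs (j, m) may share an energy, as m and -m always do, so a multiplicity is
  the cardinality of this set and not simply N.\<close>

definition level_set :: "nat \<Rightarrow> real \<Rightarrow> (nat \<times> nat \<times> int) set" where
  "level_set N \<mu> = {(j, r, m). r < N \<and> level_energy N j m = \<mu>}"

lemma finite_level_set: "N > 0 \<Longrightarrow> finite (level_set N \<mu>)"
proof -
  assume N: "N > 0"
  have "level_set N \<mu> \<subseteq> {..nat \<lceil>\<mu>\<rceil>} \<times> {..<N} \<times> {- \<lceil>\<mu>\<rceil>..\<lceil>\<mu>\<rceil>}"
  proof
    fix p assume "p \<in> level_set N \<mu>"
    then obtain j r m where p: "p = (j, r, m)" "r < N" "4 * pi * N * j + 2 * pi * N + (2 * pi * m)\<^sup>2 = \<mu>"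
      by (auto simp: level_set_def level_energy_def)
    have a: "0 \<le> 4 * pi * N * j" "0 \<le> 2 * pi * N" "0 \<le> (2 * pi * real_of_int m)\<^sup>2" by simp_all
    have "1 \<le> 4 * pi" using pi_gt3 by simp
    then have "1 * 1 \<le> 4 * pi * N" using N by (intro mult_mono) auto
    then have "1 * real j \<le> 4 * pi * N * j" by (intro mult_right_mono) auto
    then have j: "real j \<le> \<mu>" using a p(3) by linarith
    have "\<bar>m\<bar> * 1 \<le> \<bar>m\<bar> * \<bar>m\<bar>" by (cases "m = 0") (simp, intro mult_left_mono, auto)
    then have "\<bar>m\<bar> \<le> m\<^sup>2" by (simp add: power2_eq_square flip: abs_mult)
    then have "real_of_int \<bar>m\<bar> \<le> 1 * (real_of_int m)\<^sup>2" by (metis mult_1 of_int_le_iff of_int_power)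
    also have "\<dots> \<le> (2 * pi)\<^sup>2 * (real_of_int m)\<^sup>2"
      using pi_gt3 by (intro mult_right_mono one_le_power) auto
    also have "\<dots> = (2 * pi * real_of_int m)\<^sup>2" by (simp add: power_mult_distrib)
    finally have m: "\<bar>real_of_int m\<bar> \<le> \<mu>" using a p(3) by linarith
    then have "m \<le> \<lceil>\<mu>\<rceil>" "- \<lceil>\<mu>\<rceil> \<le> m" by linarith+
    moreover have "j \<le> nat \<lceil>\<mu>\<rceil>" using j by linarith
    ultimately show "p \<in> {..nat \<lceil>\<mu>\<rceil>} \<times> {..<N} \<times> {- \<lceil>\<mu>\<rceil>..\<lceil>\<mu>\<rceil>}" using p by auto
  qed
  then show ?thesis by (rule finite_subset) auto
qed

definition level_basis :: "nat \<Rightarrow> nat \<times> nat \<times> int \<Rightarrow> real \<times> real \<times> real \<Rightarrow> complex" where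
  "level_basis N = (\<lambda>(j, r, m). level_section N j r m)"

lemma sum_fun_apply: "(\<Sum>i\<in>I. f i) x = (\<Sum>i\<in>I. f i x)" for f :: "'i \<Rightarrow> 'a \<Rightarrow> 'b::comm_monoid_add"
  by (induction I rule: infinite_finite_induct) (auto simp: zero_fun_def)

lemma yz_coeff_sum:
  assumes "finite I" "\<And>i. i \<in> I \<Longrightarrow> v i \<in> smooth_sections N" "N > 0"
  shows "(\<lambda>p. \<Sum>i\<in>I. \<alpha> i * v i p) \<in> smooth_sections N \<and>
    yz_coeff k m (\<lambda>p. \<Sum>i\<in>I. \<alpha> i * v i p) x = (\<Sum>i\<in>I. \<alpha> i * yz_coeff k m (v i) x)"
  using assms
proof (induction I)
  case empty
  have "(\<lambda>p. 0) \<in> smooth_sections N"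
    using smooth_sections_cmult[OF ground_section_smooth[OF assms(3)], of 0] by simp
  then show ?case by (simp add: yz_coeff_def fourier_coeff_0)
next
  case (insert i I)
  have 1: "(\<lambda>p. \<alpha> i * v i p) \<in> smooth_sections N"
    using insert by (intro smooth_sections_cmult) auto
  have 2: "(\<lambda>p. \<Sum>i\<in>I. \<alpha> i * v i p) \<in> smooth_sections N"
    "yz_coeff k m (\<lambda>p. \<Sum>i\<in>I. \<alpha> i * v i p) x = (\<Sum>i\<in>I. \<alpha> i * yz_coeff k m (v i) x)"
    using insert by auto
  have "(\<lambda>p. \<Sum>i\<in>insert i I. \<alpha> i * v i p) = (\<lambda>p. \<alpha> i * v i p + (\<Sum>i\<in>I. \<alpha> i * v i p))"
    using insert by auto
  then show ?case
    using smooth_sections_add[OF 1 2(1)] yz_coeff_add[OF smooth_sections_continuous[OF 1] smooth_sections_continuous[OF 2(1)]]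
      insert 2(2) by (simp add: yz_coeff_cmult)
qed

text \<open>Within a fixed \<open>\<mu>\<close> the pair \<open>(r, m)\<close> determines \<open>j\<close>, so the coefficients with frequencies
  \<open>(r, m)\<close> are dual to the candidate basis.\<close>

lemma level_basis_dual:
  assumes "N > 0" "(j, r, m) \<in> level_set N \<mu>" "i \<in> level_set N \<mu>" "i \<noteq> (j, r, m)"
  shows "yz_coeff (int r) m (level_basis N i) x = 0"
proof -
  obtain j' r' m' where i: "i = (j', r', m')" by (cases i)
  have "m \<noteq> m' \<or> r \<noteq> r'"
    using assms level_energy_inj[OF assms(1), of j m j'] by (auto simp: level_set_def i)
  moreover have "(int r - int r') mod int N \<noteq> 0" if "r \<noteq> r'"
  proof
    assume "(int r - int r') mod int N = 0"
    then have "int r mod int N = int r' mod int N" by (simp add: mod_eq_dvd_iff dvd_eq_mod_eq_0)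
    then show False using that assms by (simp add: level_set_def i)
  qed
  ultimately show ?thesis
    using yz_coeff_level_section_eq_0[OF assms(1), of m m' "int r" r' j' x] by (auto simp: level_basis_def i)
qed

lemma level_basis_in_eigenspace:
  assumes "N > 0" "i \<in> level_set N \<mu>"
  shows "level_basis N i \<in> eigenspace N \<mu>"
proof -
  obtain j r m where i: "i = (j, r, m)" by (cases i)
  have e: "\<mu> - 2 * pi * N - (2 * pi * m)\<^sup>2 = 4 * pi * N * real j"
    using assms(2) by (auto simp: i level_set_def level_energy_def)
  have "yz_coeff k m' (creat N (annih N (level_section N j r m))) x =
      of_real (\<mu> - 2 * pi * N - (2 * pi * m')\<^sup>2) * yz_coeff k m' (level_section N j r m) x" for k m' x
  proof (cases "m' = m")
    case True
    then show ?thesis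
      using yz_coeff_annih_level_section(2)[OF assms(1), of k m j r m] unfolding landau_def True e by blast
  next
    \<comment> \<open>Away from the frequency m of the section the factor on the right is not its
      oscillator energy, but both coefficients vanish.\<close>
    case False
    then show ?thesis
      using yz_coeff_annih_level_section(2)[OF assms(1), of k m' j r m] yz_coeff_level_section_eq_0[OF assms(1), of m' m k r j x]
      unfolding landau_def by simp
  qed
  then show ?thesis
    unfolding i level_basis_def prod.case using eigenspace_iff[OF level_section_smooth[OF assms(1)]] by blast
qed

lemma level_basis_smooth: "N > 0 \<Longrightarrow> level_basis N i \<in> smooth_sections N"
  by (auto simp: level_basis_def level_section_smooth split: prod.split)

lemma level_basis_coeff_neq_0:
  assumes "N > 0" "(j, r, m) \<in> level_set N \<mu>"
  shows "\<exists>x. yz_coeff (int r) m (level_basis N (j, r, m)) x \<noteq> 0"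
  using level_section_coeff_neq_0[OF assms(1), of r m j] assms(2) by (auto simp: level_basis_def level_set_def)

lemma inj_on_level_basis:
  assumes "N > 0"
  shows "inj_on (level_basis N) (level_set N \<mu>)"
proof (rule inj_onI, rule ccontr)
  fix i i' assume *: "i \<in> level_set N \<mu>" "i' \<in> level_set N \<mu>" "level_basis N i = level_basis N i'" "i \<noteq> i'"
  obtain j r m where i: "i = (j, r, m)" by (cases i)
  show False
    using level_basis_coeff_neq_0[OF assms *(1)[unfolded i]] level_basis_dual[OF assms *(1)[unfolded i] *(2)] * by (auto simp: i)
qed

text \<open>The coefficient \<alpha> of (j, r, m) is the proportionality factor between u and the
  basis section at frequencies (r, m). Where no j fits (r, m), quantization makes the coefficient of
  u vanish, as it does for every basis section. Other y-frequencies reduce to these modulo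
  N.\<close>

lemma eigenspace_expand:
  assumes N: "N > 0" and u: "u \<in> eigenspace N \<mu>"
  obtains \<alpha> where "u = (\<lambda>p. \<Sum>i\<in>level_set N \<mu>. \<alpha> i * level_basis N i p)"
proof -
  have us: "u \<in> smooth_sections N" using u by (simp add: eigenspace_def)
  have lu: "landau N k m u (\<mu> - 2 * pi * N - (2 * pi * m)\<^sup>2)" for k m
    using u eigenspace_iff[OF us] by (simp add: landau_def)
  have "\<exists>a. \<forall>x. yz_coeff (int r) m u x = a * yz_coeff (int r) m (level_basis N (j, r, m)) x"
    if ji: "(j, r, m) \<in> level_set N \<mu>" for j r m
  proof -
    have e: "\<mu> - 2 * pi * N - (2 * pi * m)\<^sup>2 = 4 * pi * N * real j"
      using ji by (auto simp: level_set_def level_energy_def)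
    obtain y where "yz_coeff (int r) m (level_basis N (j, r, m)) y \<noteq> 0"
      using level_basis_coeff_neq_0[OF N ji] by blast
    then show ?thesis
      using landau_unique[OF N us level_basis_smooth[OF N], of "int r" m j "(j, r, m)" y] lu[of "int r" m, unfolded e]
        yz_coeff_annih_level_section(2)[OF N, of "int r" m j r m] by (simp add: level_basis_def)
  qed
  then have "\<forall>i\<in>level_set N \<mu>. \<exists>a. \<forall>x. yz_coeff (int (fst (snd i))) (snd (snd i)) u x =
      a * yz_coeff (int (fst (snd i))) (snd (snd i)) (level_basis N i) x"
    by auto
  then obtain \<alpha> where \<alpha>: "\<And>i x. i \<in> level_set N \<mu> \<Longrightarrow> yz_coeff (int (fst (snd i))) (snd (snd i)) u x =
      \<alpha> i * yz_coeff (int (fst (snd i))) (snd (snd i)) (level_basis N i) x"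
    by metis
  define w where "w = (\<lambda>p. \<Sum>i\<in>level_set N \<mu>. \<alpha> i * level_basis N i p)"
  have w: "w \<in> smooth_sections N"
    "\<And>k m x. yz_coeff k m w x = (\<Sum>i\<in>level_set N \<mu>. \<alpha> i * yz_coeff k m (level_basis N i) x)"
    using yz_coeff_sum[where v = "level_basis N" and \<alpha> = \<alpha>, OF finite_level_set[OF N] level_basis_smooth[OF N] N]
    by (auto simp: w_def)
  have eq: "yz_coeff (int r) m u x = yz_coeff (int r) m w x" if r: "r < N" for r m x
  proof (cases "\<exists>j. (j, r, m) \<in> level_set N \<mu>")
    case True
    then obtain j where j: "(j, r, m) \<in> level_set N \<mu>" by blast
    have "(\<Sum>i\<in>level_set N \<mu>. \<alpha> i * yz_coeff (int r) m (level_basis N i) x) =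
        (\<Sum>i\<in>level_set N \<mu>. if i = (j, r, m) then \<alpha> i * yz_coeff (int r) m (level_basis N i) x else 0)"
      using level_basis_dual[OF N j] by (intro sum.cong) auto
    also have "\<dots> = yz_coeff (int r) m u x"
      using j \<alpha>[OF j, of x] finite_level_set[OF N] by simp
    finally show ?thesis by (simp add: w(2))
  next
    case False
    have "yz_coeff (int r) m u x = 0"
    proof (rule ccontr)
      assume "yz_coeff (int r) m u x \<noteq> 0"
      from landau_quantized'[OF N us lu this] obtain j where "\<mu> - 2 * pi * N - (2 * pi * m)\<^sup>2 = 4 * pi * N * real j" by blast
      then have "(j, r, m) \<in> level_set N \<mu>" using r by (simp add: level_set_def level_energy_def)
      then show False using False by blast
    qed
    moreover have "yz_coeff (int r) m (level_basis N i) x = 0" if i: "i \<in> level_set N \<mu>" for i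
    proof -
      obtain j' r' m' where i': "i = (j', r', m')" by (cases i)
      have "m \<noteq> m' \<or> r \<noteq> r'" using False i i' by auto
      moreover have "(int r - int r') mod int N \<noteq> 0" if "r \<noteq> r'"
      proof
        assume "(int r - int r') mod int N = 0"
        then have "int r mod int N = int r' mod int N" by (simp add: mod_eq_dvd_iff dvd_eq_mod_eq_0)
        then show False using that r i by (simp add: level_set_def i')
      qed
      ultimately show ?thesis
        using yz_coeff_level_section_eq_0[OF N, of m m' "int r" r' j' x] by (auto simp: level_basis_def i')
    qed
    ultimately show ?thesis by (simp add: w(2))
  qed
  have "u = w"
  proof (rule yz_coeff_eqI[OF us w(1)])
    fix k m x
    have "0 \<le> k mod int N" "k mod int N < int N" using N by auto
    then have "int (nat (k mod int N)) = k mod int N" "nat (k mod int N) < N" by auto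
    with eq[of "nat (k mod int N)" m "x - of_int (k div int N)"] show "yz_coeff k m u x = yz_coeff k m w x"
      unfolding yz_coeff_mod[OF us, of k] yz_coeff_mod[OF w(1), of k] by simp
  qed
  then show ?thesis using that by (simp add: w_def)
qed

text \<open>For independence, the (r, m) coefficient of a vanishing combination is taken at a point
  where that of the basis section (j, r, m) is nonzero; duality leaves a single term.\<close>

lemma eigen_mult_eq:
  assumes N: "N > 0"
  shows "eigen_mult N \<mu> = card (level_set N \<mu>)"
  unfolding eigen_mult_def
proof (rule cfun.dim_unique[where B = "level_basis N ` level_set N \<mu>"])
  note fin = finite_level_set[OF N, of \<mu>]
  show "level_basis N ` level_set N \<mu> \<subseteq> eigenspace N \<mu>"
    using level_basis_in_eigenspace[OF N] by blast
  show "card (level_basis N ` level_set N \<mu>) = card (level_set N \<mu>)"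
    by (rule card_image[OF inj_on_level_basis[OF N]])
  show "eigenspace N \<mu> \<subseteq> cfun.span (level_basis N ` level_set N \<mu>)"
  proof
    fix u assume "u \<in> eigenspace N \<mu>"
    then obtain \<alpha> where u: "u = (\<lambda>p. \<Sum>i\<in>level_set N \<mu>. \<alpha> i * level_basis N i p)"
      using eigenspace_expand[OF N] by blast
    have "u = (\<Sum>i\<in>level_set N \<mu>. (\<lambda>p. \<alpha> i * level_basis N i p))"
      unfolding u by (rule ext) (simp add: sum_fun_apply)
    also have "\<dots> \<in> cfun.span (level_basis N ` level_set N \<mu>)"
      by (intro cfun.span_sum cfun.span_scale cfun.span_base) auto
    finally show "u \<in> cfun.span (level_basis N ` level_set N \<mu>)" .
  qed
  show "cfun.independent (level_basis N ` level_set N \<mu>)"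
  proof (rule cfun.independent_if_scalars_zero)
    fix f x
    assume z: "(\<Sum>x\<in>level_basis N ` level_set N \<mu>. (\<lambda>p. f x * x p)) = 0" and x: "x \<in> level_basis N ` level_set N \<mu>"
    from x obtain j r m where i: "(j, r, m) \<in> level_set N \<mu>" "x = level_basis N (j, r, m)" by auto
    obtain t where t: "yz_coeff (int r) m (level_basis N (j, r, m)) t \<noteq> 0"
      using level_basis_coeff_neq_0[OF N i(1)] by blast
    have "(\<Sum>i\<in>level_set N \<mu>. (\<lambda>p. f (level_basis N i) * level_basis N i p)) = 0"
      using z unfolding sum.reindex[OF inj_on_level_basis[OF N]] by (simp add: o_def)
    then have z0: "(\<lambda>p. \<Sum>i\<in>level_set N \<mu>. f (level_basis N i) * level_basis N i p) = (\<lambda>p. 0)"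
      by (auto simp: fun_eq_iff sum_fun_apply)
    have "(\<Sum>i\<in>level_set N \<mu>. f (level_basis N i) * yz_coeff (int r) m (level_basis N i) t) = yz_coeff (int r) m (\<lambda>p. 0) t"
      using yz_coeff_sum[where v = "level_basis N" and \<alpha> = "\<lambda>i. f (level_basis N i)", OF fin level_basis_smooth[OF N] N, of "int r" m t]
      unfolding z0 by simp
    also have "\<dots> = 0" by (simp add: yz_coeff_def fourier_coeff_0)
    finally have "(\<Sum>i\<in>level_set N \<mu>. f (level_basis N i) * yz_coeff (int r) m (level_basis N i) t) = 0" .
    moreover have "(\<Sum>i\<in>level_set N \<mu>. f (level_basis N i) * yz_coeff (int r) m (level_basis N i) t) =
        (\<Sum>i\<in>level_set N \<mu>. if i = (j, r, m) then f (level_basis N i) * yz_coeff (int r) m (level_basis N i) t else 0)"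
      using level_basis_dual[OF N i(1)] by (intro sum.cong) auto
    ultimately have "f (level_basis N (j, r, m)) * yz_coeff (int r) m (level_basis N (j, r, m)) t = 0"
      using i fin by simp
    then show "f x = 0" using t i by simp
  qed (use fin in simp)
qed

section \<open>Schwartz functions\<close>

lemma schwartz_deriv: "\<phi> \<in> schwartz \<Longrightarrow> dir_deriv 1 \<phi> \<in> schwartz"
  unfolding schwartz_def mem_Collect_eq
  by (metis C_infinity_dir_deriv funpow_Suc_right o_apply)

lemma schwartz_has_vector_derivative:
  "\<phi> \<in> schwartz \<Longrightarrow> (\<phi> has_vector_derivative dir_deriv 1 \<phi> t) (at t)"
  using dir_deriv_chain[of \<phi> "\<lambda>t. t" t 1] C_infinity_differentiable
  by (auto simp: schwartz_def)

lemma schwartz_continuous: "\<phi> \<in> schwartz \<Longrightarrow> continuous_on A \<phi>"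
  using C_infinity_continuous continuous_on_subset by (fastforce simp: schwartz_def)

lemma schwartz_isCont: "\<phi> \<in> schwartz \<Longrightarrow> isCont \<phi> x"
  using schwartz_continuous[of \<phi> UNIV] by (simp add: continuous_on_eq_continuous_at)

lemma schwartz_measurable: "\<phi> \<in> schwartz \<Longrightarrow> \<phi> \<in> borel_measurable borel"
  using schwartz_continuous by (intro borel_measurable_continuous_onI)

lemma schwartz_decay:
  assumes "\<phi> \<in> schwartz"
  obtains C where "C > 0" "\<And>t. norm (\<phi> t) \<le> C / (1 + \<bar>t\<bar>) ^ k"
proof -
  have "\<exists>C. \<forall>t. \<bar>t\<bar> ^ k * norm (\<phi> t) \<le> C" for k
    using assms unfolding schwartz_def mem_Collect_eq by (metis funpow_0)
  then obtain C where C: "\<And>k t. \<bar>t\<bar> ^ k * norm (\<phi> t) \<le> C k" by metis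
  define D where "D = 2 ^ k * (\<bar>C 0\<bar> + \<bar>C k\<bar>) + 1"
  have "norm (\<phi> t) \<le> D / (1 + \<bar>t\<bar>) ^ k" for t
  proof -
    have "(1 + \<bar>t\<bar>) ^ k \<le> (2 * max 1 \<bar>t\<bar>) ^ k" by (intro power_mono) auto
    also have "\<dots> = 2 ^ k * max 1 \<bar>t\<bar> ^ k" by (simp add: power_mult_distrib)
    also have "max 1 \<bar>t\<bar> ^ k \<le> 1 + \<bar>t\<bar> ^ k" by (auto simp: max_def)
    finally have "(1 + \<bar>t\<bar>) ^ k * norm (\<phi> t) \<le> 2 ^ k * (1 + \<bar>t\<bar> ^ k) * norm (\<phi> t)"
      by (simp add: mult_right_mono)
    also have "\<dots> = 2 ^ k * (\<bar>t\<bar> ^ 0 * norm (\<phi> t) + \<bar>t\<bar> ^ k * norm (\<phi> t))" by (simp add: algebra_simps)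
    also have "\<dots> \<le> 2 ^ k * (\<bar>C 0\<bar> + \<bar>C k\<bar>)"
      using C[of t 0] C[of t k] by (intro mult_left_mono add_mono) auto
    finally have "(1 + \<bar>t\<bar>) ^ k * norm (\<phi> t) \<le> D" by (simp add: D_def)
    moreover have "(1 + \<bar>t\<bar>) ^ k > 0" by (intro zero_less_power) auto
    ultimately show ?thesis by (simp add: field_simps)
  qed
  moreover have "D > 0" by (simp add: D_def add_nonneg_pos)
  ultimately show ?thesis using that by blast
qed

lemma integrable_1_div_1_plus_square: "integrable lborel (\<lambda>x::real. 1 / (1 + x\<^sup>2))"
  using integrable_inverse_1_plus_square by (simp add: set_integrable_def inverse_eq_divide)

lemma inverse_1_plus_abs_square_le: "1 / (1 + \<bar>t\<bar>)\<^sup>2 \<le> 1 / (1 + t\<^sup>2)" for t :: real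
proof -
  have "1 + t\<^sup>2 \<le> (1 + \<bar>t\<bar>)\<^sup>2" by (simp add: power2_eq_square algebra_simps abs_mult_self_eq)
  moreover have "0 < 1 + t\<^sup>2" by (simp add: add_pos_nonneg)
  ultimately show ?thesis by (intro divide_left_mono mult_pos_pos) auto
qed

lemma integrable_bound_1_plus_square:
  fixes f :: "real \<Rightarrow> complex"
  assumes "f \<in> borel_measurable borel" "\<And>t. norm (f t) \<le> C / (1 + t\<^sup>2)"
  shows "integrable lborel f"
proof (rule Bochner_Integration.integrable_bound)
  show "integrable lborel (\<lambda>t::real. C * (1 / (1 + t\<^sup>2)))"
    using integrable_1_div_1_plus_square by (rule integrable_mult_right)
  show "AE t in lborel. norm (f t) \<le> norm (C * (1 / (1 + t\<^sup>2)))"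
    using order_trans[OF assms(2) abs_ge_self] by auto
qed (use assms in auto)

lemma schwartz_bound_1_plus_square:
  assumes "\<phi> \<in> schwartz"
  obtains C where "C > 0" "\<And>t. norm (\<phi> t) \<le> C / (1 + t\<^sup>2)"
proof -
  obtain C where C: "C > 0" "\<And>t. norm (\<phi> t) \<le> C / (1 + \<bar>t\<bar>)\<^sup>2"
    using schwartz_decay[OF assms, of 2] by blast
  have "norm (\<phi> t) \<le> C / (1 + t\<^sup>2)" for t
    using order_trans[OF C(2)[of t]] mult_left_mono[OF inverse_1_plus_abs_square_le[of t], of C] C(1) by simp
  then show ?thesis using that C(1) by blast
qed

lemma schwartz_integrable: "\<phi> \<in> schwartz \<Longrightarrow> integrable lborel \<phi>"
  using schwartz_bound_1_plus_square schwartz_measurable integrable_bound_1_plus_square by metis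

lemma tendsto_0_1_plus_square:
  fixes f :: "real \<Rightarrow> complex"
  assumes "\<And>t. norm (f t) \<le> C / (1 + t\<^sup>2)"
  shows "(f \<longlongrightarrow> 0) at_top" "(f \<longlongrightarrow> 0) at_bot"
proof -
  have "((\<lambda>t::real. C / (1 + t\<^sup>2)) \<longlongrightarrow> 0) at_top" by real_asymp
  then show "(f \<longlongrightarrow> 0) at_top"
    by (rule Lim_null_comparison[rotated]) (use assms in auto)
  have "((\<lambda>t::real. C / (1 + t\<^sup>2)) \<longlongrightarrow> 0) at_bot" by real_asymp
  then show "(f \<longlongrightarrow> 0) at_bot"
    by (rule Lim_null_comparison[rotated]) (use assms in auto)
qed

text \<open>The common form of integration by parts over the line: the integrand is recognized as
  the derivative of a function vanishing at both ends.\<close>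

lemma integral_derivative_eq_0:
  fixes f f' :: "real \<Rightarrow> complex"
  assumes "\<And>t. (f has_vector_derivative f' t) (at t)" "continuous_on UNIV f'" "integrable lborel f'"
    "(f \<longlongrightarrow> 0) at_top" "(f \<longlongrightarrow> 0) at_bot"
  shows "(LINT t|lborel. f' t) = 0"
proof -
  have "(LBINT t=-\<infinity>..\<infinity>. f' t) = 0 - 0"
  proof (rule interval_integral_FTC_integrable)
    show "((f \<circ> real_of_ereal) \<longlongrightarrow> 0) (at_right (-\<infinity>))" "((f \<circ> real_of_ereal) \<longlongrightarrow> 0) (at_left \<infinity>)"
      using assms(4,5) by (simp_all add: ereal_tendsto_simps)
    show "set_integrable lborel (einterval (-\<infinity>) \<infinity>) f'"
      using assms(3) by (simp add: set_integrable_def)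
  qed (use assms(1,2) in \<open>auto simp: continuous_on_eq_continuous_at\<close>)
  then show ?thesis
    by (simp add: interval_lebesgue_integral_def set_lebesgue_integral_def)
qed

section \<open>Fourier inversion\<close>

lemma fourier_cis: "fourier \<phi> k = (LINT s|lborel. \<phi> s * cis (- (k * s)))"
  by (simp add: fourier_def cis_conv_exp)

lemma integrable_mult_cis:
  fixes f :: "real \<Rightarrow> complex"
  assumes "integrable lborel f"
  shows "integrable lborel (\<lambda>s. f s * cis (w * s))"
proof (rule Bochner_Integration.integrable_bound[OF assms])
  have "(\<lambda>s. cis (w * s)) \<in> borel_measurable borel"
    by (intro borel_measurable_continuous_onI continuous_intros)
  then show "(\<lambda>s. f s * cis (w * s)) \<in> borel_measurable lborel"
    using borel_measurable_integrable[OF assms] by simp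
qed (simp add: norm_mult)

lemma fourier_norm_le:
  assumes "\<phi> \<in> schwartz"
  shows "norm (fourier \<phi> k) \<le> (LINT s|lborel. norm (\<phi> s))"
  using integral_norm_bound[of lborel "\<lambda>s. \<phi> s * cis (- (k * s))"] by (simp add: fourier_cis norm_mult)

lemma fourier_deriv:
  assumes "\<phi> \<in> schwartz"
  shows "fourier (dir_deriv 1 \<phi>) k = \<i> * k * fourier \<phi> k"
proof -
  note i = integrable_mult_cis[OF schwartz_integrable, of _ "- k", simplified]
  obtain C where C: "\<And>t. norm (\<phi> t) \<le> C / (1 + t\<^sup>2)"
    using schwartz_bound_1_plus_square[OF assms] by blast
  have "(LINT s|lborel. dir_deriv 1 \<phi> s * cis (- (k * s)) - \<i> * k * (\<phi> s * cis (- (k * s)))) = 0"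
  proof (rule integral_derivative_eq_0[where f = "\<lambda>s. \<phi> s * cis (- (k * s))"])
    fix s
    have "((\<lambda>s. cis (- (k * s))) has_vector_derivative (- \<i> * k * cis (- (k * s)))) (at s)"
      by (auto intro!: derivative_eq_intros simp: has_vector_derivative_def scaleR_conv_of_real)
    from has_vector_derivative_mult[OF schwartz_has_vector_derivative[OF assms] this]
    show "((\<lambda>s. \<phi> s * cis (- (k * s))) has_vector_derivative
        (dir_deriv 1 \<phi> s * cis (- (k * s)) - \<i> * k * (\<phi> s * cis (- (k * s))))) (at s)"
      by (simp add: algebra_simps)
  next
    show "continuous_on UNIV (\<lambda>s. dir_deriv 1 \<phi> s * cis (- (k * s)) - \<i> * k * (\<phi> s * cis (- (k * s))))"
      by (intro continuous_intros schwartz_continuous schwartz_deriv assms)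
    show "integrable lborel (\<lambda>s. dir_deriv 1 \<phi> s * cis (- (k * s)) - \<i> * k * (\<phi> s * cis (- (k * s))))"
      by (intro Bochner_Integration.integrable_diff integrable_mult_right i schwartz_deriv assms)
    show "((\<lambda>s. \<phi> s * cis (- (k * s))) \<longlongrightarrow> 0) at_top" "((\<lambda>s. \<phi> s * cis (- (k * s))) \<longlongrightarrow> 0) at_bot"
      by (rule tendsto_0_1_plus_square[of _ C]; use C in \<open>simp add: norm_mult\<close>)+
  qed
  also have "(LINT s|lborel. dir_deriv 1 \<phi> s * cis (- (k * s)) - \<i> * k * (\<phi> s * cis (- (k * s)))) =
      fourier (dir_deriv 1 \<phi>) k - \<i> * k * fourier \<phi> k"
    unfolding fourier_cis integral_mult_right_zero[symmetric]
    by (intro Bochner_Integration.integral_diff integrable_mult_right i schwartz_deriv assms)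
  finally show ?thesis by simp
qed

text \<open>Two derivatives of \<phi> produce the factor t^2, enough decay to make the transform
  integrable.\<close>

lemma fourier_bound:
  assumes "\<phi> \<in> schwartz"
  obtains C where "C > 0" "\<And>t. norm (fourier \<phi> t) \<le> C / (1 + t\<^sup>2)"
proof -
  define I where "I \<psi> = (LINT s|lborel. norm (\<psi> s))" for \<psi> :: "real \<Rightarrow> complex"
  let ?\<psi> = "dir_deriv 1 (dir_deriv 1 \<phi>)"
  have "norm (fourier \<phi> t) \<le> (I \<phi> + I ?\<psi> + 1) / (1 + t\<^sup>2)" for t
  proof -
    have "fourier ?\<psi> t = - (of_real (t\<^sup>2) * fourier \<phi> t)"
      using fourier_deriv[OF schwartz_deriv[OF assms], of t] fourier_deriv[OF assms, of t]
      by (simp add: power2_eq_square algebra_simps)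
    then have "norm (fourier ?\<psi> t) = t\<^sup>2 * norm (fourier \<phi> t)" by (simp only: norm_minus_cancel norm_mult norm_of_real abs_power2)
    then have "t\<^sup>2 * norm (fourier \<phi> t) \<le> I ?\<psi>"
      using fourier_norm_le[OF schwartz_deriv[OF schwartz_deriv[OF assms]], of t] by (simp add: I_def)
    moreover have "norm (fourier \<phi> t) \<le> I \<phi>" using fourier_norm_le[OF assms] by (simp add: I_def)
    ultimately have "(1 + t\<^sup>2) * norm (fourier \<phi> t) \<le> I \<phi> + I ?\<psi> + 1" by (simp add: distrib_right)
    moreover have "0 < 1 + t\<^sup>2" by (simp add: add_pos_nonneg)
    ultimately show ?thesis by (simp add: field_simps)
  qed
  moreover have "I \<phi> + I ?\<psi> + 1 > 0" by (simp add: I_def add_nonneg_pos)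
  ultimately show ?thesis using that by blast
qed

lemma fourier_measurable:
  assumes "\<phi> \<in> schwartz"
  shows "fourier \<phi> \<in> borel_measurable borel"
proof -
  note [measurable] = schwartz_measurable[OF assms]
  show ?thesis unfolding fourier_def[abs_def] by measurable
qed

lemma fourier_integrable: "\<phi> \<in> schwartz \<Longrightarrow> integrable lborel (fourier \<phi>)"
  using fourier_bound fourier_measurable integrable_bound_1_plus_square by metis

lemma integrable_gaussian:
  assumes "\<delta> > 0"
  shows "integrable lborel (\<lambda>t::real. exp (- (\<delta> * t)\<^sup>2 / 2))"
proof -
  have "integrable lborel (\<lambda>t. sqrt (2 * pi) / \<delta> * normal_density 0 (1 / \<delta>) t)"
    using assms by (intro integrable_mult_right integrable_normal_density) auto
  also have "(\<lambda>t. sqrt (2 * pi) / \<delta> * normal_density 0 (1 / \<delta>) t) = (\<lambda>t. exp (- (\<delta> * t)\<^sup>2 / 2))"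
    using assms by (auto simp: normal_density_def fun_eq_iff real_sqrt_mult real_sqrt_divide power_mult_distrib field_simps)
  finally show ?thesis .
qed

text \<open>The characteristic function of the standard normal distribution, rescaled by
  \<delta>.\<close>

lemma gaussian_fourier:
  assumes "\<delta> > 0"
  shows "(LINT t|lborel. cis (a * t) * of_real (exp (- (\<delta> * t)\<^sup>2 / 2))) = of_real (sqrt (2 * pi) / \<delta> * exp (- (a / \<delta>)\<^sup>2 / 2))"
proof -
  have "of_real (exp (- (b\<^sup>2) / 2)) = (LINT x|lborel. std_normal_density x *\<^sub>R cis (b * x))" for b
  proof -
    have "of_real (exp (- (b\<^sup>2) / 2)) = char std_normal_distribution b"
      by (simp add: char_std_normal_distribution)
    also have "\<dots> = (LINT x|lborel. std_normal_density x *\<^sub>R cis (b * x))"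
      unfolding char_def cis_conv_exp by (subst integral_density) (auto simp: normal_density_nonneg)
    finally show ?thesis .
  qed
  from this[of "a / \<delta>"]
  have "of_real (sqrt (2 * pi)) * of_real (exp (- (a / \<delta>)\<^sup>2 / 2)) =
      (LINT x|lborel. of_real (sqrt (2 * pi)) * (std_normal_density x *\<^sub>R cis (a / \<delta> * x)))"
    by (simp only: integral_mult_right_zero)
  also have "\<dots> = (LINT x|lborel. cis (a / \<delta> * x) * of_real (exp (- x\<^sup>2 / 2)))"
    by (intro Bochner_Integration.integral_cong)
       (auto simp: normal_density_def scaleR_conv_of_real real_sqrt_mult)
  also have "\<dots> = \<bar>\<delta>\<bar> *\<^sub>R (LINT t|lborel. cis (a / \<delta> * (0 + \<delta> * t)) * of_real (exp (- (0 + \<delta> * t)\<^sup>2 / 2)))"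
    using assms by (intro lborel_integral_real_affine) auto
  also have "\<dots> = \<delta> * (LINT t|lborel. cis (a * t) * of_real (exp (- (\<delta> * t)\<^sup>2 / 2)))"
    using assms by (simp add: scaleR_conv_of_real)
  finally show ?thesis using assms by (simp add: field_simps)
qed

text \<open>Without damping the double integral over s and t does not converge absolutely. With it
  Fubini applies, the inner integral is a Gaussian of width \<delta> about a, and s = a + \<delta> r
  normalizes it.\<close>

lemma fourier_smoothed_inversion:
  assumes \<phi>: "\<phi> \<in> schwartz" and \<delta>: "\<delta> > 0"
  shows "(LINT t|lborel. fourier \<phi> t * cis (a * t) * of_real (exp (- (\<delta> * t)\<^sup>2 / 2))) =
    (LINT r|lborel. \<phi> (a + \<delta> * r) * of_real (sqrt (2 * pi) * exp (- r\<^sup>2 / 2)))"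
proof -
  note [measurable] = schwartz_measurable[OF \<phi>]
  have [measurable]: "cis \<in> borel_measurable borel"
    by (intro borel_measurable_continuous_onI continuous_intros)
  define F where "F = (\<lambda>s t. \<phi> s * cis (- (t * s)) * cis (a * t) * complex_of_real (exp (- (\<delta> * t)\<^sup>2 / 2)))"
  have [measurable]: "(\<lambda>(s, t). F s t) \<in> borel_measurable (lborel \<Otimes>\<^sub>M lborel)"
    unfolding F_def by measurable
  have ig: "integrable lborel (\<lambda>t::real. exp (- (\<delta> * t)\<^sup>2 / 2))" by (rule integrable_gaussian[OF \<delta>])
  have int: "integrable (lborel \<Otimes>\<^sub>M lborel) (\<lambda>(s, t). F s t)"
  proof (rule lborel_pair.Fubini_integrable)
    show "integrable lborel (\<lambda>s. LINT t|lborel. norm ((\<lambda>(s, t). F s t) (s, t)))"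
      using integrable_norm[OF schwartz_integrable[OF \<phi>]] by (simp add: F_def norm_mult)
    have "integrable lborel (\<lambda>t. F s t)" for s
    proof (rule Bochner_Integration.integrable_bound)
      show "integrable lborel (\<lambda>t::real. norm (\<phi> s) * exp (- (\<delta> * t)\<^sup>2 / 2))"
        using ig by (rule integrable_mult_right)
    qed (auto simp: F_def norm_mult)
    then show "AE s in lborel. integrable lborel (\<lambda>t. (\<lambda>(s, t). F s t) (s, t))" by simp
  qed simp
  have "(LINT t|lborel. fourier \<phi> t * cis (a * t) * of_real (exp (- (\<delta> * t)\<^sup>2 / 2))) =
      (LINT t|lborel. LINT s|lborel. F s t)"
    unfolding fourier_cis F_def by (simp flip: integral_mult_left_zero)
  also have "\<dots> = (LINT s|lborel. LINT t|lborel. F s t)"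
    by (rule lborel_pair.Fubini_integral[OF int])
  also have "\<dots> = (LINT s|lborel. \<phi> s * of_real (sqrt (2 * pi) / \<delta> * exp (- ((a - s) / \<delta>)\<^sup>2 / 2)))"
  proof (intro Bochner_Integration.integral_cong refl)
    fix s
    have "F s t = \<phi> s * (cis ((a - s) * t) * of_real (exp (- (\<delta> * t)\<^sup>2 / 2)))" for t
    proof -
      have "cis ((a - s) * t) = cis (- (t * s)) * cis (a * t)" by (simp add: cis_mult algebra_simps)
      then show ?thesis by (simp add: F_def mult.assoc)
    qed
    then have "(LINT t|lborel. F s t) = \<phi> s * (LINT t|lborel. cis ((a - s) * t) * of_real (exp (- (\<delta> * t)\<^sup>2 / 2)))"
      by simp
    then show "(LINT t|lborel. F s t) = \<phi> s * of_real (sqrt (2 * pi) / \<delta> * exp (- ((a - s) / \<delta>)\<^sup>2 / 2))"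
      unfolding gaussian_fourier[OF \<delta>] .
  qed
  also have "\<dots> = \<bar>\<delta>\<bar> *\<^sub>R (LINT r|lborel. \<phi> (a + \<delta> * r) * of_real (sqrt (2 * pi) / \<delta> * exp (- ((a - (a + \<delta> * r)) / \<delta>)\<^sup>2 / 2)))"
    using \<delta> by (intro lborel_integral_real_affine) auto
  also have "\<dots> = (LINT r|lborel. \<delta> *\<^sub>R (\<phi> (a + \<delta> * r) * of_real (sqrt (2 * pi) / \<delta> * exp (- ((a - (a + \<delta> * r)) / \<delta>)\<^sup>2 / 2))))"
    using \<delta> by simp
  also have "\<dots> = (LINT r|lborel. \<phi> (a + \<delta> * r) * of_real (sqrt (2 * pi) * exp (- r\<^sup>2 / 2)))"
    using \<delta> by (intro Bochner_Integration.integral_cong) (auto simp: scaleR_conv_of_real)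
  finally show ?thesis .
qed

text \<open>Let the damping \<delta> tend to 0 on both sides. The left side is dominated by the
  integrable transform, the right side by a Gaussian; the limit mass sqrt(2 pi) * sqrt(2 pi) is the
  factor 2 pi.\<close>

lemma fourier_inversion:
  fixes \<phi> :: "real \<Rightarrow> complex"
  assumes \<phi>: "\<phi> \<in> schwartz"
  shows "(LINT t|lborel. fourier \<phi> t * cis (a * t)) = of_real (2 * pi) * \<phi> a"
proof -
  note [measurable] = schwartz_measurable[OF \<phi>] fourier_measurable[OF \<phi>]
  have [measurable]: "cis \<in> borel_measurable borel"
    by (intro borel_measurable_continuous_onI continuous_intros)
  define \<delta> where "\<delta> n = 1 / real (Suc n)" for n
  have \<delta>: "\<delta> n > 0" for n by (simp add: \<delta>_def)
  have \<delta>0: "\<delta> \<longlonglongrightarrow> 0" unfolding \<delta>_def by real_asymp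
  let ?A = "\<lambda>n. LINT t|lborel. fourier \<phi> t * cis (a * t) * of_real (exp (- (\<delta> n * t)\<^sup>2 / 2))"
  have 1: "?A \<longlonglongrightarrow> (LINT t|lborel. fourier \<phi> t * cis (a * t))"
  proof (rule integral_dominated_convergence[where w = "\<lambda>t. norm (fourier \<phi> t)"])
    show "integrable lborel (\<lambda>t. norm (fourier \<phi> t))" by (intro integrable_norm fourier_integrable \<phi>)
    have "(\<lambda>n. fourier \<phi> t * cis (a * t) * of_real (exp (- (\<delta> n * t)\<^sup>2 / 2))) \<longlonglongrightarrow>
        fourier \<phi> t * cis (a * t) * of_real (exp (- (0 * t)\<^sup>2 / 2))" for t
      by (intro tendsto_intros \<delta>0) auto
    then show "AE t in lborel. (\<lambda>n. fourier \<phi> t * cis (a * t) * of_real (exp (- (\<delta> n * t)\<^sup>2 / 2))) \<longlonglongrightarrow> fourier \<phi> t * cis (a * t)"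
      by simp
    show "AE t in lborel. norm (fourier \<phi> t * cis (a * t) * of_real (exp (- (\<delta> n * t)\<^sup>2 / 2))) \<le> norm (fourier \<phi> t)" for n
      by (auto simp: norm_mult intro!: mult_left_le)
  qed measurable
  \<comment> \<open>Decay of order 0 is just a uniform bound on \<phi>.\<close>
  obtain C where C: "C > 0" "\<And>t. norm (\<phi> t) \<le> C / (1 + \<bar>t\<bar>) ^ 0"
    by (rule schwartz_decay[OF \<phi>, of 0]) (rule that)
  have 2: "(\<lambda>n. LINT r|lborel. \<phi> (a + \<delta> n * r) * of_real (sqrt (2 * pi) * exp (- r\<^sup>2 / 2))) \<longlonglongrightarrow>
      (LINT r|lborel. \<phi> a * of_real (sqrt (2 * pi) * exp (- r\<^sup>2 / 2)))"
  proof (rule integral_dominated_convergence[where w = "\<lambda>r. C * (sqrt (2 * pi) * exp (- r\<^sup>2 / 2))" and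
        s = "\<lambda>n r. \<phi> (a + \<delta> n * r) * of_real (sqrt (2 * pi) * exp (- r\<^sup>2 / 2))"])
    have "integrable lborel (\<lambda>r::real. exp (- r\<^sup>2 / 2))"
      using integrable_gaussian[OF zero_less_one] by (simp only: mult_1_left)
    then show "integrable lborel (\<lambda>r::real. C * (sqrt (2 * pi) * exp (- r\<^sup>2 / 2)))"
      by (intro integrable_mult_right)
    have "(\<lambda>n. \<phi> (a + \<delta> n * r)) \<longlonglongrightarrow> \<phi> (a + 0 * r)" for r
      by (intro isCont_tendsto_compose[OF schwartz_isCont[OF \<phi>]] tendsto_intros \<delta>0)
    then show "AE r in lborel. (\<lambda>n. \<phi> (a + \<delta> n * r) * of_real (sqrt (2 * pi) * exp (- r\<^sup>2 / 2))) \<longlonglongrightarrow> \<phi> a * of_real (sqrt (2 * pi) * exp (- r\<^sup>2 / 2))"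
      by (auto intro!: tendsto_intros)
    show "AE r in lborel. norm (\<phi> (a + \<delta> n * r) * of_real (sqrt (2 * pi) * exp (- r\<^sup>2 / 2))) \<le> C * (sqrt (2 * pi) * exp (- r\<^sup>2 / 2))" for n
      using C(2) by (auto simp: norm_mult intro!: mult_right_mono)
  qed measurable
  have "(\<lambda>n. LINT r|lborel. \<phi> (a + \<delta> n * r) * of_real (sqrt (2 * pi) * exp (- r\<^sup>2 / 2))) \<longlonglongrightarrow> (LINT t|lborel. fourier \<phi> t * cis (a * t))"
    using 1 unfolding fourier_smoothed_inversion[OF \<phi> \<delta>] .
  from LIMSEQ_unique[OF this 2]
  have "(LINT t|lborel. fourier \<phi> t * cis (a * t)) = (LINT r|lborel. \<phi> a * of_real (sqrt (2 * pi) * exp (- r\<^sup>2 / 2)))" .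
  also have "\<dots> = \<phi> a * of_real (sqrt (2 * pi)) * (LINT r|lborel. cis (0 * r) * of_real (exp (- (1 * r)\<^sup>2 / 2)))"
    unfolding integral_mult_right_zero[symmetric] by (simp only: mult_zero_left cis_zero mult_1_left of_real_mult mult.assoc)
  also have "\<dots> = \<phi> a * of_real (sqrt (2 * pi) * sqrt (2 * pi))"
  proof -
    have e: "sqrt (2 * pi) / 1 * exp (- (0 / 1)\<^sup>2 / 2) = sqrt (2 * pi)" by simp
    show ?thesis unfolding gaussian_fourier[OF zero_less_one] e of_real_mult by (rule mult.assoc)
  qed
  also have "\<dots> = of_real (2 * pi) * \<phi> a"
  proof -
    have "sqrt (2 * pi) * sqrt (2 * pi) = 2 * pi" by simp
    then show ?thesis by (simp only: mult.commute)
  qed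
  finally show ?thesis .
qed

section \<open>Gaussian integrals with complex parameter\<close>

lemma power4_exp_le:
  fixes y :: real
  assumes "y \<ge> 0"
  shows "y\<^sup>2 * exp (- y) \<le> 16 * exp (- y / 2)"
proof -
  have "y / 4 \<le> exp (y / 4)" using exp_ge_add_one_self[of "y / 4"] by linarith
  then have "(y / 4)\<^sup>2 \<le> exp (y / 4) ^ 2" using assms by (intro power_mono) auto
  also have "exp (y / 4) ^ 2 = exp (y / 2)" by (simp flip: exp_of_nat_mult)
  finally have "y\<^sup>2 \<le> 16 * exp (y / 2)" by (simp add: power_divide)
  then have "y\<^sup>2 * exp (- y) \<le> 16 * exp (y / 2) * exp (- y)" by (intro mult_right_mono) auto
  then show ?thesis by (simp add: mult.assoc flip: exp_add)
qed

text \<open>Moments up to order 4 are what the second-order Taylor remainder in the parameter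
  \<beta> requires.\<close>

lemma integrable_gaussian_power:
  assumes "\<alpha> > 0" "k \<le> 4"
  shows "integrable lborel (\<lambda>s::real. s ^ k * exp (- \<alpha> * s\<^sup>2))"
proof (rule Bochner_Integration.integrable_bound)
  define C where "C = 1 + 16 / \<alpha>\<^sup>2"
  show "integrable lborel (\<lambda>s::real. C * exp (- (sqrt \<alpha> * s)\<^sup>2 / 2))"
    using assms(1) by (intro integrable_mult_right integrable_gaussian) auto
  have "norm (s ^ k * exp (- \<alpha> * s\<^sup>2)) \<le> norm (C * exp (- (sqrt \<alpha> * s)\<^sup>2 / 2))" for s
  proof -
    have "\<bar>s\<bar> ^ k \<le> 1 + s ^ 4"
    proof (cases "\<bar>s\<bar> \<le> 1")
      case True
      then show ?thesis using power_le_one[of "\<bar>s\<bar>" k] by (simp add: add_increasing2)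
    next
      case False
      then have "\<bar>s\<bar> ^ k \<le> \<bar>s\<bar> ^ 4" using assms(2) by (intro power_increasing) auto
      then show ?thesis by simp
    qed
    then have "\<bar>s\<bar> ^ k * exp (- \<alpha> * s\<^sup>2) \<le> (1 + s ^ 4) * exp (- \<alpha> * s\<^sup>2)"
      by (intro mult_right_mono) auto
    also have "\<dots> = exp (- \<alpha> * s\<^sup>2) + (\<alpha> * s\<^sup>2)\<^sup>2 * exp (- (\<alpha> * s\<^sup>2)) / \<alpha>\<^sup>2"
      using assms(1) by (simp add: power_mult_distrib distrib_right)
    also have "\<dots> \<le> exp (- \<alpha> * s\<^sup>2 / 2) + 16 * exp (- (\<alpha> * s\<^sup>2) / 2) / \<alpha>\<^sup>2"
      using assms(1) by (intro add_mono divide_right_mono power4_exp_le) auto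
    also have "\<dots> = C * exp (- (sqrt \<alpha> * s)\<^sup>2 / 2)"
      using assms(1) by (simp add: C_def power_mult_distrib algebra_simps)
    finally show ?thesis
      using assms(1) by (simp add: abs_mult power_abs C_def)
  qed
  then show "AE s in lborel. norm (s ^ k * exp (- \<alpha> * s\<^sup>2)) \<le> norm (C * exp (- (sqrt \<alpha> * s)\<^sup>2 / 2))"
    by simp
qed simp

text \<open>The k-th moment of exp(-p s^2) with p = \<alpha> - i \<beta>, that is
  \<open>Complex \<alpha> (- \<beta>)\<close>. With \<alpha> fixed it is a function of the real
  variable \<beta>.\<close>

definition cgauss :: "real \<Rightarrow> nat \<Rightarrow> real \<Rightarrow> complex" where
  "cgauss \<alpha> k \<beta> = (LINT s|lborel. of_real (s ^ k * exp (- \<alpha> * s\<^sup>2)) * cis (\<beta> * s\<^sup>2))"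

lemma cgauss_integrable:
  assumes "\<alpha> > 0" "k \<le> 4"
  shows "integrable lborel (\<lambda>s. of_real (s ^ k * exp (- \<alpha> * s\<^sup>2)) * cis (\<beta> * s\<^sup>2))"
proof (rule Bochner_Integration.integrable_bound[OF integrable_gaussian_power[OF assms]])
  show "(\<lambda>s. of_real (s ^ k * exp (- \<alpha> * s\<^sup>2)) * cis (\<beta> * s\<^sup>2)) \<in> borel_measurable lborel"
    by (simp, intro borel_measurable_continuous_onI continuous_intros)
  show "AE s in lborel. norm (of_real (s ^ k * exp (- \<alpha> * s\<^sup>2)) * cis (\<beta> * s\<^sup>2)) \<le> norm (s ^ k * exp (- \<alpha> * s\<^sup>2))"
    unfolding norm_mult[of _ "cis _"] norm_of_real norm_cis by simp
qed

lemma cis_second_order: "norm (cis x - 1 - \<i> * x) \<le> x\<^sup>2 / 2"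
  using iexp_approx1[of x 1] by (simp add: cis_conv_exp power2_eq_square numeral_2_eq_2 diff_diff_eq abs_mult_self_eq)

text \<open>The difference quotient is compared under the integral: \<open>cis_second_order\<close>
  bounds the remainder by (h s^2)^2 / 2, so its integral is at most h^2/2 times the fourth
  moment.\<close>

lemma cgauss_has_vector_derivative:
  assumes \<alpha>: "\<alpha> > 0"
  shows "(cgauss \<alpha> 0 has_vector_derivative \<i> * cgauss \<alpha> 2 \<beta>) (at \<beta>)"
proof -
  define I4 where "I4 = (LINT s|lborel. s ^ 4 * exp (- \<alpha> * s\<^sup>2))"
  show ?thesis
    unfolding has_vector_derivative_def
  proof (rule has_derivativeI_sandwich[where e = 1 and H = "\<lambda>y. \<bar>y - \<beta>\<bar> * I4 / 2"])
    show "bounded_linear (\<lambda>x. x *\<^sub>R (\<i> * cgauss \<alpha> 2 \<beta>))" by (rule bounded_linear_scaleR_left)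
    have "((\<lambda>y. \<bar>y - \<beta>\<bar> * I4 / 2) \<longlongrightarrow> \<bar>\<beta> - \<beta>\<bar> * I4 / 2) (at \<beta>)"
      by (intro tendsto_intros) auto
    then show "((\<lambda>y. \<bar>y - \<beta>\<bar> * I4 / 2) \<longlongrightarrow> 0) (at \<beta>)" by simp
  next
    fix y assume "y \<noteq> \<beta>"
    define h where "h = y - \<beta>"
    let ?R = "\<lambda>s. of_real (s ^ 0 * exp (- \<alpha> * s\<^sup>2)) * cis (y * s\<^sup>2) - of_real (s ^ 0 * exp (- \<alpha> * s\<^sup>2)) * cis (\<beta> * s\<^sup>2)
        - of_real h * \<i> * (of_real (s ^ 2 * exp (- \<alpha> * s\<^sup>2)) * cis (\<beta> * s\<^sup>2))"
    have eq: "cgauss \<alpha> 0 y - cgauss \<alpha> 0 \<beta> - of_real h * \<i> * cgauss \<alpha> 2 \<beta> = (LINT s|lborel. ?R s)"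
      unfolding cgauss_def integral_mult_right_zero[symmetric]
      by (subst Bochner_Integration.integral_diff Bochner_Integration.integral_diff,
        (intro Bochner_Integration.integrable_diff integrable_mult_right cgauss_integrable \<alpha>; simp)+)+ simp
    have le: "norm (LINT s|lborel. ?R s) \<le> (LINT s|lborel. h\<^sup>2 / 2 * (s ^ 4 * exp (- \<alpha> * s\<^sup>2)))"
    proof (rule Bochner_Integration.integral_norm_bound_integral)
      show "integrable lborel ?R"
        by (intro Bochner_Integration.integrable_diff integrable_mult_right cgauss_integrable \<alpha>) auto
      show "integrable lborel (\<lambda>s. h\<^sup>2 / 2 * (s ^ 4 * exp (- \<alpha> * s\<^sup>2)))"
        using \<alpha> by (intro integrable_mult_right integrable_gaussian_power) auto
      fix s
      have "cis (y * s\<^sup>2) = cis (\<beta> * s\<^sup>2) * cis (h * s\<^sup>2)" by (simp add: cis_mult h_def algebra_simps)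
      then have "?R s = of_real (exp (- \<alpha> * s\<^sup>2)) * cis (\<beta> * s\<^sup>2) * (cis (h * s\<^sup>2) - 1 - \<i> * of_real (h * s\<^sup>2))"
        by (simp add: algebra_simps)
      then have "norm (?R s) = exp (- \<alpha> * s\<^sup>2) * norm (cis (h * s\<^sup>2) - 1 - \<i> * of_real (h * s\<^sup>2))"
        by (simp only: norm_mult norm_cis norm_of_real abs_exp_cancel mult_1_right)
      also have "\<dots> \<le> exp (- \<alpha> * s\<^sup>2) * ((h * s\<^sup>2)\<^sup>2 / 2)"
        by (intro mult_left_mono cis_second_order) auto
      also have "\<dots> = h\<^sup>2 / 2 * (s ^ 4 * exp (- \<alpha> * s\<^sup>2))"
        by (simp add: power_mult_distrib)
      finally show "norm (?R s) \<le> h\<^sup>2 / 2 * (s ^ 4 * exp (- \<alpha> * s\<^sup>2))" .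
    qed
    have "(LINT s|lborel. h\<^sup>2 / 2 * (s ^ 4 * exp (- \<alpha> * s\<^sup>2))) = h\<^sup>2 / 2 * I4"
      unfolding I4_def by (rule integral_mult_right_zero)
    with le have "norm (cgauss \<alpha> 0 y - cgauss \<alpha> 0 \<beta> - of_real h * \<i> * cgauss \<alpha> 2 \<beta>) \<le> h\<^sup>2 / 2 * I4"
      unfolding eq by (rule ord_le_eq_trans)
    then have "norm (cgauss \<alpha> 0 y - cgauss \<alpha> 0 \<beta> - h *\<^sub>R (\<i> * cgauss \<alpha> 2 \<beta>)) \<le> h\<^sup>2 / 2 * I4"
      unfolding scaleR_conv_of_real mult.assoc .
    then have "norm (cgauss \<alpha> 0 y - cgauss \<alpha> 0 \<beta> - h *\<^sub>R (\<i> * cgauss \<alpha> 2 \<beta>)) \<le> (I4 / 2) * (\<bar>h\<bar> * \<bar>h\<bar>)"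
      unfolding abs_mult_self_eq power2_eq_square by (simp add: mult.commute)
    then show "norm (cgauss \<alpha> 0 y - cgauss \<alpha> 0 \<beta> - (y - \<beta>) *\<^sub>R (\<i> * cgauss \<alpha> 2 \<beta>)) / norm (y - \<beta>) \<le> \<bar>y - \<beta>\<bar> * I4 / 2"
      unfolding h_def[symmetric] real_norm_def
      using \<open>y \<noteq> \<beta>\<close> by (subst pos_divide_le_eq) (simp_all only: mult_ac h_def zero_less_abs_iff, simp_all add: mult.commute)
  qed auto
qed

text \<open>Integrate the derivative of s exp(-p s^2).\<close>

lemma cgauss_by_parts:
  assumes \<alpha>: "\<alpha> > 0"
  shows "2 * Complex \<alpha> (- \<beta>) * cgauss \<alpha> 2 \<beta> = cgauss \<alpha> 0 \<beta>"
proof -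
  let ?p = "Complex \<alpha> (- \<beta>)"
  define g where "g = (\<lambda>k s. of_real (s ^ k * exp (- \<alpha> * s\<^sup>2)) * cis (\<beta> * s\<^sup>2))"
  have gexp: "g k s = of_real s ^ k * exp (- ?p * of_real s ^ 2)" for k s
  proof -
    have E: "exp (- ?p * of_real s ^ 2) = exp (of_real (- \<alpha> * s\<^sup>2) + \<i> * of_real (\<beta> * s\<^sup>2))"
      by (intro arg_cong[of _ _ exp]) (simp add: complex_eq_iff)
    show ?thesis unfolding g_def E exp_add exp_of_real cis_conv_exp by (simp only: of_real_mult of_real_power mult.assoc)
  qed
  have cont: "continuous_on UNIV (g k)" for k
    unfolding g_def by (intro continuous_intros)
  have int: "integrable lborel (g k)" if "k \<le> 4" for k
    unfolding g_def by (rule cgauss_integrable[OF \<alpha> that])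
  have "(LINT s|lborel. g 0 s - 2 * ?p * g 2 s) = 0"
  proof (rule integral_derivative_eq_0)
    fix s
    have "((\<lambda>z. z * exp (- ?p * z\<^sup>2)) has_field_derivative (exp (- ?p * of_real s ^ 2) - 2 * ?p * (of_real s ^ 2 * exp (- ?p * of_real s ^ 2)))) (at (of_real s))"
      by (auto intro!: derivative_eq_intros simp: algebra_simps power2_eq_square)
    from has_vector_derivative_real_field[OF this]
    show "(g 1 has_vector_derivative (g 0 s - 2 * ?p * g 2 s)) (at s)"
      by (simp add: gexp[abs_def])
  next
    show "continuous_on UNIV (\<lambda>s. g 0 s - 2 * ?p * g 2 s)" by (intro continuous_intros cont)
    show "integrable lborel (\<lambda>s. g 0 s - 2 * ?p * g 2 s)"
      by (intro Bochner_Integration.integrable_diff integrable_mult_right int) auto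
    have "((\<lambda>s. norm (g 1 s)) \<longlongrightarrow> 0) at_top"
      unfolding g_def norm_mult norm_cis norm_of_real using \<alpha> by real_asymp
    then show "(g 1 \<longlongrightarrow> 0) at_top" by (rule tendsto_norm_zero_cancel)
    have "((\<lambda>s. norm (g 1 s)) \<longlongrightarrow> 0) at_bot"
      unfolding g_def norm_mult norm_cis norm_of_real using \<alpha> by real_asymp
    then show "(g 1 \<longlongrightarrow> 0) at_bot" by (rule tendsto_norm_zero_cancel)
  qed
  also have "(LINT s|lborel. g 0 s - 2 * ?p * g 2 s) = cgauss \<alpha> 0 \<beta> - 2 * ?p * cgauss \<alpha> 2 \<beta>"
  proof -
    have cg: "cgauss \<alpha> k \<beta> = (LINT s|lborel. g k s)" for k by (simp add: cgauss_def g_def)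
    show ?thesis unfolding cg integral_mult_right_zero[symmetric]
      by (intro Bochner_Integration.integral_diff integrable_mult_right int) auto
  qed
  finally show ?thesis by simp
qed

text \<open>The product does not depend on \<beta>: its derivative vanishes by
  \<open>cgauss_by_parts\<close>, and p stays in the right half-plane, away from the cut of the
  root. Its value is read off at \<beta> = 0.\<close>

lemma csqrt_cgauss:
  assumes \<alpha>: "\<alpha> > 0"
  shows "csqrt (Complex \<alpha> (- \<beta>)) * cgauss \<alpha> 0 \<beta> = sqrt pi"
proof -
  define F where "F = (\<lambda>\<beta>. csqrt (Complex \<alpha> (- \<beta>)) * cgauss \<alpha> 0 \<beta>)"
  have "(F has_vector_derivative 0) (at \<beta>)" for \<beta>
  proof -
    let ?p = "Complex \<alpha> (- \<beta>)"
    have np: "?p \<notin> \<real>\<^sub>\<le>\<^sub>0" using \<alpha> by (auto simp: complex_nonpos_Reals_iff)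
    have p0: "?p \<noteq> 0" using \<alpha> by (simp add: complex_eq_iff)
    have "((\<lambda>\<beta>. Complex \<alpha> (- \<beta>)) has_vector_derivative (- \<i>)) (at \<beta>)"
    proof -
      have "(\<lambda>\<beta>. Complex \<alpha> (- \<beta>)) = (\<lambda>\<beta>. of_real \<alpha> - \<i> * of_real \<beta>)" by (auto simp: complex_eq_iff fun_eq_iff)
      moreover have "((\<lambda>\<beta>. of_real \<alpha> - \<i> * of_real \<beta>) has_vector_derivative (- \<i>)) (at \<beta>)"
        by (rule has_vector_derivative_real_field) (auto intro!: derivative_eq_intros)
      ultimately show ?thesis by simp
    qed
    from field_vector_diff_chain_at[OF this has_field_derivative_csqrt[OF np]]
    have "((\<lambda>\<beta>. csqrt (Complex \<alpha> (- \<beta>))) has_vector_derivative (- \<i> * inverse (2 * csqrt ?p))) (at \<beta>)"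
      by (simp add: o_def)
    from has_vector_derivative_mult[OF this cgauss_has_vector_derivative[OF \<alpha>, of \<beta>]]
    have "(F has_vector_derivative (csqrt ?p * (\<i> * cgauss \<alpha> 2 \<beta>) + - \<i> * inverse (2 * csqrt ?p) * cgauss \<alpha> 0 \<beta>)) (at \<beta>)"
      by (simp add: F_def)
    also have "csqrt ?p * (\<i> * cgauss \<alpha> 2 \<beta>) + - \<i> * inverse (2 * csqrt ?p) * cgauss \<alpha> 0 \<beta> = 0"
    proof -
      have "csqrt ?p \<noteq> 0" using p0 by simp
      moreover have "csqrt ?p * csqrt ?p = ?p" using power2_csqrt[of ?p] by (simp only: power2_eq_square)
      ultimately have "inverse (2 * csqrt ?p) * (2 * ?p) = csqrt ?p" by (simp add: field_simps)
      then have "inverse (2 * csqrt ?p) * cgauss \<alpha> 0 \<beta> = csqrt ?p * cgauss \<alpha> 2 \<beta>"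
        unfolding cgauss_by_parts[OF \<alpha>, symmetric] by (simp only: mult.assoc[symmetric])
      then show ?thesis by (simp add: mult.assoc)
    qed
    finally show ?thesis .
  qed
  then obtain C where "\<And>\<beta>. F \<beta> = C"
    using has_vector_derivative_zero_constant[of UNIV F] by auto
  then have "F \<beta> = F 0" by simp
  also have "F 0 = of_real (sqrt \<alpha>) * (LINT t|lborel. cis (0 * t) * of_real (exp (- (sqrt (2 * \<alpha>) * t)\<^sup>2 / 2)))"
  proof -
    have "Complex \<alpha> (- 0) = of_real \<alpha>" by (simp add: complex_eq_iff)
    then have "csqrt (Complex \<alpha> (- 0)) = of_real (sqrt \<alpha>)" using \<alpha> by (simp add: csqrt_of_real_nonneg)
    then show ?thesis using \<alpha> by (simp add: F_def cgauss_def power_mult_distrib)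
  qed
  also have "\<dots> = sqrt pi"
  proof -
    have "sqrt (2 * \<alpha>) > 0" using \<alpha> by simp
    from gaussian_fourier[OF this, of 0] have "(LINT t|lborel. cis (0 * t) * of_real (exp (- (sqrt (2 * \<alpha>) * t)\<^sup>2 / 2))) = of_real (sqrt (2 * pi) / sqrt (2 * \<alpha>))"
      by simp
    moreover have "sqrt \<alpha> * (sqrt (2 * pi) / sqrt (2 * \<alpha>)) = sqrt pi"
      using \<alpha> by (simp add: real_sqrt_mult)
    ultimately show ?thesis by (simp only: of_real_mult[symmetric])
  qed
  finally show ?thesis by (simp add: F_def)
qed

text \<open>Squaring determines the root up to sign. For Im w > 0 the principal root of w lies in
  the open first quadrant, and turning it by -pi/4 keeps its real part positive, as the principal
  branch demands.\<close>

lemma csqrt_rotate: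
  assumes "Im w > 0"
  shows "csqrt (- (\<i> * w) * of_real (4 * pi\<^sup>2)) = of_real (2 * pi) * cis (- pi / 4) * csqrt w"
proof (rule csqrt_unique)
  have "cis (- pi / 4) ^ 2 = cis (- (pi / 2))" unfolding Complex.DeMoivre by (simp add: field_simps)
  also have "\<dots> = - \<i>" by (simp add: complex_eq_iff)
  finally show "(of_real (2 * pi) * cis (- pi / 4) * csqrt w)\<^sup>2 = - (\<i> * w) * of_real (4 * pi\<^sup>2)"
    by (simp add: power_mult_distrib)
  define a b where "a = Re (csqrt w)" "b = Im (csqrt w)"
  have "2 * a * b = Im ((csqrt w)\<^sup>2)" by (simp add: a_b_def power2_eq_square)
  then have ab: "a * b > 0" using assms by simp
  have "a \<ge> 0" using csqrt_principal[of w] by (auto simp: a_b_def)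
  with ab have "a > 0" "b > 0" by (auto simp: zero_less_mult_iff)
  moreover have "Re (of_real (2 * pi) * cis (- pi / 4) * csqrt w) = 2 * pi * (sqrt 2 / 2 * a + sqrt 2 / 2 * b)"
    by (simp add: a_b_def cos_45 sin_45 algebra_simps)
  ultimately have "Re (of_real (2 * pi) * cis (- pi / 4) * csqrt w) > 0"
    by (simp add: add_pos_pos)
  then show "0 < Re (of_real (2 * pi) * cis (- pi / 4) * csqrt w) \<or> Re (of_real (2 * pi) * cis (- pi / 4) * csqrt w) = 0 \<and> 0 \<le> Im (of_real (2 * pi) * cis (- pi / 4) * csqrt w)"
    by simp
qed

text \<open>The Gaussian integral with p = -4 pi^2 i w equals sqrt(pi) / sqrt p, and sqrt p = 2 pi
  e^(-i pi/4) csqrt w. The leading minus is the branch of \<open>uhp_sqrt\<close>.\<close>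

lemma inverse_uhp_sqrt:
  assumes "Im w > 0"
  shows "1 / uhp_sqrt w = - (2 * sqrt pi * cis (- pi / 4)) * (LINT s|lborel. exp (\<i> * w * of_real (4 * pi\<^sup>2 * s\<^sup>2)))"
proof -
  have p: "Complex (4 * pi\<^sup>2 * Im w) (- (4 * pi\<^sup>2 * Re w)) = - (\<i> * w) * of_real (4 * pi\<^sup>2)"
    by (simp add: complex_eq_iff)
  have w0: "w \<noteq> 0" using assms by auto
  have "of_real (s ^ 0 * exp (- (4 * pi\<^sup>2 * Im w) * s\<^sup>2)) * cis (4 * pi\<^sup>2 * Re w * s\<^sup>2) = exp (\<i> * w * of_real (4 * pi\<^sup>2 * s\<^sup>2))" for s
  proof -
    have E: "exp (\<i> * w * of_real (4 * pi\<^sup>2 * s\<^sup>2)) = exp (of_real (- (4 * pi\<^sup>2 * Im w) * s\<^sup>2) + \<i> * of_real (4 * pi\<^sup>2 * Re w * s\<^sup>2))"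
      by (intro arg_cong[of _ _ exp]) (simp add: complex_eq_iff)
    show ?thesis unfolding E exp_add exp_of_real cis_conv_exp by (simp only: power_0 mult_1_left)
  qed
  then have "cgauss (4 * pi\<^sup>2 * Im w) 0 (4 * pi\<^sup>2 * Re w) = (LINT s|lborel. exp (\<i> * w * of_real (4 * pi\<^sup>2 * s\<^sup>2)))"
    unfolding cgauss_def by simp
  with csqrt_cgauss[of "4 * pi\<^sup>2 * Im w" "4 * pi\<^sup>2 * Re w"] assms
  have *: "of_real (2 * pi) * cis (- pi / 4) * csqrt w * (LINT s|lborel. exp (\<i> * w * of_real (4 * pi\<^sup>2 * s\<^sup>2))) = sqrt pi"
    unfolding p csqrt_rotate[OF assms] by simp
  define I where "I = (LINT s|lborel. exp (\<i> * w * of_real (4 * pi\<^sup>2 * s\<^sup>2)))"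
  have "csqrt w * (2 * sqrt pi * cis (- pi / 4) * I) = 2 * sqrt pi / (2 * pi) * (of_real (2 * pi) * cis (- pi / 4) * csqrt w * I)"
    by simp
  also have "\<dots> = of_real (2 * sqrt pi / (2 * pi) * sqrt pi)" unfolding I_def * by (simp, simp flip: of_real_mult)
  also have "2 * sqrt pi / (2 * pi) * sqrt pi = 1" by simp
  finally have "csqrt w * (2 * sqrt pi * cis (- pi / 4) * I) = 1" by simp
  then have "2 * sqrt pi * cis (- pi / 4) * I * csqrt w = 1" by (simp only: mult.commute)
  then have "2 * sqrt pi * cis (- pi / 4) * I = 1 / csqrt w" using w0 by (intro eq_divide_imp) auto
  then show ?thesis by (simp add: uhp_sqrt_def I_def)
qed

section \<open>Summation over the integers\<close>

text \<open>At t = m / sqrt N the argument of \<psi> is a rescaled eigenvalue. The weight t^n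
  records the powers created by the chain rule, so that the family is closed under
  differentiation.\<close>

definition radial :: "(real \<Rightarrow> complex) \<Rightarrow> nat \<Rightarrow> real \<Rightarrow> real \<Rightarrow> complex" where
  "radial \<psi> n l t = of_real (t ^ n) * \<psi> (l + 4 * pi\<^sup>2 * t\<^sup>2)"

lemma le_4_pi_square: "t\<^sup>2 \<le> 4 * pi\<^sup>2 * t\<^sup>2" for t :: real
proof -
  have "1 * t\<^sup>2 \<le> (2 * pi)\<^sup>2 * t\<^sup>2"
    using pi_gt3 by (intro mult_right_mono one_le_power) auto
  then show ?thesis by (simp add: power_mult_distrib)
qed

text \<open>With X = 1 + l + 4 pi^2 t^2, the decay X^-(n + 4) of \<psi> is spent as follows: n
  powers on t^n, one on the extra factor X, three on (1 + l)^2 (1 + t^2). The extra factor later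
  pays for undoing the damping.\<close>

lemma radial_bound:
  assumes "\<psi> \<in> schwartz"
  obtains C where "C > 0" "\<And>l t. l \<ge> 0 \<Longrightarrow> norm (radial \<psi> n l t) * (1 + (l + 4 * pi\<^sup>2 * t\<^sup>2)) \<le> C / ((1 + l)\<^sup>2 * (1 + t\<^sup>2))"
proof -
  obtain C where C: "C > 0" "\<And>t. norm (\<psi> t) \<le> C / (1 + \<bar>t\<bar>) ^ (n + 4)"
    using schwartz_decay[OF assms] by blast
  have "norm (radial \<psi> n l t) * (1 + (l + 4 * pi\<^sup>2 * t\<^sup>2)) \<le> C / ((1 + l)\<^sup>2 * (1 + t\<^sup>2))" if l: "l \<ge> 0" for l t
  proof -
    define X where "X = 1 + (l + 4 * pi\<^sup>2 * t\<^sup>2)"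
    have X1: "1 + l \<le> X" "1 + t\<^sup>2 \<le> X"
      using le_4_pi_square[of t] l zero_le_power2[of t] unfolding X_def by linarith+
    have "2 * \<bar>t\<bar> \<le> 1 + t\<^sup>2" using zero_le_power2[of "\<bar>t\<bar> - 1"] by (simp add: power2_diff)
    then have tX: "\<bar>t\<bar> \<le> X" using X1(2) zero_le_power2[of t] by linarith
    have X0: "X > 0" using X1(1) l by linarith
    have "\<bar>l + 4 * pi\<^sup>2 * t\<^sup>2\<bar> = l + 4 * pi\<^sup>2 * t\<^sup>2" using l by simp
    then have "norm (\<psi> (l + 4 * pi\<^sup>2 * t\<^sup>2)) \<le> C / X ^ (n + 4)" using C(2)[of "l + 4 * pi\<^sup>2 * t\<^sup>2"] by (simp add: X_def)
    then have "norm (radial \<psi> n l t) \<le> X ^ n * (C / X ^ (n + 4))"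
      unfolding radial_def norm_mult norm_of_real power_abs using tX X0 by (intro mult_mono power_mono) auto
    then have "norm (radial \<psi> n l t) * X \<le> X ^ n * (C / X ^ (n + 4)) * X"
      using X0 by (intro mult_right_mono) auto
    also have "\<dots> = C / X ^ 3" using X0 by (simp add: power_add field_simps power3_eq_cube numeral_eq_Suc)
    also have "\<dots> \<le> C / ((1 + l)\<^sup>2 * (1 + t\<^sup>2))"
    proof -
      have "(1 + l)\<^sup>2 * (1 + t\<^sup>2) \<le> X\<^sup>2 * X" using X1 l by (intro mult_mono power_mono) auto
      also have "\<dots> = X ^ 3" by (simp add: power3_eq_cube power2_eq_square)
      finally show ?thesis using C(1) l X0 by (intro divide_left_mono mult_pos_pos) (auto simp: add_pos_nonneg)
    qed
    finally show ?thesis by (simp add: X_def)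
  qed
  then show ?thesis using that C(1) by blast
qed

lemma radial_bound':
  assumes "\<psi> \<in> schwartz"
  obtains C where "C > 0" "\<And>l t. l \<ge> 0 \<Longrightarrow> norm (radial \<psi> n l t) \<le> C / ((1 + l)\<^sup>2 * (1 + t\<^sup>2))"
proof -
  obtain C where C: "C > 0" "\<And>l t. l \<ge> 0 \<Longrightarrow> norm (radial \<psi> n l t) * (1 + (l + 4 * pi\<^sup>2 * t\<^sup>2)) \<le> C / ((1 + l)\<^sup>2 * (1 + t\<^sup>2))"
    using radial_bound[OF assms] by blast
  have "norm (radial \<psi> n l t) \<le> C / ((1 + l)\<^sup>2 * (1 + t\<^sup>2))" if "l \<ge> 0" for l t
  proof -
    have "norm (radial \<psi> n l t) * 1 \<le> norm (radial \<psi> n l t) * (1 + (l + 4 * pi\<^sup>2 * t\<^sup>2))"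
      using that by (intro mult_left_mono) auto
    then show ?thesis using C(2)[OF that, of t] by simp
  qed
  then show ?thesis using that C(1) by blast
qed

text \<open>For n = 0 the truncated n - 1 is harmless, since that term carries the factor n.\<close>

lemma radial_has_vector_derivative:
  assumes "\<psi> \<in> schwartz"
  shows "(radial \<psi> n l has_vector_derivative
    (of_nat n * radial \<psi> (n - 1) l t + of_real (8 * pi\<^sup>2) * radial (dir_deriv 1 \<psi>) (n + 1) l t)) (at t)"
proof -
  have "((\<lambda>t. l + 4 * pi\<^sup>2 * t\<^sup>2) has_real_derivative 8 * pi\<^sup>2 * t) (at t)"
    by (auto intro!: derivative_eq_intros)
  then have 1: "((\<lambda>t. l + 4 * pi\<^sup>2 * t\<^sup>2) has_vector_derivative 8 * pi\<^sup>2 * t) (at t)"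
    by (simp add: has_real_derivative_iff_has_vector_derivative)
  have 2: "((\<lambda>t. \<psi> (l + 4 * pi\<^sup>2 * t\<^sup>2)) has_vector_derivative (8 * pi\<^sup>2 * t) *\<^sub>R dir_deriv 1 \<psi> (l + 4 * pi\<^sup>2 * t\<^sup>2)) (at t)"
    using vector_diff_chain_at[OF 1 schwartz_has_vector_derivative[OF assms]] by (simp add: o_def)
  have 3: "((\<lambda>t. complex_of_real (t ^ n)) has_vector_derivative of_real (real n * t ^ (n - 1))) (at t)"
    by (intro has_vector_derivative_of_real) (auto intro!: derivative_eq_intros)
  from has_vector_derivative_mult[OF 3 2] show ?thesis
    unfolding radial_def[abs_def] by (simp add: scaleR_conv_of_real algebra_simps)
qed

lemma radial_continuous: "\<psi> \<in> schwartz \<Longrightarrow> continuous_on A (radial \<psi> n l)"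
  unfolding radial_def[abs_def]
  by (intro continuous_intros continuous_on_compose2[OF schwartz_continuous[of \<psi> UNIV]]) auto

section \<open>Periodic kernels of mean zero and Euler-Maclaurin summation\<close>

text \<open>Having a periodic primitive encodes mean zero over a period, in the form in which
  integration by parts uses it.\<close>

definition per0 :: "(real \<Rightarrow> real) \<Rightarrow> bool" where
  "per0 p \<longleftrightarrow> continuous_on UNIV p \<and> (\<forall>x. p (x + 1) = p x) \<and>
     (\<exists>P. (\<forall>x. (P has_real_derivative p x) (at x)) \<and> (\<forall>x. P (x + 1) = P x))"

lemma continuous_antiderivative:
  fixes f :: "real \<Rightarrow> real"
  assumes "continuous_on UNIV f"
  obtains F where "\<And>x. (F has_real_derivative f x) (at x)"
  using einterval_antiderivative[of "-\<infinity>" \<infinity> f] assms that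
  by (auto simp: continuous_on_eq_continuous_at has_real_derivative_iff_has_vector_derivative)

lemma periodic_antiderivative_increment:
  fixes p P :: "real \<Rightarrow> real"
  assumes "\<And>x. (P has_real_derivative p x) (at x)" "\<And>x. p (x + 1) = p x"
  shows "P (x + 1) - P x = P 1 - P 0"
proof -
  have "((\<lambda>x. P (x + 1) - P x) has_real_derivative 0) (at x)" for x
    using DERIV_diff[OF DERIV_shift[THEN iffD1, OF assms(1)[of "x + 1"]] assms(1)[of x]] assms(2)[of x]
    by (simp add: add.commute)
  from DERIV_isconst_all[OF allI[OF this], of x 0] show ?thesis by simp
qed

text \<open>Among the periodic primitives of p, the one of mean zero is obtained by subtracting the
  mean c; the class is thus closed under taking primitives.\<close>

lemma per0_antiderivative:
  assumes "per0 p"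
  obtains P where "per0 P" "\<And>x. (P has_real_derivative p x) (at x)"
proof -
  from assms obtain P where P: "\<And>x. (P has_real_derivative p x) (at x)" "\<And>x. P (x + 1) = P x"
    by (auto simp: per0_def)
  have cP: "continuous_on UNIV P" using P(1) DERIV_continuous_on has_field_derivative_at_within by blast
  obtain Q where Q: "\<And>x. (Q has_real_derivative P x) (at x)"
    using continuous_antiderivative[OF cP] by blast
  define c where "c = Q 1 - Q 0"
  have Qc: "Q (x + 1) - Q x = c" for x
    unfolding c_def by (rule periodic_antiderivative_increment[OF Q P(2)])
  have "per0 (\<lambda>x. P x - c)"
    unfolding per0_def
  proof (intro conjI exI[of _ "\<lambda>x. Q x - c * x"] allI)
    show "((\<lambda>x. Q x - c * x) has_real_derivative P x - c) (at x)" for x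
      by (auto intro!: derivative_eq_intros Q)
    show "Q (x + 1) - c * (x + 1) = Q x - c * x" for x
      using Qc[of x] by (simp add: algebra_simps)
  qed (use P in \<open>auto intro!: continuous_intros cP\<close>)
  moreover have "((\<lambda>x. P x - c) has_real_derivative p x) (at x)" for x
    by (auto intro!: derivative_eq_intros P)
  ultimately show ?thesis using that by blast
qed

lemma per0_bounded:
  assumes "per0 p"
  obtains B where "B > 0" "\<And>x. \<bar>p x\<bar> \<le> B"
proof -
  have "compact (p ` {0..1})"
    using assms by (intro compact_continuous_image) (auto simp: per0_def intro: continuous_on_subset)
  then have "bounded (p ` {0..1})" by (rule compact_imp_bounded)
  then obtain B where B: "B > 0" "\<forall>v\<in>p ` {0..1}. norm v \<le> B" unfolding bounded_pos by blast
  have "\<bar>p x\<bar> \<le> B" for x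
  proof -
    have "p x = p (frac x)"
      using periodic_int_shift[of p "frac x" "\<lfloor>x\<rfloor>"] assms by (simp add: per0_def frac_def)
    moreover have "frac x \<in> {0..1}" by (auto simp: frac_lt_1 less_imp_le)
    ultimately show ?thesis using B(2) by force
  qed
  then show ?thesis using that B(1) by blast
qed

lemma inverse_1_plus_scaled_square_le:
  fixes h s :: real
  assumes "0 < h" "h \<le> 1"
  shows "1 / (1 + (h * s)\<^sup>2) \<le> 1 / h\<^sup>2 * (1 / (1 + s\<^sup>2))"
proof -
  have "h\<^sup>2 \<le> 1" using assms by (simp add: power_le_one)
  then have "h\<^sup>2 * (1 + s\<^sup>2) \<le> 1 + (h * s)\<^sup>2" by (simp add: power_mult_distrib distrib_left)
  moreover have "0 < h\<^sup>2 * (1 + s\<^sup>2)" using assms by (intro mult_pos_pos) (auto simp: add_pos_nonneg)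
  ultimately have "1 / (1 + (h * s)\<^sup>2) \<le> 1 / (h\<^sup>2 * (1 + s\<^sup>2))" by (intro divide_left_mono mult_pos_pos) (auto simp: add_pos_nonneg)
  then show ?thesis by simp
qed

text \<open>The loss of h^-2 is the price for decay in s that is uniform in h; the two derivatives
  in the Euler-Maclaurin remainder later supply the compensating h^2.\<close>

lemma radial_scaled_bound:
  assumes "\<psi> \<in> schwartz"
  obtains C where "C > 0" "\<And>l h s. l \<ge> 0 \<Longrightarrow> 0 < h \<Longrightarrow> h \<le> 1 \<Longrightarrow>
    norm (radial \<psi> n l (h * s)) \<le> C / ((1 + l)\<^sup>2 * h\<^sup>2) * (1 / (1 + s\<^sup>2))"
proof -
  obtain C where C: "C > 0" "\<And>l t. l \<ge> 0 \<Longrightarrow> norm (radial \<psi> n l t) \<le> C / ((1 + l)\<^sup>2 * (1 + t\<^sup>2))"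
    using radial_bound'[OF assms] by blast
  have "norm (radial \<psi> n l (h * s)) \<le> C / ((1 + l)\<^sup>2 * h\<^sup>2) * (1 / (1 + s\<^sup>2))" if "l \<ge> 0" "0 < h" "h \<le> 1" for l h s
  proof -
    have "norm (radial \<psi> n l (h * s)) \<le> C / (1 + l)\<^sup>2 * (1 / (1 + (h * s)\<^sup>2))" using C(2)[OF that(1)] by simp
    also have "\<dots> \<le> C / (1 + l)\<^sup>2 * (1 / h\<^sup>2 * (1 / (1 + s\<^sup>2)))"
      using C(1) that by (intro mult_left_mono inverse_1_plus_scaled_square_le) auto
    finally show ?thesis by simp
  qed
  then show ?thesis using that C(1) by blast
qed

lemma per0_radial_integrable:
  assumes "continuous_on UNIV p" "\<And>x. \<bar>p x\<bar> \<le> B" "\<psi> \<in> schwartz" "l \<ge> 0" "0 < h" "h \<le> 1"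
  shows "integrable lborel (\<lambda>s. of_real (p s) * radial \<psi> n l (h * s))"
    "\<exists>C>0. \<forall>s. norm (of_real (p s) * radial \<psi> n l (h * s)) \<le> C / (1 + s\<^sup>2)"
proof -
  obtain C where C: "C > 0" "\<And>l h s. l \<ge> 0 \<Longrightarrow> 0 < h \<Longrightarrow> h \<le> 1 \<Longrightarrow>
    norm (radial \<psi> n l (h * s)) \<le> C / ((1 + l)\<^sup>2 * h\<^sup>2) * (1 / (1 + s\<^sup>2))"
    using radial_scaled_bound[OF assms(3), of n] by blast
  define D where "D = (\<bar>B\<bar> + 1) * (C / ((1 + l)\<^sup>2 * h\<^sup>2))"
  have D: "D > 0" unfolding D_def using C(1) assms(4,5) by (intro mult_pos_pos divide_pos_pos) auto
  have le: "norm (of_real (p s) * radial \<psi> n l (h * s)) \<le> D / (1 + s\<^sup>2)" for s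
  proof -
    have "norm (of_real (p s) * radial \<psi> n l (h * s)) \<le> (\<bar>B\<bar> + 1) * (C / ((1 + l)\<^sup>2 * h\<^sup>2) * (1 / (1 + s\<^sup>2)))"
      unfolding norm_mult norm_of_real using assms(2)[of s] C(2)[OF assms(4-6)]
      by (intro mult_mono) auto
    then show ?thesis by (simp add: D_def)
  qed
  then show "\<exists>C>0. \<forall>s. norm (of_real (p s) * radial \<psi> n l (h * s)) \<le> C / (1 + s\<^sup>2)" using D by blast
  have "continuous_on UNIV (\<lambda>s. of_real (p s) * radial \<psi> n l (h * s))"
    by (intro continuous_intros assms(1) continuous_on_compose2[OF radial_continuous[OF assms(3), of UNIV]]) auto
  then show "integrable lborel (\<lambda>s. of_real (p s) * radial \<psi> n l (h * s))"
    by (intro integrable_bound_1_plus_square[OF _ le] borel_measurable_continuous_onI)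
qed

text \<open>The kernel is replaced by its periodic primitive, which stays bounded, and the
  derivative falls on the slowly varying factor, where the chain rule yields h.\<close>

lemma per0_radial_by_parts:
  assumes p: "per0 p" and P: "per0 P" "\<And>x. (P has_real_derivative p x) (at x)"
    and \<psi>: "\<psi> \<in> schwartz" and l: "l \<ge> 0" and h: "0 < h" "h \<le> 1"
  shows "(LINT s|lborel. of_real (p s) * radial \<psi> n l (h * s)) =
    - of_real h * (of_nat n * (LINT s|lborel. of_real (P s) * radial \<psi> (n - 1) l (h * s))
      + of_real (8 * pi\<^sup>2) * (LINT s|lborel. of_real (P s) * radial (dir_deriv 1 \<psi>) (n + 1) l (h * s)))"
proof -
  note \<psi>' = schwartz_deriv[OF \<psi>]
  obtain B B' where B: "\<And>x. \<bar>p x\<bar> \<le> B" "\<And>x. \<bar>P x\<bar> \<le> B'"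
    using per0_bounded[OF p] per0_bounded[OF P(1)] by metis
  have cp: "continuous_on UNIV p" and cP: "continuous_on UNIV P" using p P by (auto simp: per0_def)
  define a b c where "a = (\<lambda>s. of_real (p s) * radial \<psi> n l (h * s))"
    and "b = (\<lambda>s. of_real (P s) * radial \<psi> (n - 1) l (h * s))"
    and "c = (\<lambda>s. of_real (P s) * radial (dir_deriv 1 \<psi>) (n + 1) l (h * s))"
  have int: "integrable lborel a" "integrable lborel b" "integrable lborel c"
    unfolding a_def b_def c_def
    by (rule per0_radial_integrable(1)[OF cp B(1) \<psi> l h] per0_radial_integrable(1)[OF cP B(2) \<psi> l h]
        per0_radial_integrable(1)[OF cP B(2) \<psi>' l h])+
  have cont: "continuous_on UNIV a" "continuous_on UNIV b" "continuous_on UNIV c"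
    unfolding a_def b_def c_def
    by (intro continuous_intros cp cP continuous_on_compose2[OF radial_continuous[OF \<psi>, of UNIV]]
        continuous_on_compose2[OF radial_continuous[OF \<psi>', of UNIV]]; simp)+
  have "(LINT s|lborel. a s + of_real h * (of_nat n * b s + of_real (8 * pi\<^sup>2) * c s)) = 0"
  proof (rule integral_derivative_eq_0[where f = "\<lambda>s. of_real (P s) * radial \<psi> n l (h * s)"])
    fix s
    have 1: "((\<lambda>s. complex_of_real (P s)) has_vector_derivative of_real (p s)) (at s)"
      by (intro has_vector_derivative_of_real P)
    have 2: "((\<lambda>s. h * s) has_vector_derivative h) (at s)"
      by (auto intro!: derivative_eq_intros simp flip: has_real_derivative_iff_has_vector_derivative)
    have 3: "((\<lambda>s. radial \<psi> n l (h * s)) has_vector_derivative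
        h *\<^sub>R (of_nat n * radial \<psi> (n - 1) l (h * s) + of_real (8 * pi\<^sup>2) * radial (dir_deriv 1 \<psi>) (n + 1) l (h * s))) (at s)"
      using vector_diff_chain_at[OF 2 radial_has_vector_derivative[OF \<psi>]] by (simp add: o_def)
    from has_vector_derivative_mult[OF 1 3]
    show "((\<lambda>s. of_real (P s) * radial \<psi> n l (h * s)) has_vector_derivative
        (a s + of_real h * (of_nat n * b s + of_real (8 * pi\<^sup>2) * c s))) (at s)"
      unfolding a_def b_def c_def scaleR_conv_of_real by (rule has_vector_derivative_eq_rhs) (simp add: algebra_simps)
  next
    show "continuous_on UNIV (\<lambda>s. a s + of_real h * (of_nat n * b s + of_real (8 * pi\<^sup>2) * c s))"
      by (intro continuous_intros cont)
    show "integrable lborel (\<lambda>s. a s + of_real h * (of_nat n * b s + of_real (8 * pi\<^sup>2) * c s))"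
      by (intro Bochner_Integration.integrable_add integrable_mult_right int)
    obtain C where "\<And>s. norm (of_real (P s) * radial \<psi> n l (h * s)) \<le> C / (1 + s\<^sup>2)"
      using per0_radial_integrable(2)[OF cP B(2) \<psi> l h] by blast
    then show "((\<lambda>s. of_real (P s) * radial \<psi> n l (h * s)) \<longlongrightarrow> 0) at_top"
      "((\<lambda>s. of_real (P s) * radial \<psi> n l (h * s)) \<longlongrightarrow> 0) at_bot"
      by (rule tendsto_0_1_plus_square)+
  qed
  also have "(LINT s|lborel. a s + of_real h * (of_nat n * b s + of_real (8 * pi\<^sup>2) * c s)) =
      (LINT s|lborel. a s) + of_real h * (of_nat n * (LINT s|lborel. b s) + of_real (8 * pi\<^sup>2) * (LINT s|lborel. c s))"
    using int by simp
  finally show ?thesis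
    unfolding a_def b_def c_def by (simp only: eq_neg_iff_add_eq_0 mult_minus_left)
qed

text \<open>Iterating the integration by parts gains one factor h each time. The kernel, \<psi> and
  n all change in a step, so the induction varies them; l enters only through the weight.\<close>

lemma per0_radial_small:
  assumes "per0 p" "\<psi> \<in> schwartz"
  shows "\<exists>C>0. \<forall>l\<ge>0. \<forall>h. 0 < h \<and> h \<le> 1 \<longrightarrow>
    norm (LINT s|lborel. of_real (p s) * radial \<psi> n l (h * s)) \<le> C * h ^ M / ((1 + l)\<^sup>2 * h\<^sup>2)"
  using assms
proof (induction M arbitrary: p \<psi> n)
  case 0
  obtain C where C: "C > 0" "\<And>l h s. l \<ge> 0 \<Longrightarrow> 0 < h \<Longrightarrow> h \<le> 1 \<Longrightarrow>
    norm (radial \<psi> n l (h * s)) \<le> C / ((1 + l)\<^sup>2 * h\<^sup>2) * (1 / (1 + s\<^sup>2))"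
    using radial_scaled_bound[OF 0(2), of n] by blast
  obtain B where B: "B > 0" "\<And>x. \<bar>p x\<bar> \<le> B" using per0_bounded[OF 0(1)] by blast
  have cp: "continuous_on UNIV p" using 0(1) by (simp add: per0_def)
  define K where "K = (LINT s|lborel. 1 / (1 + s\<^sup>2 :: real))"
  have K: "K \<ge> 0" unfolding K_def by (intro Bochner_Integration.integral_nonneg) auto
  have "norm (LINT s|lborel. of_real (p s) * radial \<psi> n l (h * s)) \<le> (B * C * (K + 1)) * h ^ 0 / ((1 + l)\<^sup>2 * h\<^sup>2)"
    if "l \<ge> 0" "0 < h" "h \<le> 1" for l h
  proof -
    have "norm (LINT s|lborel. of_real (p s) * radial \<psi> n l (h * s)) \<le> (LINT s|lborel. B * (C / ((1 + l)\<^sup>2 * h\<^sup>2)) * (1 / (1 + s\<^sup>2)))"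
    proof (rule Bochner_Integration.integral_norm_bound_integral)
      show "integrable lborel (\<lambda>s. of_real (p s) * radial \<psi> n l (h * s))"
        by (rule per0_radial_integrable(1)[OF cp B(2) 0(2) that])
      show "integrable lborel (\<lambda>s::real. B * (C / ((1 + l)\<^sup>2 * h\<^sup>2)) * (1 / (1 + s\<^sup>2)))"
        by (intro integrable_mult_right integrable_1_div_1_plus_square)
      show "norm (of_real (p s) * radial \<psi> n l (h * s)) \<le> B * (C / ((1 + l)\<^sup>2 * h\<^sup>2)) * (1 / (1 + s\<^sup>2))" for s
        unfolding norm_mult norm_of_real mult.assoc[of B] using B(1) by (intro mult_mono B(2) C(2)[OF that]) auto
    qed
    also have "\<dots> = B * (C / ((1 + l)\<^sup>2 * h\<^sup>2)) * K" unfolding K_def by (rule integral_mult_right_zero)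
    also have "\<dots> \<le> B * (C / ((1 + l)\<^sup>2 * h\<^sup>2)) * (K + 1)" using B C that by (intro mult_left_mono) auto
    finally show ?thesis by simp
  qed
  moreover have "B * C * (K + 1) > 0" using B C K by simp
  ultimately show ?case by blast
next
  case (Suc M)
  obtain P where P: "per0 P" "\<And>x. (P has_real_derivative p x) (at x)"
    using per0_antiderivative[OF Suc.prems(1)] by blast
  obtain C1 where C1: "C1 > 0" "\<And>l h. l \<ge> 0 \<Longrightarrow> 0 < h \<Longrightarrow> h \<le> 1 \<Longrightarrow>
      norm (LINT s|lborel. of_real (P s) * radial \<psi> (n - 1) l (h * s)) \<le> C1 * h ^ M / ((1 + l)\<^sup>2 * h\<^sup>2)"
    using Suc.IH[OF P(1) Suc.prems(2), of "n - 1"] by blast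
  obtain C2 where C2: "C2 > 0" "\<And>l h. l \<ge> 0 \<Longrightarrow> 0 < h \<Longrightarrow> h \<le> 1 \<Longrightarrow>
      norm (LINT s|lborel. of_real (P s) * radial (dir_deriv 1 \<psi>) (n + 1) l (h * s)) \<le> C2 * h ^ M / ((1 + l)\<^sup>2 * h\<^sup>2)"
    using Suc.IH[OF P(1) schwartz_deriv[OF Suc.prems(2)], of "n + 1"] by blast
  define C where "C = real n * C1 + 8 * pi\<^sup>2 * C2"
  have "norm (LINT s|lborel. of_real (p s) * radial \<psi> n l (h * s)) \<le> C * h ^ Suc M / ((1 + l)\<^sup>2 * h\<^sup>2)"
    if "l \<ge> 0" "0 < h" "h \<le> 1" for l h
  proof -
    define D where "D = h ^ M / ((1 + l)\<^sup>2 * h\<^sup>2)"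
    define X Y where "X = (LINT s|lborel. of_real (P s) * radial \<psi> (n - 1) l (h * s))"
      and "Y = (LINT s|lborel. of_real (P s) * radial (dir_deriv 1 \<psi>) (n + 1) l (h * s))"
    have "(LINT s|lborel. of_real (p s) * radial \<psi> n l (h * s)) = - of_real h * (of_nat n * X + of_real (8 * pi\<^sup>2) * Y)"
      unfolding X_def Y_def by (rule per0_radial_by_parts[OF Suc.prems(1) P Suc.prems(2) that])
    then have "norm (LINT s|lborel. of_real (p s) * radial \<psi> n l (h * s)) = h * norm (of_nat n * X + of_real (8 * pi\<^sup>2) * Y)"
      using that by (simp add: norm_mult)
    also have "\<dots> \<le> h * (norm (of_nat n * X) + norm (of_real (8 * pi\<^sup>2) * Y))"
      using that by (intro mult_left_mono norm_triangle_ineq) auto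
    also have "\<dots> = h * (real n * norm X + 8 * pi\<^sup>2 * norm Y)"
      unfolding norm_mult norm_of_real norm_of_nat by simp
    also have "\<dots> \<le> h * (real n * (C1 * D) + 8 * pi\<^sup>2 * (C2 * D))"
      using C1(2)[OF that] C2(2)[OF that] that unfolding X_def Y_def D_def
      by (intro mult_left_mono add_mono) auto
    also have "\<dots> = C * h ^ Suc M / ((1 + l)\<^sup>2 * h\<^sup>2)"
      by (simp add: C_def D_def algebra_simps add_divide_distrib)
    finally show ?thesis .
  qed
  moreover have "C > 0" unfolding C_def using C1 C2 by (intro add_nonneg_pos) auto
  ultimately show ?case by blast
qed

text \<open>The periodic second Bernoulli polynomial (up to the factor \<open>1/2\<close>); \<open>arccos (cos (2 \<pi> x)) / (2 \<pi>)\<close>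
  is the distance of \<open>x\<close> to the integers.\<close>

definition bernoulli2 :: "real \<Rightarrow> real" where
  "bernoulli2 x = 1 / 12 - (let d = arccos (cos (2 * pi * x)) / (2 * pi) in d * (1 - d) / 2)"

lemma bernoulli2_unit:
  assumes "0 \<le> x" "x \<le> 1"
  shows "bernoulli2 x = 1 / 12 - x * (1 - x) / 2"
proof (cases "x \<le> 1 / 2")
  case True
  then have "2 * pi * x \<le> pi" by simp
  then have "arccos (cos (2 * pi * x)) = 2 * pi * x" using assms by (intro arccos_cos) auto
  then show ?thesis by (simp add: bernoulli2_def)
next
  case False
  have "cos (2 * pi * x) = cos (2 * pi * (1 - x))" by (simp add: right_diff_distrib cos_diff)
  moreover have "arccos (cos (2 * pi * (1 - x))) = 2 * pi * (1 - x)"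
  proof (rule arccos_cos)
    have "pi * (2 * (1 - x)) \<le> pi * 1" using False by (intro mult_left_mono) auto
    then show "2 * pi * (1 - x) \<le> pi" by simp
  qed (use assms in auto)
  ultimately have "arccos (cos (2 * pi * x)) / (2 * pi) = 1 - x" by simp
  then show ?thesis by (simp add: bernoulli2_def mult.commute)
qed

lemma bernoulli2_periodic: "bernoulli2 (x + 1) = bernoulli2 x"
  by (simp add: bernoulli2_def distrib_left)

lemma continuous_bernoulli2: "continuous_on UNIV bernoulli2"
  unfolding bernoulli2_def[abs_def] Let_def
  by (intro continuous_intros continuous_on_arccos) auto

text \<open>On [0,1] a primitive is x/12 - x^2/4 + x^3/6 up to a constant, with equal values at 0
  and 1. The constant 1/12 in \<open>bernoulli2\<close> is what makes the mean vanish.\<close>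

lemma per0_bernoulli2: "per0 bernoulli2"
proof -
  obtain Q where Q: "\<And>x. (Q has_real_derivative bernoulli2 x) (at x)"
    using continuous_antiderivative[OF continuous_bernoulli2] by blast
  define G where "G = (\<lambda>x. Q x - (x / 12 - x ^ 2 / 4 + x ^ 3 / 6))"
  have dG: "(G has_real_derivative bernoulli2 x - (1 / 12 - x / 2 + x\<^sup>2 / 2)) (at x)" for x
  proof -
    have "((\<lambda>x. x / 12 - x ^ 2 / 4 + x ^ 3 / 6) has_real_derivative (1 / 12 - x / 2 + x\<^sup>2 / 2)) (at x)"
      by (auto intro!: derivative_eq_intros)
    from DERIV_diff[OF Q this] show ?thesis unfolding G_def .
  qed
  have "G 1 = G 0"
  proof (rule DERIV_isconst_end[where f = G and a = 0 and b = 1])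
    show "continuous_on {0..1} G" by (rule DERIV_continuous_on) (rule has_field_derivative_at_within[OF dG])
    show "(G has_real_derivative 0) (at x)" if "0 < x" "x < 1" for x
    proof -
      have "bernoulli2 x - (1 / 12 - x / 2 + x\<^sup>2 / 2) = 0"
        using that by (simp add: bernoulli2_unit right_diff_distrib diff_divide_distrib power2_eq_square)
      then show ?thesis using dG[of x] by simp
    qed
  qed simp
  then have "Q 1 - Q 0 = 0" by (simp add: G_def)
  then have "Q (x + 1) = Q x" for x
    using periodic_antiderivative_increment[of Q bernoulli2 x, OF Q bernoulli2_periodic] by simp
  then show ?thesis
    unfolding per0_def using continuous_bernoulli2 bernoulli2_periodic Q by blast
qed

text \<open>On the unit interval q'' = 1, so V = q T' - q' T is a primitive of q T'' - T. The
  endpoint values q = 1/12 and q' = 1/2, -1/2 give the boundary terms.\<close>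

lemma euler_maclaurin_unit:
  fixes T T' T'' :: "real \<Rightarrow> complex" and m :: int
  assumes "\<And>s. (T has_vector_derivative T' s) (at s)" "\<And>s. (T' has_vector_derivative T'' s) (at s)"
  shows "((\<lambda>s. of_real (bernoulli2 s) * T'' s - T s) has_integral
    ((T' (of_int m + 1) - T' (of_int m)) / 12 - (T (of_int m + 1) + T (of_int m)) / 2)) {of_int m..of_int m + 1}"
proof -
  define q where "q s = 1 / 12 - (s - of_int m) * (1 - (s - of_int m)) / 2" for s :: real
  define V where "V s = of_real (q s) * T' s - of_real (s - of_int m - 1 / 2) * T s" for s
  have dV: "(V has_vector_derivative (of_real (q s) * T'' s - T s)) (at s)" for s
  proof -
    have "(q has_real_derivative (s - of_int m - 1 / 2)) (at s)"
      unfolding q_def by (auto intro!: derivative_eq_intros simp: field_simps)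
    then have 1: "((\<lambda>s. complex_of_real (q s)) has_vector_derivative of_real (s - of_int m - 1 / 2)) (at s)"
      by (rule has_vector_derivative_of_real)
    have 2: "((\<lambda>s. complex_of_real (s - of_int m - 1 / 2)) has_vector_derivative of_real 1) (at s)"
      by (intro has_vector_derivative_of_real) (auto intro!: derivative_eq_intros)
    from has_vector_derivative_diff[OF has_vector_derivative_mult[OF 1 assms(2)] has_vector_derivative_mult[OF 2 assms(1)]]
    show ?thesis unfolding V_def[abs_def] by (rule has_vector_derivative_eq_rhs) simp
  qed
  have h: "((\<lambda>s. of_real (q s) * T'' s - T s) has_integral (V (of_int m + 1) - V (of_int m))) {of_int m..of_int m + 1}"
    by (rule fundamental_theorem_of_calculus) (simp, rule has_vector_derivative_at_within[OF dV])
  have q01: "q (of_int m + 1) = 1 / 12" "q (of_int m) = 1 / 12" by (simp_all add: q_def)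
  have V1: "V (of_int m + 1) = T' (of_int m + 1) / 12 - T (of_int m + 1) / 2"
    and V0: "V (of_int m) = T' (of_int m) / 12 + T (of_int m) / 2"
    unfolding V_def q01 by simp_all
  have V: "V (of_int m + 1) - V (of_int m) =
      (T' (of_int m + 1) - T' (of_int m)) / 12 - (T (of_int m + 1) + T (of_int m)) / 2"
    unfolding V1 V0 by (simp add: add_divide_distrib diff_divide_distrib)
  have eq: "of_real (q s) * T'' s - T s = of_real (bernoulli2 s) * T'' s - T s" if "s \<in> {of_int m..of_int m + 1}" for s
  proof -
    have "bernoulli2 s = bernoulli2 (s - of_int m)"
      using periodic_int_shift[of bernoulli2 "s - of_int m" m, OF bernoulli2_periodic] by simp
    also have "\<dots> = q s" using that by (subst bernoulli2_unit) (auto simp: q_def)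
    finally show ?thesis by simp
  qed
  show ?thesis using has_integral_eq[OF eq h] unfolding V .
qed

text \<open>Each step adds a unit interval at both ends: the terms with T' telescope, and the two
  halves of T at an inner point join to a full summand.\<close>

lemma euler_maclaurin_symmetric:
  fixes T T' T'' :: "real \<Rightarrow> complex" and M :: nat
  assumes "\<And>s. (T has_vector_derivative T' s) (at s)" "\<And>s. (T' has_vector_derivative T'' s) (at s)"
  shows "((\<lambda>s. of_real (bernoulli2 s) * T'' s - T s) has_integral
    ((T' (real M) - T' (- real M)) / 12 + (T (real M) + T (- real M)) / 2 - (\<Sum>m\<in>{- int M..int M}. T (of_int m)))) {- real M..real M}"
proof (induction M)
  case 0
  show ?case using has_integral_refl(2)[of "\<lambda>s. of_real (bernoulli2 s) * T'' s - T s" "0::real"] by simp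
next
  case (Suc M)
  let ?f = "\<lambda>s. of_real (bernoulli2 s) * T'' s - T s"
  have 1: "(?f has_integral ((T' (real M + 1) - T' (real M)) / 12 - (T (real M + 1) + T (real M)) / 2)) {real M..real M + 1}"
    using euler_maclaurin_unit[of T T' T'' "int M", OF assms] by simp
  have 2: "(?f has_integral ((T' (- real M) - T' (- real M - 1)) / 12 - (T (- real M) + T (- real M - 1)) / 2)) {- real M - 1..- real M}"
    using euler_maclaurin_unit[of T T' T'' "- int M - 1", OF assms] by simp
  have "{- int (Suc M)..int (Suc M)} = insert (int M + 1) (insert (- int M - 1) {- int M..int M})" by auto
  then have s: "(\<Sum>m\<in>{- int (Suc M)..int (Suc M)}. T (of_int m)) =
      T (real M + 1) + (T (- real M - 1) + (\<Sum>m\<in>{- int M..int M}. T (of_int m)))"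
    by simp
  have "- real M - 1 \<le> - real M" "- real M \<le> real M" "- real M - 1 \<le> real M" "real M \<le> real M + 1" by simp_all
  note comb = has_integral_combine[OF this(3,4) has_integral_combine[OF this(1,2) 2 Suc.IH] 1]
  have r: "real (Suc M) = real M + 1" "- (real M + 1) = - real M - 1" by simp_all
  show ?case
    unfolding s r by (rule has_integral_eq_rhs[OF comb]) (simp add: field_simps)
qed

lemma LINT_symmetric_intervals:
  fixes f :: "real \<Rightarrow> complex"
  assumes "integrable lborel f"
  shows "(\<lambda>M. integral {- real M..real M} f) \<longlonglongrightarrow> (LINT s|lborel. f s)"
proof -
  note [measurable] = borel_measurable_integrable[OF assms]
  have "integral {- real M..real M} f = (LINT s|lborel. indicator {- real M..real M} s *\<^sub>R f s)" for M
  proof -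
    have "set_integrable lborel {- real M..real M} f"
      unfolding set_integrable_def using assms by (intro integrable_mult_indicator) auto
    then show ?thesis using set_borel_integral_eq_integral(2) by (metis set_lebesgue_integral_def)
  qed
  moreover have "(\<lambda>M. LINT s|lborel. indicator {- real M..real M} s *\<^sub>R f s) \<longlonglongrightarrow> (LINT s|lborel. f s)"
  proof (rule integral_dominated_convergence[where w = "\<lambda>s. norm (f s)"])
    show "AE s in lborel. (\<lambda>M. indicator {- real M..real M} s *\<^sub>R f s) \<longlonglongrightarrow> f s"
    proof (rule AE_I2)
      fix s
      obtain K :: nat where K: "\<bar>s\<bar> < real K" using reals_Archimedean2 by blast
      have "\<forall>\<^sub>F M in sequentially. indicator {- real M..real M} s *\<^sub>R f s = f s"
        using eventually_ge_at_top[of K]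
      proof eventually_elim
        case (elim M)
        then have "s \<in> {- real M..real M}" using K by auto
        then show ?case by simp
      qed
      then show "(\<lambda>M. indicator {- real M..real M} s *\<^sub>R f s) \<longlonglongrightarrow> f s" by (rule tendsto_eventually)
    qed
    show "AE s in lborel. norm (indicator {- real M..real M} s *\<^sub>R f s) \<le> norm (f s)" for M
      by (auto simp: indicator_def)
  qed (use assms in auto)
  ultimately show ?thesis by simp
qed

lemma summable_on_int_inverse_square: "(\<lambda>m::int. 1 / (1 + (real_of_int m)\<^sup>2)) summable_on UNIV"
proof -
  have s: "summable (\<lambda>n. norm (1 / (1 + (real n)\<^sup>2)))"
  proof (rule summable_comparison_test)
    show "summable (\<lambda>n. 1 / (real n)\<^sup>2)" using inverse_power_summable[of 2, where 'a = real] by (simp add: inverse_eq_divide)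
    show "\<exists>N. \<forall>n\<ge>N. norm (norm (1 / (1 + (real n)\<^sup>2))) \<le> 1 / (real n)\<^sup>2"
      by (intro exI[of _ 1]) (auto intro!: divide_left_mono mult_pos_pos simp: add_pos_nonneg)
  qed
  then have 1: "(\<lambda>n. 1 / (1 + (real n)\<^sup>2)) summable_on UNIV" by (rule norm_summable_imp_summable_on)
  have "summable (\<lambda>n. norm (1 / (1 + (real (Suc n))\<^sup>2)))" using s by (subst summable_Suc_iff)
  then have 2: "(\<lambda>n. 1 / (1 + (real (Suc n))\<^sup>2)) summable_on UNIV" by (rule norm_summable_imp_summable_on)
  have "(\<lambda>m::int. 1 / (1 + (real_of_int m)\<^sup>2)) summable_on range int"
    using 1 by (subst summable_on_reindex) (auto simp: o_def)
  moreover have "(\<lambda>m::int. 1 / (1 + (real_of_int m)\<^sup>2)) summable_on range (\<lambda>n. - int (Suc n))"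
  proof -
    have "(real_of_int (- int (Suc n)))\<^sup>2 = (real (Suc n))\<^sup>2" for n
      by (simp only: of_int_minus of_int_of_nat_eq power2_minus)
    then show ?thesis using 2 by (subst summable_on_reindex) (auto simp only: o_def inj_on_def)
  qed
  moreover have "range int \<union> range (\<lambda>n. - int (Suc n)) = UNIV"
  proof -
    have "m \<in> range int \<union> range (\<lambda>n. - int (Suc n))" for m
      by (cases m) auto
    then show ?thesis by blast
  qed
  ultimately show ?thesis using summable_on_union[of "\<lambda>m::int. 1 / (1 + (real_of_int m)\<^sup>2)" "range int"] by metis
qed

lemma infsum_int_symmetric_limit:
  fixes f :: "int \<Rightarrow> complex"
  assumes "f summable_on UNIV"
  shows "(\<lambda>M. \<Sum>m\<in>{- int M..int M}. f m) \<longlonglongrightarrow> infsum f UNIV"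
proof -
  have "(sum f \<longlongrightarrow> infsum f UNIV) (finite_subsets_at_top UNIV)"
    using has_sum_infsum[OF assms] by (simp add: has_sum_def)
  moreover have "filterlim (\<lambda>M. {- int M..int M}) (finite_subsets_at_top UNIV) sequentially"
    unfolding filterlim_finite_subsets_at_top
  proof (intro allI impI)
    fix X :: "int set" assume "finite X \<and> X \<subseteq> UNIV"
    then have fin: "finite (abs ` X)" by simp
    show "\<forall>\<^sub>F M in sequentially. finite {- int M..int M} \<and> X \<subseteq> {- int M..int M} \<and> {- int M..int M} \<subseteq> UNIV"
      using eventually_ge_at_top[of "nat (Max (insert 0 (abs ` X)))"]
    proof eventually_elim
      case (elim M)
      have "m \<in> {- int M..int M}" if "m \<in> X" for m
      proof -
        have "\<bar>m\<bar> \<le> Max (insert 0 (abs ` X))" using fin that by (intro Max_ge) auto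
        then show ?thesis unfolding atLeastAtMost_iff using elim by linarith
      qed
      then show ?case by blast
    qed
  qed
  ultimately show ?thesis by (rule filterlim_compose)
qed

lemma radial_int_summable:
  assumes "\<psi> \<in> schwartz" "l \<ge> 0" "0 < h" "h \<le> 1"
  shows "(\<lambda>m::int. norm (radial \<psi> n l (h * of_int m))) summable_on UNIV"
proof -
  obtain C where C: "C > 0" "\<And>l h s. l \<ge> 0 \<Longrightarrow> 0 < h \<Longrightarrow> h \<le> 1 \<Longrightarrow>
    norm (radial \<psi> n l (h * s)) \<le> C / ((1 + l)\<^sup>2 * h\<^sup>2) * (1 / (1 + s\<^sup>2))"
    using radial_scaled_bound[OF assms(1), of n] by blast
  show ?thesis
  proof (rule summable_on_comparison_test)
    show "(\<lambda>m::int. C / ((1 + l)\<^sup>2 * h\<^sup>2) * (1 / (1 + (real_of_int m)\<^sup>2))) summable_on UNIV"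
      by (intro summable_on_cmult_right summable_on_int_inverse_square)
    show "norm (radial \<psi> n l (h * of_int m)) \<le> C / ((1 + l)\<^sup>2 * h\<^sup>2) * (1 / (1 + (real_of_int m)\<^sup>2))" for m
      by (rule C(2)[OF assms(2-4)])
  qed auto
qed

lemma radial_scaled_has_vector_derivative:
  assumes "\<psi> \<in> schwartz"
  shows "((\<lambda>s. radial \<psi> n l (h * s)) has_vector_derivative
    of_real h * (of_nat n * radial \<psi> (n - 1) l (h * s) + of_real (8 * pi\<^sup>2) * radial (dir_deriv 1 \<psi>) (n + 1) l (h * s))) (at s)"
proof -
  have "((\<lambda>s. h * s) has_vector_derivative h) (at s)"
    by (auto intro!: derivative_eq_intros simp flip: has_real_derivative_iff_has_vector_derivative)
  from vector_diff_chain_at[OF this radial_has_vector_derivative[OF assms]] show ?thesis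
    by (simp add: o_def scaleR_conv_of_real)
qed

text \<open>As the symmetric interval grows, all boundary terms vanish by decay. The factor 8 pi^2
  h^2 comes from differentiating \<psi>(l + 4 pi^2 h^2 s^2) twice in s.\<close>

lemma euler_maclaurin_radial:
  assumes \<psi>: "\<psi> \<in> schwartz" and l: "l \<ge> 0" and h: "0 < h" "h \<le> 1"
  shows "infsum (\<lambda>m::int. radial \<psi> 0 l (h * of_int m)) UNIV = (LINT s|lborel. radial \<psi> 0 l (h * s))
    - of_real (8 * pi\<^sup>2 * h\<^sup>2) * ((LINT s|lborel. of_real (bernoulli2 s) * radial (dir_deriv 1 \<psi>) 0 l (h * s))
      + of_real (8 * pi\<^sup>2) * (LINT s|lborel. of_real (bernoulli2 s) * radial (dir_deriv 1 (dir_deriv 1 \<psi>)) 2 l (h * s)))"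
proof -
  let ?\<psi>' = "dir_deriv 1 \<psi>" and ?\<psi>'' = "dir_deriv 1 (dir_deriv 1 \<psi>)"
  note \<psi>' = schwartz_deriv[OF \<psi>] and \<psi>'' = schwartz_deriv[OF schwartz_deriv[OF \<psi>]]
  define T where "T = (\<lambda>s. radial \<psi> 0 l (h * s))"
  define T' where "T' = (\<lambda>s. of_real (8 * pi\<^sup>2 * h) * radial ?\<psi>' 1 l (h * s))"
  define T'' where "T'' = (\<lambda>s. of_real (8 * pi\<^sup>2 * h\<^sup>2) * (radial ?\<psi>' 0 l (h * s) + of_real (8 * pi\<^sup>2) * radial ?\<psi>'' 2 l (h * s)))"
  have dT: "(T has_vector_derivative T' s) (at s)" for s
    unfolding T_def T'_def
    by (rule has_vector_derivative_eq_rhs[OF radial_scaled_has_vector_derivative[OF \<psi>]]) simp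
  have dT': "(T' has_vector_derivative T'' s) (at s)" for s
    unfolding T'_def T''_def
    by (rule has_vector_derivative_eq_rhs[OF has_vector_derivative_mult_right[OF radial_scaled_has_vector_derivative[OF \<psi>']]])
       (simp add: power2_eq_square numeral_2_eq_2)
  have one: "continuous_on UNIV (\<lambda>s::real. 1::real)" "\<And>s::real. \<bar>1::real\<bar> \<le> 1" by auto
  obtain B where B: "\<And>s. \<bar>bernoulli2 s\<bar> \<le> B" using per0_bounded[OF per0_bernoulli2] by blast
  have iT: "integrable lborel T"
    using per0_radial_integrable(1)[OF one \<psi> l h, of 0] by (simp add: T_def)
  have i1: "integrable lborel (\<lambda>s. of_real (bernoulli2 s) * radial ?\<psi>' 0 l (h * s))"
    by (rule per0_radial_integrable(1)[OF continuous_bernoulli2 B \<psi>' l h])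
  have i2: "integrable lborel (\<lambda>s. of_real (bernoulli2 s) * radial ?\<psi>'' 2 l (h * s))"
    by (rule per0_radial_integrable(1)[OF continuous_bernoulli2 B \<psi>'' l h])
  have e2: "of_real (bernoulli2 s) * T'' s = of_real (8 * pi\<^sup>2 * h\<^sup>2) * (of_real (bernoulli2 s) * radial ?\<psi>' 0 l (h * s)
      + of_real (8 * pi\<^sup>2) * (of_real (bernoulli2 s) * radial ?\<psi>'' 2 l (h * s)))" for s
    by (simp only: T''_def distrib_left mult_ac)
  have iT'': "integrable lborel (\<lambda>s. of_real (bernoulli2 s) * T'' s)"
    unfolding e2 by (intro Bochner_Integration.integrable_add integrable_mult_right i1 i2)
  have I: "(LINT s|lborel. of_real (bernoulli2 s) * T'' s) = of_real (8 * pi\<^sup>2 * h\<^sup>2) *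
      ((LINT s|lborel. of_real (bernoulli2 s) * radial ?\<psi>' 0 l (h * s))
      + of_real (8 * pi\<^sup>2) * (LINT s|lborel. of_real (bernoulli2 s) * radial ?\<psi>'' 2 l (h * s)))"
    unfolding e2 using i1 i2 by simp
  obtain C1 where "\<And>s. norm (T s) \<le> C1 / (1 + s\<^sup>2)"
    using per0_radial_integrable(2)[OF one \<psi> l h, of 0] by (auto simp: T_def)
  note limT = tendsto_0_1_plus_square[OF this]
  obtain C2 where "\<And>s. norm (radial ?\<psi>' 1 l (h * s)) \<le> C2 / (1 + s\<^sup>2)"
    using per0_radial_integrable(2)[OF one \<psi>' l h, of 1] by auto
  note limr = tendsto_0_1_plus_square[OF this]
  have limT': "(T' \<longlongrightarrow> 0) at_top" "(T' \<longlongrightarrow> 0) at_bot"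
    unfolding T'_def using limr by (auto intro: tendsto_mult_right_zero)
  have top: "filterlim real at_top sequentially" and bot: "filterlim (\<lambda>M. - real M) at_bot sequentially"
    by (auto simp: filterlim_real_sequentially filterlim_uminus_at_bot)
  let ?S = "\<lambda>M. \<Sum>m\<in>{- int M..int M}. T (of_int m)"
  have "(\<lambda>m::int. T (of_int m)) summable_on UNIV"
    unfolding T_def by (rule abs_summable_summable[OF radial_int_summable[OF \<psi> l h]])
  then have S: "?S \<longlonglongrightarrow> infsum (\<lambda>m::int. T (of_int m)) UNIV" by (rule infsum_int_symmetric_limit)
  have "(\<lambda>M. (T' (real M) - T' (- real M)) / 12 + (T (real M) + T (- real M)) / 2 - ?S M) \<longlonglongrightarrow>
      (0 - 0) / 12 + (0 + 0) / 2 - infsum (\<lambda>m::int. T (of_int m)) UNIV"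
    by (intro tendsto_intros S filterlim_compose[OF limT(1) top] filterlim_compose[OF limT(2) bot]
        filterlim_compose[OF limT'(1) top] filterlim_compose[OF limT'(2) bot]) auto
  moreover have "(\<lambda>M. integral {- real M..real M} (\<lambda>s. of_real (bernoulli2 s) * T'' s - T s)) \<longlonglongrightarrow>
      (LINT s|lborel. of_real (bernoulli2 s) * T'' s - T s)"
    by (intro LINT_symmetric_intervals Bochner_Integration.integrable_diff iT iT'')
  ultimately have *: "(LINT s|lborel. of_real (bernoulli2 s) * T'' s - T s) = (0 - 0) / 12 + (0 + 0) / 2 - infsum (\<lambda>m::int. T (of_int m)) UNIV"
    unfolding integral_unique[OF euler_maclaurin_symmetric[OF dT dT']] by (intro LIMSEQ_unique)
  have d: "(LINT s|lborel. of_real (bernoulli2 s) * T'' s - T s) = (LINT s|lborel. of_real (bernoulli2 s) * T'' s) - (LINT s|lborel. T s)"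
    by (rule Bochner_Integration.integral_diff[OF iT'' iT])
  have "infsum (\<lambda>m::int. T (of_int m)) UNIV = - (LINT s|lborel. of_real (bernoulli2 s) * T'' s - T s)"
    unfolding * by simp
  also have "\<dots> = (LINT s|lborel. T s) - (LINT s|lborel. of_real (bernoulli2 s) * T'' s)"
    unfolding d by (rule minus_diff_eq)
  finally have "infsum (\<lambda>m::int. T (of_int m)) UNIV = (LINT s|lborel. T s) - (LINT s|lborel. of_real (bernoulli2 s) * T'' s)" .
  then show ?thesis unfolding I by (simp only: T_def)
qed

text \<open>The h^2 of the Euler-Maclaurin remainder cancels the h^-2 in
  \<open>per0_radial_small\<close>, leaving an arbitrary power of h, uniformly in l.\<close>

lemma radial_sum_asymptotics:
  assumes \<psi>: "\<psi> \<in> schwartz"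
  shows "\<exists>C>0. \<forall>l\<ge>0. \<forall>h. 0 < h \<and> h \<le> 1 \<longrightarrow>
    norm (infsum (\<lambda>m::int. radial \<psi> 0 l (h * of_int m)) UNIV - (LINT s|lborel. radial \<psi> 0 l (h * s))) \<le> C * h ^ M / (1 + l)\<^sup>2"
proof -
  obtain C1 where C1: "C1 > 0" "\<And>l h. l \<ge> 0 \<Longrightarrow> 0 < h \<Longrightarrow> h \<le> 1 \<Longrightarrow>
      norm (LINT s|lborel. of_real (bernoulli2 s) * radial (dir_deriv 1 \<psi>) 0 l (h * s)) \<le> C1 * h ^ M / ((1 + l)\<^sup>2 * h\<^sup>2)"
    using per0_radial_small[OF per0_bernoulli2 schwartz_deriv[OF \<psi>], of 0 M] by blast
  obtain C2 where C2: "C2 > 0" "\<And>l h. l \<ge> 0 \<Longrightarrow> 0 < h \<Longrightarrow> h \<le> 1 \<Longrightarrow>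
      norm (LINT s|lborel. of_real (bernoulli2 s) * radial (dir_deriv 1 (dir_deriv 1 \<psi>)) 2 l (h * s)) \<le> C2 * h ^ M / ((1 + l)\<^sup>2 * h\<^sup>2)"
    using per0_radial_small[OF per0_bernoulli2 schwartz_deriv[OF schwartz_deriv[OF \<psi>]], of 2 M] by blast
  define C where "C = 8 * pi\<^sup>2 * (C1 + 8 * pi\<^sup>2 * C2)"
  have "norm (infsum (\<lambda>m::int. radial \<psi> 0 l (h * of_int m)) UNIV - (LINT s|lborel. radial \<psi> 0 l (h * s))) \<le> C * h ^ M / (1 + l)\<^sup>2"
    if "l \<ge> 0" "0 < h" "h \<le> 1" for l h
  proof -
    define X Y where "X = (LINT s|lborel. of_real (bernoulli2 s) * radial (dir_deriv 1 \<psi>) 0 l (h * s))"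
      and "Y = (LINT s|lborel. of_real (bernoulli2 s) * radial (dir_deriv 1 (dir_deriv 1 \<psi>)) 2 l (h * s))"
    define D where "D = h ^ M / ((1 + l)\<^sup>2 * h\<^sup>2)"
    have X: "norm X \<le> C1 * D" and Y: "norm Y \<le> C2 * D"
      using C1(2)[OF that] C2(2)[OF that] by (simp_all add: X_def Y_def D_def)
    have "infsum (\<lambda>m::int. radial \<psi> 0 l (h * of_int m)) UNIV - (LINT s|lborel. radial \<psi> 0 l (h * s)) =
        - (of_real (8 * pi\<^sup>2 * h\<^sup>2) * (X + of_real (8 * pi\<^sup>2) * Y))"
      unfolding euler_maclaurin_radial[OF \<psi> that] X_def Y_def by simp
    then have "norm (infsum (\<lambda>m::int. radial \<psi> 0 l (h * of_int m)) UNIV - (LINT s|lborel. radial \<psi> 0 l (h * s))) =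
        8 * pi\<^sup>2 * h\<^sup>2 * norm (X + of_real (8 * pi\<^sup>2) * Y)"
      by (simp only: norm_minus_cancel norm_mult norm_of_real) simp
    also have "\<dots> \<le> 8 * pi\<^sup>2 * h\<^sup>2 * (norm X + norm (of_real (8 * pi\<^sup>2) * Y))"
      by (intro mult_left_mono norm_triangle_ineq) auto
    also have "norm (of_real (8 * pi\<^sup>2) * Y) = 8 * pi\<^sup>2 * norm Y"
      unfolding norm_mult norm_of_real by simp
    also have "8 * pi\<^sup>2 * h\<^sup>2 * (norm X + 8 * pi\<^sup>2 * norm Y) \<le> 8 * pi\<^sup>2 * h\<^sup>2 * (C1 * D + 8 * pi\<^sup>2 * (C2 * D))"
      using X Y by (intro mult_left_mono add_mono) auto
    also have "\<dots> = C * (h\<^sup>2 * D)" by (simp add: C_def algebra_simps)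
    also have "h\<^sup>2 * D = h ^ M / (1 + l)\<^sup>2" using that by (simp add: D_def)
    finally show ?thesis by simp
  qed
  moreover have "C > 0" unfolding C_def using C1 C2 by (intro mult_pos_pos add_pos_pos) auto
  ultimately show ?thesis by blast
qed

section \<open>The leading coefficient\<close>

text \<open>The oscillator energies divided by N; the same numbers are the frequencies in the
  expansion of 1/sin(2 pi w), which is why the two sides of the theorem match level by
  level.\<close>

definition landau_level :: "nat \<Rightarrow> real" where
  "landau_level j = 2 * pi * (2 * real j + 1)"

lemma landau_level_ge: "real j \<le> landau_level j" "0 \<le> landau_level j"
proof -
  have "1 * real j \<le> (4 * pi) * real j" using pi_gt3 by (intro mult_right_mono) auto
  then show "real j \<le> landau_level j" by (simp add: landau_level_def distrib_left) (use pi_gt_zero in linarith)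
  then show "0 \<le> landau_level j" by linarith
qed

lemma inverse_landau_level_le: "1 / (1 + landau_level j)\<^sup>2 \<le> 1 / (1 + real j)\<^sup>2"
  using landau_level_ge[of j] by (intro divide_left_mono power_mono mult_pos_pos zero_less_power) auto

lemma summable_inverse_Suc_square: "summable (\<lambda>j. C / (1 + real j)\<^sup>2)"
proof -
  have "summable (\<lambda>n. 1 / (real n)\<^sup>2)" using inverse_power_summable[of 2, where 'a = real] by (simp add: inverse_eq_divide)
  then have "summable (\<lambda>n. 1 / (real (Suc n))\<^sup>2)" by (subst summable_Suc_iff)
  from summable_mult[OF this, of C] show ?thesis by (simp add: add.commute)
qed

lemma integrable_damping:
  assumes "\<epsilon> > 0"
  shows "integrable lborel (\<lambda>s. exp (- (\<epsilon> * (l + 4 * pi\<^sup>2 * s\<^sup>2))))"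
    "(LINT s|lborel. exp (- (\<epsilon> * (l + 4 * pi\<^sup>2 * s\<^sup>2)))) = exp (- (\<epsilon> * l)) * (LINT s|lborel. exp (- (\<epsilon> * (4 * pi\<^sup>2 * s\<^sup>2))))"
proof -
  have e: "exp (- (\<epsilon> * (l + 4 * pi\<^sup>2 * s\<^sup>2))) = exp (- (\<epsilon> * l)) * exp (- (\<epsilon> * (4 * pi\<^sup>2 * s\<^sup>2)))" for s
    unfolding exp_add[symmetric] by (simp add: distrib_left)
  have "integrable lborel (\<lambda>s::real. s ^ 0 * exp (- (4 * pi\<^sup>2 * \<epsilon>) * s\<^sup>2))"
    using assms by (intro integrable_gaussian_power) auto
  then have "integrable lborel (\<lambda>s. exp (- (\<epsilon> * (4 * pi\<^sup>2 * s\<^sup>2))))"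
    by (simp add: mult_ac)
  then show "integrable lborel (\<lambda>s. exp (- (\<epsilon> * (l + 4 * pi\<^sup>2 * s\<^sup>2))))"
    unfolding e by (rule integrable_mult_right)
  show "(LINT s|lborel. exp (- (\<epsilon> * (l + 4 * pi\<^sup>2 * s\<^sup>2)))) = exp (- (\<epsilon> * l)) * (LINT s|lborel. exp (- (\<epsilon> * (4 * pi\<^sup>2 * s\<^sup>2))))"
    unfolding e by (rule integral_mult_right_zero)
qed

definition level_kernel :: "nat \<Rightarrow> complex \<Rightarrow> complex" where
  "level_kernel j w = (LINT s|lborel. exp (\<i> * w * of_real (landau_level j + 4 * pi\<^sup>2 * s\<^sup>2)))"

text \<open>The product of -2 sqrt(pi) e^(-i pi/4) from the inverse root and -2i from the inverse
  sine.\<close>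

abbreviation kappa :: complex where
  "kappa \<equiv> 4 * \<i> * of_real (sqrt pi) * cis (- pi / 4)"

text \<open>With e = e^(2 pi i w), |e| < 1 in the upper half-plane and 1/sin(2 pi w) = -2i e / (1 -
  e^2), so only odd powers of e occur: e^(2j + 1) is the exponential at
  \<open>landau_level j\<close>.\<close>

lemma kernel_sums:
  assumes w: "Im w > 0"
  shows "(\<lambda>j. kappa * level_kernel j w) sums (1 / (uhp_sqrt w * sin (2 * of_real pi * w)))"
proof -
  define e where "e = exp (\<i> * (2 * of_real pi * w))"
  define I where "I = (LINT s|lborel. exp (\<i> * w * of_real (4 * pi\<^sup>2 * s\<^sup>2)))"
  have e0: "e \<noteq> 0" by (simp add: e_def)
  have "norm e = exp (- (2 * pi * Im w))" by (simp add: e_def norm_exp_eq_Re)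
  then have "norm e < 1" using w by simp
  then have e1: "norm (e\<^sup>2) < 1" by (simp add: norm_power power_less_one_iff)
  then have e2: "e\<^sup>2 \<noteq> 1" by auto
  have k: "level_kernel j w = e * (e\<^sup>2) ^ j * I" for j
  proof -
    have "exp (\<i> * w * of_real (landau_level j)) = e ^ (2 * j + 1)"
      unfolding e_def exp_of_nat_mult[symmetric] by (simp add: landau_level_def algebra_simps)
    also have "\<dots> = e * (e\<^sup>2) ^ j" by (simp add: power_mult)
    finally have *: "exp (\<i> * w * of_real (landau_level j)) = e * (e\<^sup>2) ^ j" .
    have "exp (\<i> * w * of_real (landau_level j + 4 * pi\<^sup>2 * s\<^sup>2)) = e * (e\<^sup>2) ^ j * exp (\<i> * w * of_real (4 * pi\<^sup>2 * s\<^sup>2))" for s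
      unfolding of_real_add distrib_left exp_add * ..
    then show ?thesis unfolding level_kernel_def I_def by (simp only: integral_mult_right_zero)
  qed
  have s: "sin (2 * of_real pi * w) = (e - 1 / e) / (2 * \<i>)"
    unfolding sin_exp_eq e_def by (simp add: exp_minus inverse_eq_divide)
  have si: "1 / sin (2 * of_real pi * w) = - 2 * \<i> * (e / (1 - e\<^sup>2))"
  proof -
    have s': "sin (2 * of_real pi * w) = (e\<^sup>2 - 1) / e / (2 * \<i>)"
      unfolding s using e0 by (simp add: diff_divide_distrib power2_eq_square)
    have "e\<^sup>2 - 1 \<noteq> 0" using e2 by simp
    then have p: "(2 * \<i> * (e / (e\<^sup>2 - 1))) * sin (2 * of_real pi * w) = 1" unfolding s' using e0 by simp
    then have "sin (2 * of_real pi * w) \<noteq> 0" by auto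
    from eq_divide_imp[OF this p] have "1 / sin (2 * of_real pi * w) = 2 * \<i> * (e / (e\<^sup>2 - 1))" ..
    also have "e / (e\<^sup>2 - 1) = - (e / (1 - e\<^sup>2))"
    proof -
      have "e\<^sup>2 - 1 = - (1 - e\<^sup>2)" by simp
      then show ?thesis by (simp only: divide_minus_right)
    qed
    finally show ?thesis by simp
  qed
  have "(\<lambda>j. (e\<^sup>2) ^ j) sums (1 / (1 - e\<^sup>2))" by (rule geometric_sums[OF e1])
  from sums_mult[OF this, of "kappa * e * I"]
  have "(\<lambda>j. kappa * level_kernel j w) sums (kappa * e * I * (1 / (1 - e\<^sup>2)))"
    by (simp only: k mult_ac)
  also have "kappa * e * I * (1 / (1 - e\<^sup>2)) = (- (2 * sqrt pi * cis (- pi / 4)) * I) * (- 2 * \<i> * (e / (1 - e\<^sup>2)))"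
    by simp
  also have "\<dots> = (1 / uhp_sqrt w) * (1 / sin (2 * of_real pi * w))"
    unfolding si inverse_uhp_sqrt[OF w] I_def ..
  also have "\<dots> = 1 / (uhp_sqrt w * sin (2 * of_real pi * w))" by simp
  finally show ?thesis .
qed

text \<open>The contribution of level j with damping \<epsilon>, the imaginary part of w; at
  \<epsilon> = 0 it is the coefficient of the trace asymptotics.\<close>

definition level_integral :: "(real \<Rightarrow> complex) \<Rightarrow> nat \<Rightarrow> real \<Rightarrow> complex" where
  "level_integral \<phi> j \<epsilon> = (LINT s|lborel. radial \<phi> 0 (landau_level j) s * of_real (exp (- (\<epsilon> * (landau_level j + 4 * pi\<^sup>2 * s\<^sup>2)))))"

lemma exp_upper_half_plane:
  "exp (\<i> * (of_real t + \<i> * of_real \<epsilon>) * of_real L) = cis (t * L) * of_real (exp (- (\<epsilon> * L)))"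
proof -
  have "\<i> * (of_real t + \<i> * of_real \<epsilon>) * of_real L = \<i> * of_real (t * L) + of_real (- (\<epsilon> * L))"
    by (simp add: complex_eq_iff algebra_simps)
  then show ?thesis by (simp only: exp_add cis_conv_exp exp_of_real)
qed

lemma level_kernel_norm_le:
  assumes "\<epsilon> > 0"
  shows "norm (level_kernel j (of_real t + \<i> * of_real \<epsilon>)) \<le>
    exp (- (\<epsilon> * landau_level j)) * (LINT s|lborel. exp (- (\<epsilon> * (4 * pi\<^sup>2 * s\<^sup>2))))"
proof -
  have "norm (level_kernel j (of_real t + \<i> * of_real \<epsilon>)) \<le>
      (LINT s|lborel. norm (cis (t * (landau_level j + 4 * pi\<^sup>2 * s\<^sup>2)) * complex_of_real (exp (- (\<epsilon> * (landau_level j + 4 * pi\<^sup>2 * s\<^sup>2))))))"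
    unfolding level_kernel_def exp_upper_half_plane by (rule integral_norm_bound)
  also have "\<dots> = (LINT s|lborel. exp (- (\<epsilon> * (landau_level j + 4 * pi\<^sup>2 * s\<^sup>2))))"
    by (simp only: norm_mult norm_cis norm_of_real abs_exp_cancel mult_1_left)
  finally show ?thesis unfolding integrable_damping(2)[OF assms] .
qed

lemma level_kernel_measurable: "(\<lambda>t. level_kernel j (of_real t + \<i> * of_real \<epsilon>)) \<in> borel_measurable borel"
proof -
  have [measurable]: "cis \<in> borel_measurable borel"
    by (intro borel_measurable_continuous_onI continuous_intros)
  show ?thesis unfolding level_kernel_def exp_upper_half_plane by measurable
qed

text \<open>The damping makes the double integral absolutely convergent; after Fubini the integral
  over t is Fourier inversion at the energy L s.\<close>

lemma fourier_level_kernel: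
  fixes \<phi> :: "real \<Rightarrow> complex"
  assumes \<phi>: "\<phi> \<in> schwartz" and \<epsilon>: "\<epsilon> > 0"
  shows "(LINT t|lborel. fourier \<phi> t * level_kernel j (of_real t + \<i> * of_real \<epsilon>)) = of_real (2 * pi) * level_integral \<phi> j \<epsilon>"
proof -
  note [measurable] = fourier_measurable[OF \<phi>]
  have [measurable]: "cis \<in> borel_measurable borel"
    by (intro borel_measurable_continuous_onI continuous_intros)
  define L where "L s = landau_level j + 4 * pi\<^sup>2 * s\<^sup>2" for s
  have [measurable]: "L \<in> borel_measurable borel" unfolding L_def by measurable
  have iL: "integrable lborel (\<lambda>s. exp (- (\<epsilon> * L s)))" unfolding L_def by (rule integrable_damping(1)[OF \<epsilon>])
  define F where "F = (\<lambda>t s. fourier \<phi> t * (cis (t * L s) * complex_of_real (exp (- (\<epsilon> * L s)))))"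
  have mF: "(\<lambda>(t, s). F t s) \<in> borel_measurable (lborel \<Otimes>\<^sub>M lborel)"
    unfolding F_def by measurable
  have nF: "norm (F t s) = norm (fourier \<phi> t) * exp (- (\<epsilon> * L s))" for t s
    unfolding F_def by (simp only: norm_mult norm_cis norm_of_real abs_exp_cancel mult_1_left)
  have int: "integrable (lborel \<Otimes>\<^sub>M lborel) (\<lambda>(t, s). F t s)"
  proof (rule lborel_pair.Fubini_integrable[OF mF])
    show "integrable lborel (\<lambda>t. LINT s|lborel. norm ((\<lambda>(t, s). F t s) (t, s)))"
      unfolding prod.case nF integral_mult_right_zero
      by (intro integrable_mult_left integrable_norm fourier_integrable \<phi>)
    have "integrable lborel (\<lambda>s. F t s)" for t
    proof (rule Bochner_Integration.integrable_bound)
      show "integrable lborel (\<lambda>s. norm (fourier \<phi> t) * exp (- (\<epsilon> * L s)))"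
        by (rule integrable_mult_right[OF iL])
      show "AE s in lborel. norm (F t s) \<le> norm (norm (fourier \<phi> t) * exp (- (\<epsilon> * L s)))"
        unfolding nF by simp
    qed (simp add: F_def)
    then show "AE t in lborel. integrable lborel (\<lambda>s. (\<lambda>(t, s). F t s) (t, s))" by simp
  qed
  have "(LINT t|lborel. fourier \<phi> t * level_kernel j (of_real t + \<i> * of_real \<epsilon>)) = (LINT t|lborel. LINT s|lborel. F t s)"
    unfolding level_kernel_def exp_upper_half_plane F_def L_def by (simp only: integral_mult_right_zero)
  also have "\<dots> = (LINT s|lborel. LINT t|lborel. F t s)"
    by (rule lborel_pair.Fubini_integral[OF int, symmetric])
  also have "\<dots> = (LINT s|lborel. of_real (2 * pi) * (\<phi> (L s) * of_real (exp (- (\<epsilon> * L s)))))"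
  proof (intro Bochner_Integration.integral_cong refl)
    fix s
    have "(LINT t|lborel. F t s) = (LINT t|lborel. fourier \<phi> t * cis (L s * t)) * of_real (exp (- (\<epsilon> * L s)))"
      unfolding F_def mult.assoc[symmetric] integral_mult_left_zero by (simp only: mult.commute[of "L s"])
    then show "(LINT t|lborel. F t s) = of_real (2 * pi) * (\<phi> (L s) * of_real (exp (- (\<epsilon> * L s))))"
      unfolding fourier_inversion[OF \<phi>] mult.assoc .
  qed
  also have "\<dots> = of_real (2 * pi) * level_integral \<phi> j \<epsilon>"
    unfolding integral_mult_right_zero level_integral_def radial_def L_def by simp
  finally show ?thesis .
qed

text \<open>The first bound makes the sum over j converge uniformly in \<epsilon>. For the second,
  |exp(-\<epsilon> L) - 1| <= \<epsilon> (1 + L), and 1 + L is absorbed by the extra factor in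
  \<open>radial_bound\<close>.\<close>

lemma level_integral_bounds:
  assumes "\<phi> \<in> schwartz"
  obtains C where "\<And>j \<epsilon>. \<epsilon> \<ge> 0 \<Longrightarrow> norm (level_integral \<phi> j \<epsilon>) \<le> C / (1 + real j)\<^sup>2"
    "\<And>j \<epsilon>. \<epsilon> \<ge> 0 \<Longrightarrow> norm (level_integral \<phi> j \<epsilon> - level_integral \<phi> j 0) \<le> \<epsilon> * (C / (1 + real j)\<^sup>2)"
proof -
  obtain D where D: "D > 0" "\<And>l t. l \<ge> 0 \<Longrightarrow> norm (radial \<phi> 0 l t) * (1 + (l + 4 * pi\<^sup>2 * t\<^sup>2)) \<le> D / ((1 + l)\<^sup>2 * (1 + t\<^sup>2))"
    using radial_bound[OF assms] by blast
  define K where "K = (LINT s|lborel. 1 / (1 + s\<^sup>2 :: real))"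
  have K: "K \<ge> 0" unfolding K_def by (intro Bochner_Integration.integral_nonneg) auto
  define G where "G = (\<lambda>j \<epsilon> s. radial \<phi> 0 (landau_level j) s * complex_of_real (exp (- (\<epsilon> * (landau_level j + 4 * pi\<^sup>2 * s\<^sup>2)))))"
  have mG: "G j \<epsilon> \<in> borel_measurable borel" for j \<epsilon>
    unfolding G_def by (intro borel_measurable_continuous_onI continuous_intros radial_continuous assms)
  have base: "norm (radial \<phi> 0 (landau_level j) s) * (1 + (landau_level j + 4 * pi\<^sup>2 * s\<^sup>2)) \<le> D / (1 + real j)\<^sup>2 * (1 / (1 + s\<^sup>2))" for j s
  proof -
    have "norm (radial \<phi> 0 (landau_level j) s) * (1 + (landau_level j + 4 * pi\<^sup>2 * s\<^sup>2)) \<le> D / ((1 + landau_level j)\<^sup>2 * (1 + s\<^sup>2))"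
      by (rule D(2)[OF landau_level_ge(2)])
    also have "\<dots> = D * (1 / (1 + landau_level j)\<^sup>2) * (1 / (1 + s\<^sup>2))" by simp
    also have "\<dots> \<le> D * (1 / (1 + real j)\<^sup>2) * (1 / (1 + s\<^sup>2))"
      using D(1) by (intro mult_right_mono mult_left_mono inverse_landau_level_le) auto
    finally show ?thesis by simp
  qed
  have L0: "0 \<le> landau_level j + 4 * pi\<^sup>2 * s\<^sup>2" for j s
    using landau_level_ge(2)[of j] by simp
  have base0: "norm (radial \<phi> 0 (landau_level j) s) \<le> D / (1 + real j)\<^sup>2 * (1 / (1 + s\<^sup>2))" for j s
  proof -
    have "norm (radial \<phi> 0 (landau_level j) s) * 1 \<le> norm (radial \<phi> 0 (landau_level j) s) * (1 + (landau_level j + 4 * pi\<^sup>2 * s\<^sup>2))"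
      using L0[of j s] by (intro mult_left_mono) auto
    then show ?thesis using base[of j s] by linarith
  qed
  have nG: "norm (G j \<epsilon> s) \<le> D / (1 + real j)\<^sup>2 * (1 / (1 + s\<^sup>2))" if "\<epsilon> \<ge> 0" for j \<epsilon> s
  proof -
    have "exp (- (\<epsilon> * (landau_level j + 4 * pi\<^sup>2 * s\<^sup>2))) \<le> 1" using mult_nonneg_nonneg[OF that L0[of j s]] by simp
    then have "norm (G j \<epsilon> s) \<le> norm (radial \<phi> 0 (landau_level j) s) * 1"
      unfolding G_def norm_mult norm_of_real abs_exp_cancel by (intro mult_left_mono) auto
    then show ?thesis using base0[of j s] by linarith
  qed
  have iG: "integrable lborel (G j \<epsilon>)" if "\<epsilon> \<ge> 0" for j \<epsilon>
    using nG[OF that, of j] by (intro integrable_bound_1_plus_square[where C = "D / (1 + real j)\<^sup>2"] mG) simp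
  have lG: "level_integral \<phi> j \<epsilon> = (LINT s|lborel. G j \<epsilon> s)" for j \<epsilon>
    by (simp add: level_integral_def G_def)
  have iK: "integrable lborel (\<lambda>s::real. c * (1 / (1 + s\<^sup>2)))" for c
    by (intro integrable_mult_right integrable_1_div_1_plus_square)
  have 1: "norm (level_integral \<phi> j \<epsilon>) \<le> D * K / (1 + real j)\<^sup>2" if "\<epsilon> \<ge> 0" for j \<epsilon>
  proof -
    have "norm (LINT s|lborel. G j \<epsilon> s) \<le> (LINT s|lborel. D / (1 + real j)\<^sup>2 * (1 / (1 + s\<^sup>2)))"
      by (rule Bochner_Integration.integral_norm_bound_integral[OF iG[OF that] iK nG[OF that]])
    also have "\<dots> = D / (1 + real j)\<^sup>2 * K" unfolding K_def by (rule integral_mult_right_zero)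
    finally show ?thesis by (simp add: lG)
  qed
  have 2: "norm (level_integral \<phi> j \<epsilon> - level_integral \<phi> j 0) \<le> \<epsilon> * (D * K / (1 + real j)\<^sup>2)" if e: "\<epsilon> \<ge> 0" for j \<epsilon>
  proof -
    have "level_integral \<phi> j \<epsilon> - level_integral \<phi> j 0 = (LINT s|lborel. G j \<epsilon> s - G j 0 s)"
      unfolding lG by (rule Bochner_Integration.integral_diff[OF iG[OF e] iG[OF order_refl], symmetric])
    moreover have "norm (LINT s|lborel. G j \<epsilon> s - G j 0 s) \<le> (LINT s|lborel. \<epsilon> * (D / (1 + real j)\<^sup>2) * (1 / (1 + s\<^sup>2)))"
    proof (rule Bochner_Integration.integral_norm_bound_integral[OF Bochner_Integration.integrable_diff[OF iG[OF e] iG[OF order_refl]] iK])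
      fix s
      define L where "L = landau_level j + 4 * pi\<^sup>2 * s\<^sup>2"
      have eL: "0 \<le> \<epsilon> * L" using e L0[of j s] by (simp add: L_def)
      have "1 - exp (- (\<epsilon> * L)) \<le> \<epsilon> * L" using exp_ge_add_one_self[of "- (\<epsilon> * L)"] by linarith
      moreover have "exp (- (\<epsilon> * L)) \<le> 1" using eL by simp
      ultimately have ab: "\<bar>exp (- (\<epsilon> * L)) - 1\<bar> \<le> \<epsilon> * (1 + L)" using e by (simp add: distrib_left)
      have "G j \<epsilon> s - G j 0 s = radial \<phi> 0 (landau_level j) s * of_real (exp (- (\<epsilon> * L)) - 1)"
        by (simp add: G_def L_def right_diff_distrib)
      then have "norm (G j \<epsilon> s - G j 0 s) = norm (radial \<phi> 0 (landau_level j) s) * \<bar>exp (- (\<epsilon> * L)) - 1\<bar>"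
        by (simp only: norm_mult norm_of_real)
      also have "\<dots> \<le> norm (radial \<phi> 0 (landau_level j) s) * (\<epsilon> * (1 + L))"
        by (intro mult_left_mono ab) auto
      also have "\<dots> = \<epsilon> * (norm (radial \<phi> 0 (landau_level j) s) * (1 + L))" by (simp only: mult_ac)
      also have "\<dots> \<le> \<epsilon> * (D / (1 + real j)\<^sup>2 * (1 / (1 + s\<^sup>2)))"
        unfolding L_def by (intro mult_left_mono base e)
      finally show "norm (G j \<epsilon> s - G j 0 s) \<le> \<epsilon> * (D / (1 + real j)\<^sup>2) * (1 / (1 + s\<^sup>2))" by (simp only: mult.assoc)
    qed
    moreover have "(LINT s|lborel. \<epsilon> * (D / (1 + real j)\<^sup>2) * (1 / (1 + s\<^sup>2))) = \<epsilon> * (D / (1 + real j)\<^sup>2) * K"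
      unfolding K_def by (rule integral_mult_right_zero)
    ultimately show ?thesis by simp
  qed
  show ?thesis using that[of "D * K"] 1 2 by blast
qed

lemma level_integral_summable:
  assumes "\<phi> \<in> schwartz" "\<epsilon> \<ge> 0"
  shows "summable (\<lambda>j. level_integral \<phi> j \<epsilon>)"
proof -
  obtain C where C: "\<And>j \<epsilon>. \<epsilon> \<ge> 0 \<Longrightarrow> norm (level_integral \<phi> j \<epsilon>) \<le> C / (1 + real j)\<^sup>2"
    by (rule level_integral_bounds[OF assms(1)]) (rule that)
  show ?thesis
    by (rule summable_comparison_test'[OF summable_inverse_Suc_square[of C]]) (rule C[OF assms(2)])
qed

text \<open>For fixed \<epsilon> > 0 the kernels decay like exp(-\<epsilon>
  \<open>landau_level j\<close>), geometrically in j and uniformly in t, so the series may be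
  integrated term by term.\<close>

lemma damped_pairing:
  fixes \<phi> :: "real \<Rightarrow> complex"
  assumes \<phi>: "\<phi> \<in> schwartz" and \<epsilon>: "\<epsilon> > 0"
  shows "(LINT t|lborel. fourier \<phi> t / (uhp_sqrt (of_real t + \<i> * of_real \<epsilon>) * sin (2 * of_real pi * (of_real t + \<i> * of_real \<epsilon>)))) =
    kappa * of_real (2 * pi) * (\<Sum>j. level_integral \<phi> j \<epsilon>)"
proof -
  define K where "K = (LINT s|lborel. exp (- (\<epsilon> * (4 * pi\<^sup>2 * s\<^sup>2))))"
  define f where "f = (\<lambda>j t. kappa * (fourier \<phi> t * level_kernel j (of_real t + \<i> * of_real \<epsilon>)))"
  define c where "c = norm kappa * K"
  have K0: "K \<ge> 0" unfolding K_def by (intro Bochner_Integration.integral_nonneg) auto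
  have nf: "norm (f j t) \<le> c * exp (- (\<epsilon> * landau_level j)) * norm (fourier \<phi> t)" for j t
  proof -
    have "norm (f j t) = norm kappa * (norm (fourier \<phi> t) * norm (level_kernel j (of_real t + \<i> * of_real \<epsilon>)))"
      unfolding f_def norm_mult ..
    also have "\<dots> \<le> norm kappa * (norm (fourier \<phi> t) * (exp (- (\<epsilon> * landau_level j)) * K))"
      unfolding K_def by (intro mult_left_mono level_kernel_norm_le \<epsilon>) auto
    finally show ?thesis by (simp only: c_def mult_ac)
  qed
  have mf: "f j \<in> borel_measurable borel" for j
    unfolding f_def by (intro borel_measurable_times fourier_measurable[OF \<phi>] level_kernel_measurable borel_measurable_const)
  have intf: "integrable lborel (\<lambda>t. norm (fourier \<phi> t))" by (intro integrable_norm fourier_integrable \<phi>)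
  have int: "integrable lborel (f j)" for j
  proof (rule Bochner_Integration.integrable_bound)
    show "integrable lborel (\<lambda>t. c * exp (- (\<epsilon> * landau_level j)) * norm (fourier \<phi> t))"
      by (rule integrable_mult_right[OF intf])
    show "AE t in lborel. norm (f j t) \<le> norm (c * exp (- (\<epsilon> * landau_level j)) * norm (fourier \<phi> t))"
      using order_trans[OF nf abs_ge_self] by simp
  qed (use mf in simp)
  have se: "summable (\<lambda>j. exp (- (\<epsilon> * landau_level j)))"
  proof -
    have "exp (- (\<epsilon> * landau_level j)) = exp (- (2 * pi * \<epsilon>)) * exp (- (4 * pi * \<epsilon>)) ^ j" for j
      unfolding exp_of_nat_mult[symmetric] exp_add[symmetric] by (simp add: landau_level_def algebra_simps)
    moreover have "summable (\<lambda>j. exp (- (2 * pi * \<epsilon>)) * exp (- (4 * pi * \<epsilon>)) ^ j)"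
      using \<epsilon> by (intro summable_mult summable_geometric) simp
    ultimately show ?thesis by simp
  qed
  have sums: "(\<lambda>j. f j t) sums (fourier \<phi> t / (uhp_sqrt (of_real t + \<i> * of_real \<epsilon>) * sin (2 * of_real pi * (of_real t + \<i> * of_real \<epsilon>))))" for t
  proof -
    have "Im (of_real t + \<i> * of_real \<epsilon>) > 0" using \<epsilon> by simp
    from sums_mult[OF kernel_sums[OF this], of "fourier \<phi> t"] show ?thesis
      unfolding f_def times_divide_eq_right mult_1_right by (simp only: mult.left_commute)
  qed
  have "(LINT t|lborel. fourier \<phi> t / (uhp_sqrt (of_real t + \<i> * of_real \<epsilon>) * sin (2 * of_real pi * (of_real t + \<i> * of_real \<epsilon>)))) =
      (LINT t|lborel. (\<Sum>j. f j t))"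
    by (intro Bochner_Integration.integral_cong refl sums_unique[OF sums])
  also have "\<dots> = (\<Sum>j. LINT t|lborel. f j t)"
  proof (rule integral_suminf[OF int])
    have "summable (\<lambda>j. norm (f j t))" for t
    proof (rule summable_comparison_test)
      show "summable (\<lambda>j. c * exp (- (\<epsilon> * landau_level j)) * norm (fourier \<phi> t))"
        by (intro summable_mult2 summable_mult se)
      show "\<exists>N. \<forall>j\<ge>N. norm (norm (f j t)) \<le> c * exp (- (\<epsilon> * landau_level j)) * norm (fourier \<phi> t)"
        using nf by (intro exI[of _ 0]) simp
    qed
    then show "AE t in lborel. summable (\<lambda>j. norm (f j t))" by simp
    show "summable (\<lambda>j. LINT t|lborel. norm (f j t))"
    proof (rule summable_comparison_test)
      show "summable (\<lambda>j. c * exp (- (\<epsilon> * landau_level j)) * (LINT t|lborel. norm (fourier \<phi> t)))"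
        by (intro summable_mult2 summable_mult se)
      have "norm (LINT t|lborel. norm (f j t)) \<le> c * exp (- (\<epsilon> * landau_level j)) * (LINT t|lborel. norm (fourier \<phi> t))" for j
      proof -
        have "norm (LINT t|lborel. norm (f j t)) = (LINT t|lborel. norm (f j t))"
          by (simp add: Bochner_Integration.integral_nonneg)
        also have "\<dots> \<le> (LINT t|lborel. c * exp (- (\<epsilon> * landau_level j)) * norm (fourier \<phi> t))"
          by (intro integral_mono integrable_norm int integrable_mult_right[OF intf] nf)
        also have "\<dots> = c * exp (- (\<epsilon> * landau_level j)) * (LINT t|lborel. norm (fourier \<phi> t))"
          by (rule integral_mult_right_zero)
        finally show ?thesis .
      qed
      then show "\<exists>N. \<forall>j\<ge>N. norm (LINT t|lborel. norm (f j t)) \<le> c * exp (- (\<epsilon> * landau_level j)) * (LINT t|lborel. norm (fourier \<phi> t))"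
        by blast
    qed
  qed
  also have "(\<lambda>j. LINT t|lborel. f j t) = (\<lambda>j. kappa * of_real (2 * pi) * level_integral \<phi> j \<epsilon>)"
    unfolding f_def integral_mult_right_zero fourier_level_kernel[OF \<phi> \<epsilon>] by (simp only: mult.assoc)
  also have "(\<Sum>j. kappa * of_real (2 * pi) * level_integral \<phi> j \<epsilon>) = kappa * of_real (2 * pi) * (\<Sum>j. level_integral \<phi> j \<epsilon>)"
    using \<epsilon> by (intro suminf_mult level_integral_summable \<phi>) simp
  finally show ?thesis .
qed

lemma level_integral_sum_tendsto:
  assumes \<phi>: "\<phi> \<in> schwartz"
  shows "((\<lambda>\<epsilon>. \<Sum>j. level_integral \<phi> j \<epsilon>) \<longlongrightarrow> (\<Sum>j. level_integral \<phi> j 0)) (at_right 0)"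
proof -
  obtain C where C: "\<And>j \<epsilon>. \<epsilon> \<ge> 0 \<Longrightarrow> norm (level_integral \<phi> j \<epsilon> - level_integral \<phi> j 0) \<le> \<epsilon> * (C / (1 + real j)\<^sup>2)"
    by (rule level_integral_bounds[OF \<phi>]) (rule that)
  define S where "S = (\<Sum>j. C / (1 + real j)\<^sup>2)"
  have le: "norm ((\<Sum>j. level_integral \<phi> j \<epsilon>) - (\<Sum>j. level_integral \<phi> j 0)) \<le> \<epsilon> * S" if "\<epsilon> > 0" for \<epsilon>
  proof -
    have e: "\<epsilon> \<ge> 0" using that by simp
    have s: "summable (\<lambda>j. \<epsilon> * (C / (1 + real j)\<^sup>2))" by (intro summable_mult summable_inverse_Suc_square)
    have sn: "summable (\<lambda>j. norm (level_integral \<phi> j \<epsilon> - level_integral \<phi> j 0))"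
      by (rule summable_comparison_test'[OF s]) (use C[OF e] in simp)
    have "(\<Sum>j. level_integral \<phi> j \<epsilon>) - (\<Sum>j. level_integral \<phi> j 0) = (\<Sum>j. level_integral \<phi> j \<epsilon> - level_integral \<phi> j 0)"
      by (intro suminf_diff level_integral_summable \<phi> e order_refl)
    also have "norm \<dots> \<le> (\<Sum>j. norm (level_integral \<phi> j \<epsilon> - level_integral \<phi> j 0))"
      by (rule summable_norm[OF sn])
    also have "\<dots> \<le> (\<Sum>j. \<epsilon> * (C / (1 + real j)\<^sup>2))"
      by (rule suminf_le[OF C[OF e] sn s])
    also have "\<dots> = \<epsilon> * S" unfolding S_def by (intro suminf_mult summable_inverse_Suc_square)
    finally show ?thesis .
  qed
  have "((\<lambda>\<epsilon>. (\<Sum>j. level_integral \<phi> j \<epsilon>) - (\<Sum>j. level_integral \<phi> j 0)) \<longlongrightarrow> 0) (at_right 0)"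
  proof (rule Lim_null_comparison)
    show "\<forall>\<^sub>F \<epsilon> in at_right 0. norm ((\<Sum>j. level_integral \<phi> j \<epsilon>) - (\<Sum>j. level_integral \<phi> j 0)) \<le> \<epsilon> * S"
      using eventually_at_right_less[of "0::real"] by eventually_elim (rule le)
    have "((\<lambda>\<epsilon>. \<epsilon> * S) \<longlongrightarrow> 0 * S) (at_right 0)" by (intro tendsto_intros)
    then show "((\<lambda>\<epsilon>. \<epsilon> * S) \<longlongrightarrow> 0) (at_right 0)" by simp
  qed
  then show ?thesis by (rule LIM_zero_cancel)
qed

text \<open>The limit \<epsilon> -> 0 is taken after the term-by-term evaluation, where the sum
  depends continuously on \<epsilon>; all constants then multiply to 1.\<close>

lemma f_0_eq:
  fixes \<phi> :: "real \<Rightarrow> complex"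
  assumes \<phi>: "\<phi> \<in> schwartz"
  shows "f_0 \<phi> = (\<Sum>j. LINT s|lborel. radial \<phi> 0 (landau_level j) s)"
proof -
  define S where "S = (\<Sum>j. level_integral \<phi> j 0)"
  have "((\<lambda>\<epsilon>. kappa * of_real (2 * pi) * (\<Sum>j. level_integral \<phi> j \<epsilon>)) \<longlongrightarrow> kappa * of_real (2 * pi) * S) (at_right 0)"
    unfolding S_def by (intro tendsto_mult tendsto_const level_integral_sum_tendsto[OF \<phi>])
  moreover have "\<forall>\<^sub>F \<epsilon> in at_right 0. kappa * of_real (2 * pi) * (\<Sum>j. level_integral \<phi> j \<epsilon>) =
      (LINT t|lborel. fourier \<phi> t / (uhp_sqrt (of_real t + \<i> * of_real \<epsilon>) * sin (2 * of_real pi * (of_real t + \<i> * of_real \<epsilon>))))"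
    using eventually_at_right_less[of "0::real"] by eventually_elim (rule damped_pairing[OF \<phi>, symmetric])
  ultimately have "((\<lambda>\<epsilon>. LINT t|lborel. fourier \<phi> t / (uhp_sqrt (of_real t + \<i> * of_real \<epsilon>) * sin (2 * of_real pi * (of_real t + \<i> * of_real \<epsilon>))))
      \<longlongrightarrow> kappa * of_real (2 * pi) * S) (at_right 0)"
    by (rule Lim_transform_eventually)
  then have d: "dist_pairing (fourier \<phi>) = kappa * of_real (2 * pi) * S"
    unfolding dist_pairing_def by (intro tendsto_Lim trivial_limit_at_right_real)
  have "exp (- (1 / 4) * of_real pi * \<i>) = cis (- pi / 4)" by (simp add: cis_conv_exp mult.commute)
  moreover have "cis (- pi / 4) * cis (- pi / 4) = - \<i>"
  proof -
    have "cis (- pi / 4) * cis (- pi / 4) = cis (- (pi / 2))" unfolding cis_mult by (simp add: field_simps)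
    also have "\<dots> = - \<i>" by (simp add: complex_eq_iff)
    finally show ?thesis .
  qed
  moreover have "pi powr (3 / 2) = pi * sqrt pi"
  proof -
    have "pi powr (1 + 1 / 2) = pi powr 1 * pi powr (1 / 2)" by (rule powr_add)
    then show ?thesis by (simp add: powr_half_sqrt)
  qed
  ultimately have f: "f_0 \<phi> = cis (- pi / 4) / of_real (8 * (pi * sqrt pi)) * (kappa * of_real (2 * pi) * S)"
    and cc: "cis (- pi / 4) * cis (- pi / 4) = - \<i>"
    unfolding f_0_def d by (simp_all only:)
  have "c / (8 * (p * q)) * (4 * \<i> * q * c * (2 * p) * S) = \<i> * (c * c) * S" if "p \<noteq> 0" "q \<noteq> 0" for c p q :: complex
    using that by simp
  from this[of "of_real pi" "of_real (sqrt pi)" "cis (- pi / 4)"] have "f_0 \<phi> = \<i> * (cis (- pi / 4) * cis (- pi / 4)) * S"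
    unfolding f by simp
  also have "\<dots> = S"
    unfolding cc by simp
  also have "S = (\<Sum>j. LINT s|lborel. radial \<phi> 0 (landau_level j) s)"
    unfolding S_def level_integral_def by simp
  finally show ?thesis .
qed

section \<open>The trace formula\<close>

text \<open>\<open>Y\<close> counts an eigenvalue by anonymous indices below its multiplicity;
  enumerating each fibre turns these indices into quantum numbers.\<close>

lemma bij_betw_choose_fibres:
  assumes "\<And>\<mu>. finite (S \<mu>)" "\<And>\<mu> \<mu>'. \<mu> \<noteq> \<mu>' \<Longrightarrow> S \<mu> \<inter> S \<mu>' = {}"
  obtains g where "bij_betw g {(\<mu>, i). i < card (S \<mu>)} (\<Union>\<mu>. S \<mu>)" "\<And>\<mu> i. i < card (S \<mu>) \<Longrightarrow> g (\<mu>, i) \<in> S \<mu>"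
proof -
  have "\<forall>\<mu>. \<exists>e. bij_betw e {0..<card (S \<mu>)} (S \<mu>)"
    using assms(1) ex_bij_betw_nat_finite by blast
  then obtain e where e: "\<And>\<mu>. bij_betw (e \<mu>) {0..<card (S \<mu>)} (S \<mu>)" by metis
  define g where "g = (\<lambda>(\<mu>, i). e \<mu> i)"
  have g: "g (\<mu>, i) \<in> S \<mu>" if "i < card (S \<mu>)" for \<mu> i
    using bij_betwE[OF e, of \<mu>] that by (auto simp: g_def)
  have "inj_on g {(\<mu>, i). i < card (S \<mu>)}"
  proof (rule inj_onI, clarify)
    fix \<mu> i \<mu>' i' assume *: "i < card (S \<mu>)" "i' < card (S \<mu>')" "g (\<mu>, i) = g (\<mu>', i')"
    then have "\<mu> = \<mu>'" using g[OF *(1)] g[OF *(2)] assms(2)[of \<mu> \<mu>'] by auto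
    then show "\<mu> = \<mu>' \<and> i = i'"
      using * bij_betw_imp_inj_on[OF e, of \<mu>] by (auto simp: g_def inj_on_def)
  qed
  moreover have "g ` {(\<mu>, i). i < card (S \<mu>)} = (\<Union>\<mu>. S \<mu>)"
  proof
    show "g ` {(\<mu>, i). i < card (S \<mu>)} \<subseteq> (\<Union>\<mu>. S \<mu>)" using g by blast
    show "(\<Union>\<mu>. S \<mu>) \<subseteq> g ` {(\<mu>, i). i < card (S \<mu>)}"
    proof
      fix x assume "x \<in> (\<Union>\<mu>. S \<mu>)"
      then obtain \<mu> where "x \<in> S \<mu>" by blast
      then have "x \<in> e \<mu> ` {0..<card (S \<mu>)}"
        using bij_betw_imp_surj_on[OF e, of \<mu>] by simp
      then obtain i where "i < card (S \<mu>)" "x = e \<mu> i" by auto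
      then show "x \<in> g ` {(\<mu>, i). i < card (S \<mu>)}" by (intro image_eqI[of _ _ "(\<mu>, i)"]) (auto simp: g_def)
    qed
  qed
  ultimately show ?thesis using that[of g] g by (simp add: bij_betw_def)
qed

lemma level_energy_scaled:
  assumes "N > 0"
  shows "level_energy N j m / real N = landau_level j + 4 * pi\<^sup>2 * (1 / sqrt N * of_int m)\<^sup>2"
proof -
  have "(1 / sqrt (real N) * of_int m)\<^sup>2 = (of_int m)\<^sup>2 / real N" by (simp add: power_mult_distrib power_divide)
  then show ?thesis
    using assms by (simp add: level_energy_def landau_level_def power_mult_distrib add_divide_distrib algebra_simps)
qed

text \<open>As \<mu> varies the sets \<open>level_set N \<mu>\<close> partition all triples (j, r,
  m) with r < N, and on each of them the summand depends on \<mu> alone.\<close>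

lemma Y_eq_infsum_levels:
  assumes N: "N > 0"
  shows "Y N \<phi> = infsum (\<lambda>(j, r, m). radial \<phi> 0 (landau_level j) (1 / sqrt N * of_int m)) (UNIV \<times> ({..<N} \<times> UNIV))"
proof -
  let ?f = "\<lambda>(j, r :: nat, m). radial \<phi> 0 (landau_level j) (1 / sqrt (real N) * of_int m)"
  have dis: "level_set N \<mu> \<inter> level_set N \<mu>' = {}" if "\<mu> \<noteq> \<mu>'" for \<mu> \<mu>'
    using that by (auto simp: level_set_def)
  obtain g where g: "bij_betw g {(\<mu>, i). i < card (level_set N \<mu>)} (\<Union>\<mu>. level_set N \<mu>)"
      "\<And>\<mu> i. i < card (level_set N \<mu>) \<Longrightarrow> g (\<mu>, i) \<in> level_set N \<mu>"
    using bij_betw_choose_fibres[of "level_set N", OF finite_level_set[OF N] dis] by blast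
  have U: "(\<Union>\<mu>. level_set N \<mu>) = UNIV \<times> ({..<N} \<times> UNIV)"
    by (auto simp: level_set_def)
  have "Y N \<phi> = (\<Sum>\<^sub>\<infinity>p\<in>{(\<mu>, i). i < card (level_set N \<mu>)}. ?f (g p))"
    unfolding Y_def eigen_mult_eq[OF N]
  proof (rule infsum_cong, clarify)
    fix \<mu> i assume i: "i < card (level_set N \<mu>)"
    obtain j r m where p: "g (\<mu>, i) = (j, r, m)" by (cases "g (\<mu>, i)")
    then have "\<mu> = level_energy N j m" using g(2)[OF i] by (simp add: level_set_def)
    then have "\<mu> / real N = landau_level j + 4 * pi\<^sup>2 * (1 / sqrt N * of_int m)\<^sup>2"
      by (simp only: level_energy_scaled[OF N])
    then show "\<phi> (\<mu> / real N) = ?f (g (\<mu>, i))" unfolding p prod.case radial_def by simp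
  qed
  also have "\<dots> = infsum ?f (\<Union>\<mu>. level_set N \<mu>)"
    by (rule infsum_reindex_bij_betw[OF g(1)])
  finally show ?thesis unfolding U .
qed

lemma summable_on_product:
  fixes a :: "'i \<Rightarrow> real" and b :: "'j \<Rightarrow> real"
  assumes "a summable_on A" "b summable_on B" "\<And>x. a x \<ge> 0" "\<And>y. b y \<ge> 0"
  shows "(\<lambda>(x, y). a x * b y) summable_on (A \<times> B)"
proof (rule summable_on_SigmaI[where g = "\<lambda>x. a x * infsum b B"])
  show "((\<lambda>y. case (x, y) of (x, y) \<Rightarrow> a x * b y) has_sum a x * infsum b B) B" for x
    using has_sum_cmult_right[OF has_sum_infsum[OF assms(2)], of "a x"] by simp
  show "(\<lambda>x. a x * infsum b B) summable_on A" by (rule summable_on_cmult_left[OF assms(1)])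
qed (use assms in auto)

text \<open>Absolute summability over the triples, from the product bound in j and m, permits
  iterated summation; the N values of r contribute equal terms.\<close>

lemma level_sum_sums:
  assumes N: "N > 0" and \<phi>: "\<phi> \<in> schwartz"
  shows "(\<lambda>j. of_nat N * infsum (\<lambda>m::int. radial \<phi> 0 (landau_level j) (1 / sqrt N * of_int m)) UNIV) sums Y N \<phi>"
proof -
  define h where "h = 1 / sqrt (real N)"
  have h: "0 < h" "h \<le> 1" using N by (auto simp: h_def)
  define F where "F j m = radial \<phi> 0 (landau_level j) (h * of_int m)" for j and m :: int
  obtain C where C: "C > 0" "\<And>l h s. l \<ge> 0 \<Longrightarrow> 0 < h \<Longrightarrow> h \<le> 1 \<Longrightarrow>
      norm (radial \<phi> 0 l (h * s)) \<le> C / ((1 + l)\<^sup>2 * h\<^sup>2) * (1 / (1 + s\<^sup>2))"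
    by (rule radial_scaled_bound[OF \<phi>]) (rule that)
  have le: "norm (F j m) \<le> (C / h\<^sup>2 / (1 + real j)\<^sup>2) * (1 * (1 / (1 + (real_of_int m)\<^sup>2)))" for j m
  proof -
    have "norm (F j m) \<le> C / h\<^sup>2 * (1 / (1 + landau_level j)\<^sup>2) * (1 / (1 + (real_of_int m)\<^sup>2))"
      using C(2)[OF landau_level_ge(2) h, of j "of_int m"] by (simp add: F_def mult.commute)
    also have "\<dots> \<le> C / h\<^sup>2 * (1 / (1 + real j)\<^sup>2) * (1 / (1 + (real_of_int m)\<^sup>2))"
      using C(1) by (intro mult_right_mono mult_left_mono inverse_landau_level_le) auto
    finally show ?thesis by simp
  qed
  have "summable (\<lambda>j. norm (C / h\<^sup>2 / (1 + real j)\<^sup>2))"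
    using summable_inverse_Suc_square[of "C / h\<^sup>2"] C(1) by simp
  then have sj: "(\<lambda>j. C / h\<^sup>2 / (1 + real j)\<^sup>2) summable_on UNIV" by (rule norm_summable_imp_summable_on)
  have sr: "(\<lambda>(r :: nat, m). 1 * (1 / (1 + (real_of_int m)\<^sup>2))) summable_on ({..<N} \<times> UNIV)"
    by (intro summable_on_product summable_on_int_inverse_square summable_on_finite) auto
  have "(\<lambda>(j, q). (C / h\<^sup>2 / (1 + real j)\<^sup>2) * (case q of (r :: nat, m) \<Rightarrow> 1 * (1 / (1 + (real_of_int m)\<^sup>2))))
      summable_on (UNIV \<times> ({..<N} \<times> UNIV))"
    using C(1) by (intro summable_on_product sj sr) (auto split: prod.split)
  then have "(\<lambda>p. norm (case p of (j, r :: nat, m) \<Rightarrow> F j m)) summable_on (UNIV \<times> ({..<N} \<times> UNIV))"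
  proof (rule summable_on_comparison_test)
    fix p :: "nat \<times> nat \<times> int"
    obtain j r m where p: "p = (j, r, m)" by (cases p)
    show "norm (case p of (j, r, m) \<Rightarrow> F j m) \<le> (case p of (j, q) \<Rightarrow> (C / h\<^sup>2 / (1 + real j)\<^sup>2) * (case q of (r, m) \<Rightarrow> 1 * (1 / (1 + (real_of_int m)\<^sup>2))))"
      unfolding p prod.case by (rule le)
  qed simp
  then have S: "(\<lambda>(j, r :: nat, m). F j m) summable_on (UNIV \<times> ({..<N} \<times> UNIV))"
    by (rule abs_summable_summable)
  have inner: "((\<lambda>q. case (j, q) of (j, r :: nat, m) \<Rightarrow> F j m) has_sum of_nat N * infsum (F j) UNIV) ({..<N} \<times> UNIV)" for j
  proof -
    have n: "(\<lambda>m. norm (F j m)) summable_on UNIV"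
      unfolding F_def by (rule radial_int_summable[OF \<phi> landau_level_ge(2) h])
    have "(\<lambda>(r :: nat, m). 1 * norm (F j m)) summable_on ({..<N} \<times> UNIV)"
      by (intro summable_on_product summable_on_finite n) auto
    then have "(\<lambda>p. norm (case p of (r :: nat, m) \<Rightarrow> F j m)) summable_on ({..<N} \<times> UNIV)"
      unfolding case_prod_unfold mult_1_left .
    then have s: "(\<lambda>(r :: nat, m). F j m) summable_on ({..<N} \<times> UNIV)" by (rule abs_summable_summable)
    have "((\<lambda>(r :: nat, m). F j m) has_sum of_nat N * infsum (F j) UNIV) ({..<N} \<times> UNIV)"
    proof (rule has_sum_SigmaI[OF _ _ s])
      show "((\<lambda>m. case (r, m) of (r :: nat, m) \<Rightarrow> F j m) has_sum infsum (F j) UNIV) UNIV" for r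
        using has_sum_infsum[OF abs_summable_summable[OF n]] by simp
      show "((\<lambda>r :: nat. infsum (F j) UNIV) has_sum of_nat N * infsum (F j) UNIV) {..<N}"
        by (rule has_sum_finiteI) auto
    qed
    then show ?thesis by simp
  qed
  have "((\<lambda>(j, r :: nat, m). F j m) has_sum Y N \<phi>) (UNIV \<times> ({..<N} \<times> UNIV))"
    using has_sum_infsum[OF S] unfolding Y_eq_infsum_levels[OF N] F_def h_def .
  from has_sum_SigmaD[OF this inner] have "((\<lambda>j. of_nat N * infsum (F j) UNIV) has_sum Y N \<phi>) UNIV" .
  then show ?thesis unfolding F_def h_def by (rule has_sum_imp_sums)
qed

text \<open>Rescaling s by sqrt N extracts sqrt N from each integral; with the factor N of the
  multiplicity this is N^(3/2).\<close>

lemma level_main_term_sums: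
  fixes \<phi> :: "real \<Rightarrow> complex"
  assumes N: "N > 0" and \<phi>: "\<phi> \<in> schwartz"
  shows "(\<lambda>j. of_nat N * (LINT s|lborel. radial \<phi> 0 (landau_level j) (1 / sqrt N * s))) sums (f_0 \<phi> * of_real (real N powr (3 / 2)))"
proof -
  have r: "(LINT s|lborel. radial \<phi> 0 (landau_level j) (1 / sqrt N * s)) = of_real (sqrt N) * (LINT s|lborel. radial \<phi> 0 (landau_level j) s)" for j
  proof -
    have "(LINT s|lborel. radial \<phi> 0 (landau_level j) s) = \<bar>1 / sqrt N\<bar> *\<^sub>R (LINT s|lborel. radial \<phi> 0 (landau_level j) (0 + 1 / sqrt N * s))"
      using N by (intro lborel_integral_real_affine) auto
    then show ?thesis using N by (simp add: scaleR_conv_of_real)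
  qed
  have p: "real N powr (3 / 2) = real N * sqrt N"
  proof -
    have "real N powr (1 + 1 / 2) = real N powr 1 * real N powr (1 / 2)" by (rule powr_add)
    then show ?thesis using N by (simp add: powr_half_sqrt)
  qed
  have "summable (\<lambda>j. LINT s|lborel. radial \<phi> 0 (landau_level j) s)"
    using level_integral_summable[OF \<phi> order_refl] by (simp add: level_integral_def)
  from summable_sums[OF this] have "(\<lambda>j. LINT s|lborel. radial \<phi> 0 (landau_level j) s) sums f_0 \<phi>"
    by (simp only: f_0_eq[OF \<phi>])
  from sums_mult[OF this, of "of_nat N * of_real (sqrt N)"] show ?thesis
    unfolding r p of_real_mult of_real_of_nat_eq by (simp only: mult_ac)
qed

theorem theorem9:
  fixes \<phi> :: "real \<Rightarrow> complex"
  assumes "\<phi> \<in> schwartz"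
  shows "\<forall>k::nat. (\<lambda>N::nat. Y N \<phi> - f_0 \<phi> * of_real (real N powr (3 / 2)))
           \<in> O(\<lambda>N. 1 / of_nat N ^ k)"
proof
  fix k :: nat
  \<comment> \<open>Since h^2 = 1/N, the power h^(2(k + 1)) is N^-(k + 1): one factor 1/N offsets
    the multiplicity N, and the rest is N^-k.\<close>
  obtain C where C: "C > 0" "\<And>l h. l \<ge> 0 \<Longrightarrow> 0 < h \<Longrightarrow> h \<le> 1 \<Longrightarrow>
    norm (infsum (\<lambda>m::int. radial \<phi> 0 l (h * of_int m)) UNIV - (LINT s|lborel. radial \<phi> 0 l (h * s))) \<le> C * h ^ (2 * (k + 1)) / (1 + l)\<^sup>2"
    using radial_sum_asymptotics[OF assms, of "2 * (k + 1)"] by blast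
  define Z where "Z = (\<Sum>j. C / (1 + real j)\<^sup>2)"
  have bound: "norm (Y N \<phi> - f_0 \<phi> * of_real (real N powr (3 / 2))) \<le> Z * (1 / real N ^ k)" if N: "N > 0" for N
  proof -
    define h where "h = 1 / sqrt (real N)"
    have h: "0 < h" "h \<le> 1" using N by (auto simp: h_def)
    define d where "d j = infsum (\<lambda>m::int. radial \<phi> 0 (landau_level j) (h * of_int m)) UNIV - (LINT s|lborel. radial \<phi> 0 (landau_level j) (h * s))" for j
    have sums: "(\<lambda>j. of_nat N * d j) sums (Y N \<phi> - f_0 \<phi> * of_real (real N powr (3 / 2)))"
      using sums_diff[OF level_sum_sums[OF N assms] level_main_term_sums[OF N assms]]
      by (simp only: d_def h_def right_diff_distrib)
    have "h\<^sup>2 = 1 / real N" using N by (simp add: h_def power_divide)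
    then have hk: "real N * h ^ (2 * (k + 1)) = 1 / real N ^ k"
      unfolding power_mult using N by (simp add: power_divide)
    have le: "norm (of_nat N * d j) \<le> 1 / real N ^ k * (C / (1 + real j)\<^sup>2)" for j
    proof -
      have "norm (of_nat N * d j) = real N * norm (d j)" by (simp add: norm_mult)
      also have "\<dots> \<le> real N * (C * h ^ (2 * (k + 1)) / (1 + landau_level j)\<^sup>2)"
        unfolding d_def by (intro mult_left_mono C(2) landau_level_ge h) auto
      also have "\<dots> = (real N * h ^ (2 * (k + 1))) * C * (1 / (1 + landau_level j)\<^sup>2)" by simp
      also have "\<dots> \<le> (real N * h ^ (2 * (k + 1))) * C * (1 / (1 + real j)\<^sup>2)"
        using C(1) h by (intro mult_left_mono inverse_landau_level_le) auto
      finally show ?thesis unfolding hk by simp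
    qed
    have s: "summable (\<lambda>j. 1 / real N ^ k * (C / (1 + real j)\<^sup>2))"
      by (intro summable_mult summable_inverse_Suc_square)
    have sn: "summable (\<lambda>j. norm (of_nat N * d j))"
      by (rule summable_comparison_test'[OF s]) (use le in simp)
    have "norm (Y N \<phi> - f_0 \<phi> * of_real (real N powr (3 / 2))) = norm (\<Sum>j. of_nat N * d j)"
      by (simp only: sums_unique[OF sums])
    also have "\<dots> \<le> (\<Sum>j. norm (of_nat N * d j))" by (rule summable_norm[OF sn])
    also have "\<dots> \<le> (\<Sum>j. 1 / real N ^ k * (C / (1 + real j)\<^sup>2))" by (rule suminf_le[OF le sn s])
    also have "\<dots> = 1 / real N ^ k * Z" unfolding Z_def by (intro suminf_mult summable_inverse_Suc_square)
    finally show ?thesis by (simp only: mult.commute)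
  qed
  show "(\<lambda>N::nat. Y N \<phi> - f_0 \<phi> * of_real (real N powr (3 / 2))) \<in> O(\<lambda>N. 1 / of_nat N ^ k)"
  proof (rule bigoI[where c = Z])
    show "\<forall>\<^sub>F N in sequentially. norm (Y N \<phi> - f_0 \<phi> * of_real (real N powr (3 / 2))) \<le> Z * norm (1 / of_nat N ^ k :: complex)"
      using eventually_gt_at_top[of 0]
    proof eventually_elim
      case (elim N)
      then show ?case using bound[of N] by (simp add: norm_divide norm_power)
    qed
  qed
qed

end
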